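(* Let $d\ge 3$ and let $Q$ be an external field on $\mathbb{S}^{d-1}$ that is rotationally invariant with respect to rotations about the polar axis. Suppose that the support of the extremal measure $\mu_Q$ is a spherical cap $S_Q=C_{S,\alpha}$ centered at the South Pole, and that $Q\in C^2(N)$, where $N$ is an open neighborhood of $S_Q=C_{S,\alpha}$ on the sphere $\mathbb{S}^{d-1}$. Then the extremal (equilibrium) measure $\mu_Q$ is absolutely continuous with respect to the Lebesgue surface measure, with a locally bounded density; that is, $d\mu_Q=f(\theta_1)\,d\sigma_d$, where $f\in L^\infty([\alpha,\pi])$.
   Context: $\mathbb{S}^{d-1}=\{x\in\mathbb{R}^d:|x|=1\}$, $d\ge3$, with Lebesgue surface measure $\sigma_d$. For $x=(x_1,\dots,x_d)\in\mathbb{S}^{d-1}$ the polar angle $\theta_1\in[0,\pi]$ is defined by $x_1=\cos\theta_1$; the polar axis is the $x_1$-axis, the North Pole is $(1,0,\dots,0)$ and the South Pole is $(-1,0,\dots,0)$. For $0<\alpha\le\pi$, $C_{S,\alpha}=\{x\in\mathbb{S}^{d-1}:\alpha\le\theta_1\le\pi\}$. An external field on $\mathbb{S}^{d-1}$ is a non-negative lower semicontinuous function $Q:\mathbb{S}^{d-1}\to[0,\infty]$ with $Q(x)<\infty$ on a set of positive surface measure. For a unit positive Borel measure $\mu$ on $\mathbb{S}^{d-1}$ put $$I(\mu)=\iint\frac{1}{|x-y|^{d-2}}\,d\mu(x)\,d\mu(y),\qquad I_Q(\mu)=I(\mu)+2\int Q\,d\mu,$$ and $V_Q=\inf\{I_Q(\mu)\}$,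 the infimum being over all unit positive Borel measures $\mu$ on $\mathbb{S}^{d-1}$. The extremal (or equilibrium) measure $\mu_Q$ is the unit positive Borel measure on $\mathbb{S}^{d-1}$ with $I_Q(\mu_Q)=V_Q$, and $S_Q=\operatorname{supp}\mu_Q$. *)

theory Defs
  imports "HOL-Probability.Probability"
begin

section \<open>Measures on the unit sphere\<close>

abbreviation usphere :: "'a::euclidean_space set" where
  "usphere \<equiv> sphere 0 1"

text \<open>
  Lebesgue surface measure in polar coordinates: the surface measure of \<open>A\<close> is \<open>d\<close> times the
  Lebesgue volume of the cone \<open>{t x | 0 < t < 1, x \<in> A}\<close>, where \<open>d\<close> is the dimension of the
  ambient space. The cone is obtained as a preimage under radial projection, see
  \<open>emeasure_surface_measure\<close> below.
\<close>

definition surface_measure :: "'a::euclidean_space measure" where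
  "surface_measure =
     scale_measure (of_nat DIM('a))
       (distr (restrict_space lborel (ball 0 1 - {0})) (restrict_space borel usphere)
          (\<lambda>x. x /\<^sub>R norm x))"

lemma sets_surface_measure [simp]:
  "sets surface_measure = sets (restrict_space borel usphere)"
  by (simp add: surface_measure_def)

lemma space_surface_measure [simp]: "space surface_measure = usphere"
  by (simp add: surface_measure_def space_scale_measure space_restrict_space)

lemma emeasure_surface_measure:
  fixes A :: "'a::euclidean_space set"
  assumes "A \<in> sets (restrict_space borel usphere)"
  shows "emeasure surface_measure A =
    of_nat DIM('a) * emeasure lborel {x \<in> ball 0 1 - {0}. x /\<^sub>R norm x \<in> A}"
proof -
  let ?M = "restrict_space lborel (ball 0 1 - {0}) :: 'a measure"
  have m: "(\<lambda>x. x /\<^sub>R norm x) \<in> ?M \<rightarrow>\<^sub>M restrict_space borel usphere"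
    by (rule measurable_restrict_space2)
       (auto simp: space_restrict_space intro!: measurable_restrict_space1)
  have "(\<lambda>x. x /\<^sub>R norm x) -` A \<inter> space ?M = {x \<in> ball 0 1 - {0}. x /\<^sub>R norm x \<in> A}"
    by (auto simp: space_restrict_space)
  moreover have "emeasure ?M {x \<in> ball 0 1 - {0}. x /\<^sub>R norm x \<in> A} =
      emeasure lborel {x \<in> ball 0 1 - {0}. x /\<^sub>R norm x \<in> A}"
    by (rule emeasure_restrict_space) auto
  ultimately show ?thesis
    using assms m unfolding surface_measure_def by (simp only: emeasure_scale_measure emeasure_distr)
qed

definition sphere_prob :: "'a::euclidean_space measure \<Rightarrow> bool" where
  "sphere_prob \<mu> \<longleftrightarrow> prob_space \<mu> \<and> sets \<mu> = sets (restrict_space borel usphere)"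

definition measure_support :: "'a::topological_space measure \<Rightarrow> 'a set" where
  "measure_support \<mu> = {x \<in> space \<mu>. \<forall>U. open U \<longrightarrow> x \<in> U \<longrightarrow> emeasure \<mu> (U \<inter> space \<mu>) > 0}"


section \<open>External fields and weighted energy\<close>

text \<open>Only the values of \<open>Q\<close> on the unit sphere matter.\<close>

definition external_field :: "('a::euclidean_space \<Rightarrow> ennreal) \<Rightarrow> bool" where
  "external_field Q \<longleftrightarrow>
     (\<forall>a. openin (top_of_set usphere) {x \<in> usphere. a < Q x}) \<and>
     emeasure surface_measure {x \<in> usphere. Q x < \<infinity>} > 0"

text \<open>
  The division takes place in \<^typ>\<open>ennreal\<close>, where \<open>1 / 0 = \<infinity>\<close>; hence the kernel is infinite on
  the diagonal as soon as the dimension exceeds 2, and measures with atoms have infinite energy.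
\<close>

definition newton_energy :: "'a::euclidean_space measure \<Rightarrow> ennreal" where
  "newton_energy \<mu> =
     (\<integral>\<^sup>+ x. \<integral>\<^sup>+ y. 1 / ennreal (norm (x - y) ^ (DIM('a) - 2)) \<partial>\<mu> \<partial>\<mu>)"

definition weighted_energy :: "('a::euclidean_space \<Rightarrow> ennreal) \<Rightarrow> 'a measure \<Rightarrow> ennreal" where
  "weighted_energy Q \<mu> = newton_energy \<mu> + 2 * (\<integral>\<^sup>+ x. Q x \<partial>\<mu>)"

definition min_energy :: "('a::euclidean_space \<Rightarrow> ennreal) \<Rightarrow> ennreal" where
  "min_energy Q = (INF \<mu>\<in>{\<mu>. sphere_prob \<mu>}. weighted_energy Q \<mu>)"

definition extremal_measure :: "('a::euclidean_space \<Rightarrow> ennreal) \<Rightarrow> 'a measure \<Rightarrow> bool" where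
  "extremal_measure Q \<mu> \<longleftrightarrow> sphere_prob \<mu> \<and> weighted_energy Q \<mu> = min_energy Q"


section \<open>Polar axis\<close>

text \<open>The polar axis is the coordinate axis with index \<open>k\<close>, and \<open>axis k 1\<close> is the North Pole.\<close>

definition polar_angle :: "'n \<Rightarrow> real ^ 'n \<Rightarrow> real" where
  "polar_angle k x = arccos (x $ k)"

definition south_cap :: "'n::finite \<Rightarrow> real \<Rightarrow> (real ^ 'n) set" where
  "south_cap k \<alpha> = {x \<in> usphere. \<alpha> \<le> polar_angle k x \<and> polar_angle k x \<le> pi}"

definition rotationally_invariant :: "'n::finite \<Rightarrow> (real ^ 'n \<Rightarrow> 'b) \<Rightarrow> bool" where
  "rotationally_invariant k Q \<longleftrightarrow>
     (\<forall>R. rotation_matrix R \<longrightarrow> R *v axis k 1 = axis k 1 \<longrightarrow> (\<forall>x\<in>usphere. Q (R *v x) = Q x))"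


section \<open>Regularity\<close>

definition C2_on :: "'a::real_normed_vector set \<Rightarrow> ('a \<Rightarrow> real) \<Rightarrow> bool" where
  "C2_on U g \<longleftrightarrow>
     (\<exists>(g' :: 'a \<Rightarrow> 'a \<Rightarrow>\<^sub>L real) (g'' :: 'a \<Rightarrow> 'a \<Rightarrow>\<^sub>L 'a \<Rightarrow>\<^sub>L real).
        (\<forall>x\<in>U. (g has_derivative blinfun_apply (g' x)) (at x)) \<and>
        (\<forall>x\<in>U. (g' has_derivative blinfun_apply (g'' x)) (at x)) \<and>
        continuous_on U g'')"

text \<open>
  A function on an open subset \<open>N\<close> of the sphere is of class \<open>C\<^sup>2\<close> if near every point of \<open>N\<close> it
  is the restriction of a \<open>C\<^sup>2\<close> function on an open set of the ambient space.
\<close>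

definition C2_on_submanifold :: "'a::real_normed_vector set \<Rightarrow> ('a \<Rightarrow> real) \<Rightarrow> bool" where
  "C2_on_submanifold N f \<longleftrightarrow>
     (\<forall>x\<in>N. \<exists>U g. open U \<and> x \<in> U \<and> C2_on U g \<and> (\<forall>y\<in>U \<inter> N. f y = g y))"

text \<open>Membership in \<open>L\<^sup>\<infinity>(M)\<close>.\<close>

definition ess_bounded :: "'a measure \<Rightarrow> ('a \<Rightarrow> real) \<Rightarrow> bool" where
  "ess_bounded M f \<longleftrightarrow> f \<in> borel_measurable M \<and> (\<exists>B. AE x in M. \<bar>f x\<bar> \<le> B)"

end

theory Submission
  imports Defs
begin

text \<open>
  Write \<open>U\<close> for the potential of the extremal measure \<open>\<mu>\<close> and \<open>F\<close> for the equilibrium constant, so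
  that \<open>U + Q \<ge> F\<close> almost everywhere on the sphere and \<open>U + Q \<le> F\<close> on the support. For a point
  \<open>z = (1 - t) x\<close> inside the ball, sweeping the mass \<open>\<sigma>(S)\<close> at \<open>z\<close> onto the sphere \<open>S\<close> gives a measure
  with Poisson density \<open>P\<close> which is symmetric about \<open>x\<close>, and \<open>\<integral> U P d\<sigma> \<le> \<sigma>(S) U(z)\<close>. If \<open>x\<close> is in the
  support, the symmetric second differences of \<open>U\<close> at \<open>x\<close> are at least \<open>-C |y - x|\<^sup>2\<close>: near \<open>x\<close> because
  \<open>Q\<close> is of class \<open>C\<^sup>2\<close>, and elsewhere because \<open>0 \<le> U\<close> and \<open>U(x) \<le> F\<close>. Integrating against \<open>P\<close> gives
  \<open>U(x) \<le> U(z) + C' t\<close>. The kernel loses at least \<open>t\<close> to the power \<open>2 - d\<close> between \<open>x\<close> and \<open>z\<close> at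
  points closer to \<open>x\<close> than \<open>t / 2\<close>, hence the ball of radius \<open>t / 2\<close> about \<open>x\<close> has \<open>\<mu>\<close>-mass at most
  \<open>C''\<close> times \<open>t\<close> to the power \<open>d - 1\<close>, that is, \<open>\<mu> \<le> B \<sigma>\<close>.

  The energy is positive definite, so \<open>\<mu>\<close> is the only extremal measure and therefore inherits the
  axial symmetry of \<open>Q\<close>; an axially symmetric measure is determined by its image under the height,
  and the density of this image with respect to the image of \<open>\<sigma>\<close> is the function \<open>f\<close>.
\<close>

section \<open>Comparing measures on balls\<close>

text \<open>The exponent d - 2 enters through the inversion that exchanges the two ends of every
  chord through \<open>z\<close>. It distorts distances by an explicit factor and surface measure by
  the power d - 1 of its conformal factor. Substituting it turns the Poisson density into the
  Newtonian kernel, and the swept potential of a point mass into a multiple of the potential of the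
  sphere itself.

  The obstacle is that \<open>U\<close> is merely lower semicontinuous and
  \<open>U + Q \<ge> F\<close> holds only almost everywhere, so no derivative of \<open>U\<close> is
  at hand. Second differences therefore enter under the integral against \<open>P\<close>, where
  null sets are harmless.

  Measures are compared through their masses on small balls, because surface measure, like Lebesgue
  measure, gives equal mass to balls of equal radius about points of its support. One averaging
  argument then yields domination by surface measure, uniqueness of the extremal measure and
  recovery of an axially symmetric measure from its heights. Positive definiteness fits in: the
  kernel is a superposition of products of indicators of balls, so the energy is a square integral
  of ball masses.\<close>

lemma emeasure_times_ball_measure:
  fixes \<sigma> \<mu> :: "'a::euclidean_space measure"
  assumes [measurable_cong]: "sets \<sigma> = sets borel" "sets \<mu> = sets borel"
    and "sigma_finite_measure \<sigma>" "sigma_finite_measure \<mu>"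
    and c: "\<And>x. x \<in> S \<Longrightarrow> emeasure \<sigma> (ball x r) = c"
    and S: "AE x in \<mu>. x \<in> S"
    and K: "K \<in> sets borel" 
  shows "c * emeasure \<mu> K = (\<integral>\<^sup>+y. emeasure \<mu> (K \<inter> ball y r) \<partial>\<sigma>)"
proof -
  interpret \<sigma>: sigma_finite_measure \<sigma> by fact
  interpret \<mu>: sigma_finite_measure \<mu> by fact
  interpret P: pair_sigma_finite \<mu> \<sigma> ..
  note K [measurable]
  have b: "ball x r \<in> sets \<sigma>" for x using assms by auto
  have KB: "emeasure \<mu> (K \<inter> ball y r) = (\<integral>\<^sup>+x. indicator K x * (if dist x y < r then 1 else 0) \<partial>\<mu>)" for y
  proof -
    have "emeasure \<mu> (K \<inter> ball y r) = (\<integral>\<^sup>+x. indicator (K \<inter> ball y r) x \<partial>\<mu>)"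
      using assms by (intro nn_integral_indicator [symmetric]) auto
    also have "\<dots> = (\<integral>\<^sup>+x. indicator K x * (if dist x y < r then 1 else 0) \<partial>\<mu>)"
      by (intro nn_integral_cong) (auto simp: indicator_def dist_commute)
    finally show ?thesis .
  qed
  have "c * emeasure \<mu> K = (\<integral>\<^sup>+x. c * indicator K x \<partial>\<mu>)"
    using assms by (subst nn_integral_cmult) auto
  also have "\<dots> = (\<integral>\<^sup>+x. (\<integral>\<^sup>+y. indicator K x * (if dist x y < r then 1 else 0) \<partial>\<sigma>) \<partial>\<mu>)"
  proof (rule nn_integral_cong_AE)
    show "AE x in \<mu>. c * indicator K x = (\<integral>\<^sup>+y. indicator K x * (if dist x y < r then 1 else 0) \<partial>\<sigma>)"
      using S
    proof eventually_elim
      case (elim x)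
      have "(\<integral>\<^sup>+y. indicator K x * (if dist x y < r then 1 else 0) \<partial>\<sigma>) = 
        (\<integral>\<^sup>+y. indicator K x * indicator (ball x r) y \<partial>\<sigma>)"
        by (intro nn_integral_cong) (auto simp: indicator_def)
      also have "\<dots> = indicator K x * emeasure \<sigma> (ball x r)"
        using b by (subst nn_integral_cmult) (auto intro!: borel_measurable_indicator)
      finally show ?case using c[OF elim] by (simp add: mult.commute)
    qed
  qed
  also have "\<dots> = (\<integral>\<^sup>+y. (\<integral>\<^sup>+x. indicator K x * (if dist x y < r then 1 else 0) \<partial>\<mu>) \<partial>\<sigma>)"
    by (rule P.Fubini'[symmetric]) measurable
  finally show ?thesis by (simp only: KB)
qed

text \<open>
  Integrating \<open>\<mu>(K \<inter> ball y r)\<close> over \<open>y\<close> counts every point of \<open>K\<close> with the same weight \<open>c r\<close>, so a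
  bound on balls turns into a bound on \<open>K\<close>, up to a neighbourhood of \<open>K\<close> that shrinks with \<open>r\<close>.
\<close>

lemma compact_ball_domination:
  fixes \<sigma> \<mu> \<nu> :: "'a::euclidean_space measure"
  assumes [measurable_cong]: "sets \<sigma> = sets borel" "sets \<mu> = sets borel" "sets \<nu> = sets borel"
    and sf: "sigma_finite_measure \<sigma>" "sigma_finite_measure \<mu>" "sigma_finite_measure \<nu>"
    and c: "\<And>x r. x \<in> S \<Longrightarrow> r > 0 \<Longrightarrow> emeasure \<sigma> (ball x r) = c r"
    and c0: "\<And>r. r > 0 \<Longrightarrow> 0 < c r" "\<And>r. r > 0 \<Longrightarrow> c r < \<infinity>"
    and S: "AE x in \<mu>. x \<in> S" "AE x in \<nu>. x \<in> S"
    and r: "\<And>n. r n > 0" "r \<longlonglongrightarrow> 0"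
    and le: "\<And>n. AE y in \<sigma>. emeasure \<mu> (ball y (r n)) \<le> ennreal C * emeasure \<nu> (ball y (r n))"
    and K: "compact K" 
    and fin: "\<And>L. compact L \<Longrightarrow> emeasure \<nu> L < \<infinity>"
  shows "emeasure \<mu> K \<le> ennreal C * emeasure \<nu> K"
proof (cases "K = {}")
  case False
  \<comment> \<open>\<open>L t\<close> is the closed \<open>t\<close>-neighbourhood of
    \<open>K\<close>, written as a sum of compact sets so that it is compact.\<close>
  define L where "L t = (\<Union>x\<in>K. \<Union>y\<in>cball 0 t. {x + y})" for t
  have L_compact: "compact (L t)" for t unfolding L_def by (rule compact_sums') (use K in auto)
  have memL: "z \<in> L t \<longleftrightarrow> (\<exists>x\<in>K. dist x z \<le> t)" for z t
  proof
    show "z \<in> L t \<Longrightarrow> \<exists>x\<in>K. dist x z \<le> t" by (force simp: L_def dist_norm)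
    assume "\<exists>x\<in>K. dist x z \<le> t"
    then obtain x where "x \<in> K" "dist x z \<le> t" by auto
    then have "z - x \<in> cball 0 t" "z \<in> {x + (z - x)}" by (auto simp: dist_norm norm_minus_commute)
    then show "z \<in> L t" unfolding L_def using \<open>x \<in> K\<close> by blast
  qed
  have Lm [measurable]: "L t \<in> sets borel" for t using L_compact borel_compact by blast
  have Km [measurable]: "K \<in> sets borel" using K borel_compact by blast
  \<comment> \<open>The factor 2 arises because a ball of radius \<open>r n\<close> that meets
    \<open>K\<close> lies within \<open>2 * r n\<close> of \<open>K\<close>. After averaging,
    \<open>c (r n)\<close> cancels.\<close>
  have key: "emeasure \<mu> K \<le> ennreal C * emeasure \<nu> (L (2 * r n))" for n
  proof -
    have rn: "r n > 0" by (rule r)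
    have "c (r n) * emeasure \<mu> K = (\<integral>\<^sup>+y. emeasure \<mu> (K \<inter> ball y (r n)) \<partial>\<sigma>)"
      by (rule emeasure_times_ball_measure[where S=S]) (use assms rn in auto)
    also have "\<dots> \<le> (\<integral>\<^sup>+y. ennreal C * emeasure \<nu> (L (2 * r n) \<inter> ball y (r n)) \<partial>\<sigma>)"
    proof (rule nn_integral_mono_AE)
      show "AE y in \<sigma>. emeasure \<mu> (K \<inter> ball y (r n)) \<le> ennreal C * emeasure \<nu> (L (2 * r n) \<inter> ball y (r n))"
        using le[of n]
      proof eventually_elim
        case (elim y)
        show ?case
        proof (cases "K \<inter> ball y (r n) = {}")
          case False
          then obtain x where x: "x \<in> K" "dist y x < r n" by auto
          have "ball y (r n) \<subseteq> L (2 * r n)"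
          proof
            fix z assume "z \<in> ball y (r n)"
            then have "dist x z \<le> 2 * r n" using x dist_triangle[of x z y] by (simp add: dist_commute)
            then show "z \<in> L (2 * r n)" using x memL by auto
          qed
          then have "L (2 * r n) \<inter> ball y (r n) = ball y (r n)" by auto
          moreover have "emeasure \<mu> (K \<inter> ball y (r n)) \<le> emeasure \<mu> (ball y (r n))"
            by (rule emeasure_mono) auto
          ultimately show ?thesis using elim by simp
        qed simp
      qed
    qed
    also have "\<dots> = ennreal C * (\<integral>\<^sup>+y. emeasure \<nu> (L (2 * r n) \<inter> ball y (r n)) \<partial>\<sigma>)"
    proof (rule nn_integral_cmult)
      interpret \<nu>: sigma_finite_measure \<nu> by fact
      have eq: "emeasure \<nu> (L (2 * r n) \<inter> ball y (r n)) = (\<integral>\<^sup>+x. (if x \<in> L (2 * r n) \<and> dist y x < r n then 1 else 0) \<partial>\<nu>)" for y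
      proof -
        have "emeasure \<nu> (L (2 * r n) \<inter> ball y (r n)) = (\<integral>\<^sup>+x. indicator (L (2 * r n) \<inter> ball y (r n)) x \<partial>\<nu>)"
          using assms(3) by (intro nn_integral_indicator [symmetric]) auto
        also have "\<dots> = (\<integral>\<^sup>+x. (if x \<in> L (2 * r n) \<and> dist y x < r n then 1 else 0) \<partial>\<nu>)"
          by (intro nn_integral_cong) (auto simp: indicator_def)
        finally show ?thesis .
      qed
      show "(\<lambda>y. emeasure \<nu> (L (2 * r n) \<inter> ball y (r n))) \<in> borel_measurable \<sigma>"
        unfolding eq by measurable
    qed
    also have "(\<integral>\<^sup>+y. emeasure \<nu> (L (2 * r n) \<inter> ball y (r n)) \<partial>\<sigma>) = c (r n) * emeasure \<nu> (L (2 * r n))"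
      by (rule emeasure_times_ball_measure[where S=S, symmetric]) (use assms rn in auto)
    finally have "c (r n) * emeasure \<mu> K \<le> c (r n) * (ennreal C * emeasure \<nu> (L (2 * r n)))"
      by (simp add: ac_simps)
    then show ?thesis
      using c0[OF rn] by (simp add: ennreal_mult_le_mult_iff)
  qed
  have lim: "(\<lambda>m. emeasure \<nu> (L (1 / Suc m))) \<longlonglongrightarrow> emeasure \<nu> (\<Inter>m. L (1 / Suc m))"
  proof (rule Lim_emeasure_decseq)
    show "decseq (\<lambda>m. L (1 / Suc m))"
    proof (rule decseq_SucI)
      fix m
      have le: "1 / real (Suc (Suc m)) \<le> 1 / real (Suc m)" by (simp add: field_simps)
      show "L (1 / real (Suc (Suc m))) \<subseteq> L (1 / real (Suc m))"
      proof
        fix z assume "z \<in> L (1 / real (Suc (Suc m)))"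
        then obtain x where x: "x \<in> K" "dist x z \<le> 1 / real (Suc (Suc m))" using memL by blast
        then have "dist x z \<le> 1 / real (Suc m)" using le by linarith
        then show "z \<in> L (1 / real (Suc m))" using x memL by blast
      qed
    qed
  qed (use fin[OF L_compact] assms in \<open>auto simp: less_top\<close>)
  have Int: "(\<Inter>m. L (1 / Suc m)) = K"
  proof -
    have "z \<in> K" if z: "\<And>m. z \<in> L (1 / Suc m)" for z
    proof -
      have "infdist z K \<le> 1 / Suc m" for m
      proof -
        obtain x where "x \<in> K" "dist x z \<le> 1 / Suc m" using z memL by blast
        then show ?thesis using infdist_le[of x K z] by (simp add: dist_commute)
      qed
      then have "infdist z K \<le> 0"
        by (intro LIMSEQ_le_const[OF LIMSEQ_Suc[OF lim_1_over_n]]) auto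
      then have "infdist z K = 0" using infdist_nonneg[of z K] by linarith
      then show ?thesis using K False in_closed_iff_infdist_zero compact_imp_closed by blast
    qed
    moreover have "z \<in> L (1 / Suc m)" if "z \<in> K" for z m using that memL by (auto intro!: bexI[of _ z])
    ultimately show ?thesis by auto
  qed
  have "emeasure \<mu> K \<le> ennreal C * emeasure \<nu> (L (1 / Suc m))" for m
  proof -
    have "eventually (\<lambda>n. r n < 1 / (2 * Suc m)) sequentially"
      by (rule order_tendstoD[OF r(2)]) simp
    then obtain n where n: "r n < 1 / (2 * Suc m)" by (auto simp: eventually_sequentially)
    have "2 * r n \<le> 1 / Suc m" using n by (simp add: field_simps)
    then have "L (2 * r n) \<subseteq> L (1 / Suc m)" using memL by force
    then have "emeasure \<nu> (L (2 * r n)) \<le> emeasure \<nu> (L (1 / Suc m))" by (rule emeasure_mono) simp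
    then show ?thesis using key[of n] by (meson mult_left_mono order_trans zero_le)
  qed
  moreover have "(\<lambda>m. ennreal C * emeasure \<nu> (L (1 / Suc m))) \<longlonglongrightarrow> ennreal C * emeasure \<nu> K"
    using ennreal_tendsto_cmult[OF _ lim, of "ennreal C"] Int by simp
  ultimately show ?thesis by (intro LIMSEQ_le_const) auto
qed auto

text \<open>Finite Borel measures on a Euclidean space are inner regular, so the bound on compact
  sets carries over to all Borel sets.\<close>

lemma ball_domination:
  fixes \<sigma> \<mu> \<nu> :: "'a::euclidean_space measure"
  assumes sets: "sets \<sigma> = sets borel" "sets \<mu> = sets borel" "sets \<nu> = sets borel"
    and sf: "sigma_finite_measure \<sigma>" "finite_measure \<mu>" "finite_measure \<nu>"
    and c: "\<And>x r. x \<in> S \<Longrightarrow> r > 0 \<Longrightarrow> emeasure \<sigma> (ball x r) = c r"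
    and c0: "\<And>r. r > 0 \<Longrightarrow> 0 < c r" "\<And>r. r > 0 \<Longrightarrow> c r < \<infinity>"
    and S: "AE x in \<mu>. x \<in> S" "AE x in \<nu>. x \<in> S"
    and r: "\<And>n. r n > 0" "r \<longlonglongrightarrow> 0"
    and le: "\<And>n. AE y in \<sigma>. emeasure \<mu> (ball y (r n)) \<le> ennreal C * emeasure \<nu> (ball y (r n))"
    and A: "A \<in> sets borel"
  shows "emeasure \<mu> A \<le> ennreal C * emeasure \<nu> A"
proof -
  interpret \<mu>: finite_measure \<mu> by fact
  interpret \<nu>: finite_measure \<nu> by fact
  have "emeasure \<mu> A = (SUP K \<in> {K. K \<subseteq> A \<and> compact K}. emeasure \<mu> K)"
    by (rule inner_regular) (use assms in \<open>auto simp: \<mu>.emeasure_eq_measure\<close>)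
  also have "\<dots> \<le> ennreal C * emeasure \<nu> A"
  proof (rule SUP_least)
    fix K assume "K \<in> {K. K \<subseteq> A \<and> compact K}"
    then have K: "K \<subseteq> A" "compact K" by auto
    have "emeasure \<mu> K \<le> ennreal C * emeasure \<nu> K"
    proof (rule compact_ball_domination[where \<sigma>=\<sigma> and S=S and c=c and r=r])
      show "sigma_finite_measure \<mu>" "sigma_finite_measure \<nu>" by unfold_locales
      show "emeasure \<nu> L < \<infinity>" for L by (simp add: \<nu>.emeasure_eq_measure)
    qed (use assms K in auto)
    also have "\<dots> \<le> ennreal C * emeasure \<nu> A"
      by (intro mult_left_mono emeasure_mono) (use K A sets in auto)
    finally show "emeasure \<mu> K \<le> ennreal C * emeasure \<nu> A" .
  qed
  finally show ?thesis .
qed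

text \<open>Domination with constant 1 in both directions. It serves twice: averaging over Lebesgue
  measure for the uniqueness of the extremal measure, and over surface measure for axially symmetric
  measures.\<close>

lemma measure_eq_of_balls:
  fixes \<sigma> \<mu> \<nu> :: "'a::euclidean_space measure"
  assumes sets: "sets \<sigma> = sets borel" "sets \<mu> = sets borel" "sets \<nu> = sets borel"
    and sf: "sigma_finite_measure \<sigma>" "finite_measure \<mu>" "finite_measure \<nu>"
    and c: "\<And>x r. x \<in> S \<Longrightarrow> r > 0 \<Longrightarrow> emeasure \<sigma> (ball x r) = c r"
    and c0: "\<And>r. r > 0 \<Longrightarrow> 0 < c r" "\<And>r. r > 0 \<Longrightarrow> c r < \<infinity>"
    and S: "AE x in \<mu>. x \<in> S" "AE x in \<nu>. x \<in> S"
    and r: "\<And>n. r n > 0" "r \<longlonglongrightarrow> 0"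
    and eq: "\<And>n. AE y in \<sigma>. emeasure \<mu> (ball y (r n)) = emeasure \<nu> (ball y (r n))"
  shows "\<mu> = \<nu>"
proof (rule measure_eqI)
  have le: "AE y in \<sigma>. emeasure \<mu> (ball y (r n)) \<le> ennreal 1 * emeasure \<nu> (ball y (r n))"
    "AE y in \<sigma>. emeasure \<nu> (ball y (r n)) \<le> ennreal 1 * emeasure \<mu> (ball y (r n))" for n
    using eq[of n] by (auto elim!: eventually_mono)
  fix A assume A: "A \<in> sets \<mu>"
  have "emeasure \<mu> A \<le> ennreal 1 * emeasure \<nu> A"
    by (rule ball_domination[where \<sigma>=\<sigma> and S=S and c=c and r=r]) (use assms A le in simp_all)
  moreover have "emeasure \<nu> A \<le> ennreal 1 * emeasure \<mu> A"
    by (rule ball_domination[where \<sigma>=\<sigma> and S=S and c=c and r=r]) (use assms A le in simp_all)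
  ultimately show "emeasure \<mu> A = emeasure \<nu> A" by simp
qed (use assms in simp)

text \<open>An isometry pulls balls back to balls of the same volume, and the masses of balls
  determine a measure. Domain and codomain may be different types because surface measure is later
  carried over to another index type.\<close>

lemma distr_lborel_isometry:
  fixes f :: "'a::euclidean_space \<Rightarrow> 'b::euclidean_space"
  assumes iso: "\<And>x y. dist (f x) (f y) = dist x y" and "surj f"
    and dim: "DIM('a) = DIM('b)"
  shows "distr lborel borel f = lborel"
proof -
  have "continuous_on UNIV f"
    using iso by (auto simp: continuous_on_iff)
  then have f [measurable]: "f \<in> borel_measurable borel" by (rule borel_measurable_continuous_onI)
  have inj: "inj f" using iso by (metis dist_eq_0_iff injI)
  define g where "g = inv f"
  have fg: "f (g y) = y" for y unfolding g_def using \<open>surj f\<close> by (simp add: surj_f_inv_f)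
  have gf: "g (f x) = x" for x unfolding g_def using inj by simp
  have giso: "dist (g x) (g y) = dist x y" for x y using iso[of "g x" "g y"] by (simp add: fg)
  have "continuous_on UNIV g" using giso by (auto simp: continuous_on_iff)
  let ?M = "distr lborel borel f"
  have ball: "emeasure ?M (ball y r) = emeasure lborel (ball y r)" if "r > 0" for y :: 'b and r
  proof -
    have "f -` ball y r = ball (g y) r" using iso[of "g y"] by (auto simp: fg)
    then show ?thesis using that by (simp add: emeasure_distr emeasure_ball dim)
  qed
  have vi: "f -` X = g ` X" for X
  proof
    show "f -` X \<subseteq> g ` X" by (metis gf image_iff subsetI vimage_eq)
  qed (auto simp: fg)
  have fin: "emeasure ?M L < \<infinity>" if "compact L" for L
  proof -
    have "compact (g ` L)"
      using that \<open>continuous_on UNIV g\<close> by (meson compact_continuous_image continuous_on_subset subset_UNIV)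
    then show ?thesis using that emeasure_compact_finite[OF \<open>compact (g ` L)\<close>]
      by (simp add: emeasure_distr borel_compact vi)
  qed
  have fin': "emeasure lborel L < \<top>" if "compact L" for L :: "'b set"
    using emeasure_compact_finite[OF that] by simp
  have sfM: "sigma_finite_measure ?M"
  proof (unfold_locales, intro exI conjI)
    show "countable (range (\<lambda>n. cball (0::'b) (real n)))" by simp
    show "\<Union> (range (\<lambda>n. cball (0::'b) (real n))) = space ?M"
      using real_arch_simple by auto
    show "\<forall>a\<in>range (\<lambda>n. cball 0 (real n)). emeasure ?M a \<noteq> \<infinity>"
      using fin by (auto simp: less_top)
  qed auto
  have K: "emeasure ?M K = emeasure lborel K" if "compact K" for K
  proof -
    have r: "(\<lambda>n. inverse (real (Suc n))) \<longlonglongrightarrow> 0" by (rule LIMSEQ_inverse_real_of_nat)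
    have c: "unit_ball_vol (real DIM('b)) > 0" by simp
    have "emeasure ?M K \<le> ennreal 1 * emeasure lborel K"
      by (rule compact_ball_domination[where \<sigma>=lborel and S=UNIV and c="\<lambda>r. ennreal (unit_ball_vol (real DIM('b)) * r ^ DIM('b))" and r="\<lambda>n. inverse (real (Suc n))"])
        (use r that sfM in \<open>auto simp: emeasure_ball ball sigma_finite_lborel fin' c ennreal_zero_less_mult_iff less_top simp del: of_nat_Suc\<close>)
    moreover have "emeasure lborel K \<le> ennreal 1 * emeasure ?M K"
      by (rule compact_ball_domination[where \<sigma>=lborel and S=UNIV and c="\<lambda>r. ennreal (unit_ball_vol (real DIM('b)) * r ^ DIM('b))" and r="\<lambda>n. inverse (real (Suc n))"])
        (use r that sfM fin in \<open>auto simp: emeasure_ball ball sigma_finite_lborel fin' c ennreal_zero_less_mult_iff less_top simp del: of_nat_Suc\<close>)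
    ultimately show ?thesis by simp
  qed
  show ?thesis
  proof (rule lborel_eqI[symmetric])
    fix l u :: 'b assume lu: "\<And>b. b \<in> Basis \<Longrightarrow> l \<bullet> b \<le> u \<bullet> b"
    \<comment> \<open>Inner regularity concerns finite measures, so \<open>N\<close> is first cut
      down to the box.\<close>
    have inner: "emeasure N (box l u) = (SUP K\<in>{K. K \<subseteq> box l u \<and> compact K}. emeasure N K)"
      if N: "sets N = sets borel" and NF: "\<And>L. compact L \<Longrightarrow> emeasure N L < \<infinity>" for N
    proof -
      let ?N = "density N (indicator (box l u))"
      have e: "emeasure ?N X = emeasure N (box l u \<inter> X)" if "X \<in> sets borel" for X
      proof -
        have "emeasure ?N X = (\<integral>\<^sup>+x. indicator (box l u) x * indicator X x \<partial>N)"
          using that N by (intro emeasure_density) (auto intro!: borel_measurable_indicator)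
        also have "\<dots> = (\<integral>\<^sup>+x. indicator (box l u \<inter> X) x \<partial>N)"
          by (intro nn_integral_cong) (auto simp: indicator_def)
        finally show ?thesis using that N by (simp add: nn_integral_indicator)
      qed
      have "emeasure N (box l u) \<le> emeasure N (cbox l u)"
        by (rule emeasure_mono) (auto simp: N box_subset_cbox)
      then have "emeasure ?N (space ?N) \<noteq> \<infinity>"
        using e[of UNIV] NF[of "cbox l u"] N sets_eq_imp_space_eq[OF N] by (auto simp: less_top)
      moreover have "sets ?N = sets borel" using N by simp
      ultimately have "emeasure ?N (box l u) = (SUP K\<in>{K. K \<subseteq> box l u \<and> compact K}. emeasure ?N K)"
        by (intro inner_regular) auto
      also have "\<dots> = (SUP K\<in>{K. K \<subseteq> box l u \<and> compact K}. emeasure N K)"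
        by (intro SUP_cong) (auto simp: e borel_compact Int_absorb1)
      finally show ?thesis by (simp add: e)
    qed
    have "emeasure ?M (box l u) = (SUP K\<in>{K. K \<subseteq> box l u \<and> compact K}. emeasure ?M K)"
      by (rule inner) (use fin in auto)
    also have "\<dots> = (SUP K\<in>{K. K \<subseteq> box l u \<and> compact K}. emeasure lborel K)"
      by (intro SUP_cong) (auto simp: K)
    also have "\<dots> = emeasure lborel (box l u)"
      by (rule inner[symmetric]) (auto simp: fin')
    finally show "emeasure ?M (box l u) = (\<Prod>b\<in>Basis. (u - l) \<bullet> b)"
      using lu by (simp add: emeasure_lborel_box_eq)
  qed simp
qed

section \<open>Surface measure\<close>

text \<open>Surface measure as a Borel measure on the whole space carried by the sphere, so that
  integrands only have to be Borel on the whole space.\<close>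

definition sphere_area :: "'a::euclidean_space measure" where
  "sphere_area = distr surface_measure borel (\<lambda>x. x)"

lemma sets_sphere_area [simp, measurable_cong]: "sets sphere_area = sets borel"
  by (simp add: sphere_area_def)

lemma space_sphere_area [simp]: "space sphere_area = UNIV"
  by (simp add: sphere_area_def)

lemma measurable_sphere_area1 [simp]: "measurable sphere_area N = measurable borel N"
  by (rule measurable_cong_sets) simp_all

lemma measurable_id_surface_measure: "(\<lambda>x. x) \<in> surface_measure \<rightarrow>\<^sub>M borel"
proof -
  have "(\<lambda>x. x) \<in> restrict_space borel usphere \<rightarrow>\<^sub>M borel"
    by (rule measurable_restrict_space1) simp
  then show ?thesis by (simp cong: measurable_cong_sets)
qed

lemma emeasure_sphere_area_eq:
  "A \<in> sets borel \<Longrightarrow> emeasure sphere_area A = emeasure surface_measure (A \<inter> usphere)"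
  by (simp add: sphere_area_def emeasure_distr measurable_id_surface_measure vimage_def Int_def)

lemma emeasure_sphere_area:
  fixes A :: "'a::euclidean_space set"
  assumes [measurable]: "A \<in> sets borel"
  shows "emeasure sphere_area A = of_nat DIM('a) * emeasure lborel {x \<in> ball 0 1 - {0}. sgn x \<in> A}"
proof -
  have "A \<inter> usphere \<in> sets (restrict_space borel usphere)"
    using assms by (auto simp: sets_restrict_space)
  then have "emeasure sphere_area A = of_nat DIM('a) * emeasure lborel {x \<in> ball 0 1 - {0}. x /\<^sub>R norm x \<in> A \<inter> usphere}"
    by (simp add: emeasure_sphere_area_eq emeasure_surface_measure)
  also have "{x \<in> ball 0 1 - {0}. x /\<^sub>R norm x \<in> A \<inter> usphere} = {x \<in> ball 0 1 - {0}. sgn x \<in> A}"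
    by (auto simp: sgn_div_norm)
  finally show ?thesis .
qed

lemma borel_measurable_sgn [measurable]: "(sgn :: 'a::euclidean_space \<Rightarrow> 'a) \<in> borel_measurable borel"
  unfolding sgn_div_norm by measurable

lemma sphere_area_eq_distr:
  "(sphere_area :: 'a::euclidean_space measure) =
     scale_measure (of_nat DIM('a)) (distr (density lborel (indicator (ball 0 1 - {0}))) borel sgn)"
  (is "_ = ?M")
proof (rule measure_eqI)
  fix A :: "'a set" assume "A \<in> sets sphere_area"
  then have A [measurable]: "A \<in> sets borel" by simp
  have "emeasure ?M A = of_nat DIM('a) * (\<integral>\<^sup>+x. indicator (ball 0 1 - {0}) x * indicator (sgn -` A) x \<partial>lborel)"
    using measurable_sets[OF borel_measurable_sgn A] by (simp add: emeasure_distr emeasure_density borel_measurable_indicator)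
  also have "(\<integral>\<^sup>+x. indicator (ball 0 1 - {0}) x * indicator (sgn -` A) x \<partial>lborel) =
     (\<integral>\<^sup>+x. indicator {x \<in> ball 0 1 - {0}. sgn x \<in> A} x \<partial>lborel)"
    by (intro nn_integral_cong) (auto simp: indicator_def)
  also have "\<dots> = emeasure lborel {x \<in> ball 0 1 - {0}. sgn x \<in> A}"
    by (intro nn_integral_indicator) measurable
  finally show "emeasure sphere_area A = emeasure ?M A" by (simp add: emeasure_sphere_area)
qed simp

lemma nn_integral_sphere_area:
  fixes g :: "'a::euclidean_space \<Rightarrow> ennreal"
  assumes [measurable]: "g \<in> borel_measurable borel"
  shows "(\<integral>\<^sup>+x. g x \<partial>sphere_area) =
    of_nat DIM('a) * (\<integral>\<^sup>+x. indicator (ball 0 1 - {0}) x * g (sgn x) \<partial>lborel)"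
  unfolding sphere_area_eq_distr
  by (simp add: nn_integral_scale_measure nn_integral_distr nn_integral_density borel_measurable_indicator)

lemma finite_measure_sphere_area: "finite_measure (sphere_area :: 'a::euclidean_space measure)"
proof (rule finite_measureI)
  have "emeasure lborel {x \<in> ball 0 1 - {0}. sgn x \<in> (UNIV :: 'a set)} \<le> emeasure lborel (ball (0::'a) 1)"
    by (rule emeasure_mono) auto
  also have "\<dots> < \<infinity>" by (rule emeasure_lborel_ball_finite)
  finally show "emeasure (sphere_area :: 'a measure) (space sphere_area) \<noteq> \<infinity>"
    by (subst space_sphere_area, subst emeasure_sphere_area)
      (auto simp: ennreal_mult_eq_top_iff ennreal_of_nat_eq_real_of_nat)
qed

lemma AE_sphere_area: "AE x in sphere_area. norm x = 1"
proof (rule AE_I')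
  have "-usphere \<in> sets borel" by auto
  then have "emeasure sphere_area (- usphere :: 'a set) = emeasure lborel {x \<in> ball 0 1 - {0::'a}. sgn x \<in> -usphere} * of_nat DIM('a)"
    by (simp add: emeasure_sphere_area mult.commute)
  also have "{x \<in> ball 0 1 - {0::'a}. sgn x \<in> -usphere} = {}" by (auto simp: norm_sgn)
  finally show "- usphere \<in> null_sets (sphere_area :: 'a measure)"
    by (auto simp: null_sets_def)
qed auto

text \<open>A norm-preserving linear map commutes with the radial projection \<open>sgn\<close>, so
  invariance is inherited from the Lebesgue measure of cones.\<close>

lemma distr_sphere_area_isometry:
  fixes f :: "'a::euclidean_space \<Rightarrow> 'b::euclidean_space"
  assumes "linear f" and nf: "\<And>x. norm (f x) = norm x" and "surj f" and dim: "DIM('a) = DIM('b)"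
  shows "distr sphere_area borel f = sphere_area"
proof (rule measure_eqI)
  have dist: "dist (f x) (f y) = dist x y" for x y
    by (metis assms(1,2) dist_norm linear_diff)
  have lb: "distr lborel borel f = lborel"
    by (rule distr_lborel_isometry) fact+
  have [measurable]: "f \<in> borel_measurable borel"
    using dist by (intro borel_measurable_continuous_onI) (auto simp: continuous_on_iff)
  fix A assume "A \<in> sets (distr (sphere_area :: 'a measure) borel f)"
  then have A [measurable]: "A \<in> sets borel" by simp
  have fA [measurable]: "f -` A \<in> sets borel"
    using measurable_sets[of f borel borel A] by simp
  have sgn: "sgn (f x) = f (sgn x)" for x
    by (simp add: sgn_div_norm nf linear_scale[OF \<open>linear f\<close>])
  have zero: "f x = 0 \<longleftrightarrow> x = 0" for x using nf[of x] by (metis norm_eq_zero)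
  have "emeasure sphere_area A = of_nat DIM('b) * emeasure lborel {x \<in> ball 0 1 - {0}. sgn x \<in> A}"
    by (rule emeasure_sphere_area) fact
  also have "emeasure lborel {x \<in> ball 0 1 - {0}. sgn x \<in> A} = emeasure (distr lborel borel f) {x \<in> ball 0 1 - {0}. sgn x \<in> A}"
    by (simp add: lb)
  also have "\<dots> = emeasure lborel (f -` {x \<in> ball 0 1 - {0}. sgn x \<in> A})"
    by (subst emeasure_distr) (auto, measurable)
  also have "f -` {x \<in> ball 0 1 - {0}. sgn x \<in> A} = {x \<in> ball 0 1 - {0}. sgn x \<in> f -` A}"
    by (auto simp: sgn nf zero)
  also have "of_nat DIM('b) * emeasure lborel {x \<in> ball 0 1 - {0}. sgn x \<in> f -` A} = emeasure sphere_area (f -` A)"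
    by (simp add: emeasure_sphere_area dim)
  finally show "emeasure (distr sphere_area borel f) A = emeasure sphere_area A"
    using measurable_sets[of f sphere_area borel A] by (subst emeasure_distr) (simp_all)
qed simp

lemma distr_sphere_area_orthogonal:
  "orthogonal_transformation f \<Longrightarrow> distr sphere_area borel f = sphere_area"
  for f :: "'a::euclidean_space \<Rightarrow> 'a"
  by (rule distr_sphere_area_isometry)
    (simp_all add: orthogonal_transformation_linear orthogonal_transformation_norm orthogonal_transformation_surj)

lemma orthogonal_transformation_measurable [measurable_dest]:
  "orthogonal_transformation f \<Longrightarrow> f \<in> borel_measurable borel"
  for f :: "'a::euclidean_space \<Rightarrow> 'a"
  by (intro borel_measurable_continuous_onI linear_continuous_on)
    (simp add: orthogonal_transformation_linear linear_conv_bounded_linear[symmetric])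

lemma orthogonal_transformation_dist:
  "orthogonal_transformation f \<Longrightarrow> dist (f x) (f y) = dist x y"
  by (simp add: dist_norm linear_diff[symmetric] orthogonal_transformation_linear orthogonal_transformation_norm)

text \<open>Orthogonal maps act transitively on the sphere. This supplies the common mass
  \<open>c r\<close> in the comparison of measures on balls.\<close>

lemma emeasure_sphere_area_ball_cong:
  fixes x y :: "real ^ 'n"
  assumes "norm x = 1" "norm y = 1"
  shows "emeasure sphere_area (ball x r) = emeasure sphere_area (ball y r)"
proof -
  obtain f where f: "orthogonal_transformation f" "f x = y"
    using orthogonal_transformation_exists_1[OF assms] by blast
  note [measurable] = orthogonal_transformation_measurable[OF f(1)]
  have "f -` ball y r = ball x r"
    using orthogonal_transformation_dist[OF f(1), of x] by (auto simp: f(2))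
  then have "emeasure (distr sphere_area borel f) (ball y r) = emeasure sphere_area (ball x r)"
    by (subst emeasure_distr) simp_all
  then show ?thesis by (simp add: distr_sphere_area_orthogonal f)
qed

section \<open>Lower bound for the area of small caps\<close>

lemma emeasure_cone_scale:
  fixes A :: "'a::euclidean_space set"
  assumes [measurable]: "A \<in> sets borel" and t: "t > 0"
  shows "emeasure lborel {x \<in> ball 0 t - {0}. sgn x \<in> A} =
    ennreal (t ^ DIM('a)) * emeasure lborel {x \<in> ball 0 1 - {0}. sgn x \<in> A}"
proof -
  let ?C = "\<lambda>t. {x \<in> ball 0 t - {0}. sgn x \<in> A}"
  have "emeasure lborel (?C t) = emeasure (density (distr lborel borel (\<lambda>x. 0 + t *\<^sub>R x)) (\<lambda>_. \<bar>t\<bar> ^ DIM('a))) (?C t)"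
    using t by (subst lborel_affine[of t 0]) auto
  also have "\<dots> = ennreal (t ^ DIM('a)) * emeasure (distr lborel borel (\<lambda>x. 0 + t *\<^sub>R x)) (?C t)"
    using t by (subst emeasure_density_const) (simp_all, measurable)
  also have "emeasure (distr lborel borel (\<lambda>x. 0 + t *\<^sub>R x)) (?C t) = emeasure lborel ((\<lambda>x. 0 + t *\<^sub>R x) -` ?C t)"
    by (subst emeasure_distr) (simp_all, measurable)
  also have "(\<lambda>x. 0 + t *\<^sub>R x) -` ?C t = ?C 1"
    using t by (auto simp: sgn_scaleR)
  finally show ?thesis .
qed

text \<open>If the cone over the cap has volume \<open>V\<close>, its part between the radii
  \<open>1 - r\<close> and 1 has volume at most \<open>d * r * V\<close> by Bernoulli's inequality.
  That part contains a ball of radius \<open>r / 8\<close>, whose volume is of order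
  \<open>r ^ d\<close>, and the area is \<open>d * V\<close>.\<close>

lemma emeasure_sphere_area_ball_ge:
  fixes x :: "'a::euclidean_space"
  assumes x: "norm x = 1" and r: "0 < r" "r \<le> 1"
  shows "emeasure sphere_area (ball x r) \<ge> ennreal (unit_ball_vol (real DIM('a)) / 8 ^ DIM('a) * r ^ (DIM('a) - 1))"
proof -
  let ?d = "DIM('a)"
  let ?C = "\<lambda>t. {y \<in> ball 0 t - {0}. sgn y \<in> ball x r}"
  let ?p = "(1 - r / 2) *\<^sub>R x"
  have dim: "?d > 0" by simp
  interpret finite_measure "sphere_area :: 'a measure" by (rule finite_measure_sphere_area)
  have Cm [measurable]: "?C t \<in> sets borel" for t
  proof -
    have "?C t = (ball 0 t - {0}) \<inter> sgn -` ball x r" by auto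
    then show ?thesis using measurable_sets[OF borel_measurable_sgn, of "ball x r"] by auto
  qed
  have C_fin: "emeasure lborel (?C t) \<noteq> \<infinity>" for t
  proof -
    have "emeasure lborel (?C t) \<le> emeasure lborel (ball (0::'a) t)" by (rule emeasure_mono) auto
    then show ?thesis using emeasure_lborel_ball_finite[of "0::'a" t] by (auto simp: top_unique)
  qed
  define V where "V = measure lborel (?C 1)"
  have V: "emeasure lborel (?C 1) = ennreal V" using C_fin[of 1] by (simp add: V_def emeasure_eq_ennreal_measure)
  have V0: "V \<ge> 0" by (simp add: V_def)
  \<comment> \<open>The radius \<open>r / 8\<close> gives
    \<open>norm y * norm (sgn y - x) < r / 4\<close>; since \<open>norm y > 1 / 4\<close>, the
    projection stays within \<open>r\<close> of \<open>x\<close>.\<close>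
  have sub: "ball ?p (r / 8) \<subseteq> ?C 1 - ?C (1 - r)"
  proof
    fix y assume "y \<in> ball ?p (r / 8)"
    then have d: "norm (y - ?p) < r / 8" by (simp add: dist_norm norm_minus_commute)
    have np: "norm ?p = 1 - r / 2" using x r by simp
    have "\<bar>norm y - norm ?p\<bar> \<le> norm (y - ?p)" by (rule norm_triangle_ineq3)
    then have ny: "norm y < 1 - r / 4" "norm y > 1 - 3 * r / 4" using d np by linarith+
    then have ny0: "norm y > 1 / 4" using r by linarith
    have "norm (y - norm y *\<^sub>R x) \<le> norm (y - ?p) + norm (?p - norm y *\<^sub>R x)"
      using norm_triangle_ineq[of "y - ?p" "?p - norm y *\<^sub>R x"] by simp
    also have "norm (?p - norm y *\<^sub>R x) = \<bar>(1 - r / 2) - norm y\<bar>"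
      using x by (simp flip: scaleR_diff_left)
    also have "\<dots> < r / 8" using \<open>\<bar>norm y - norm ?p\<bar> \<le> norm (y - ?p)\<close> d np by linarith
    finally have "norm (y - norm y *\<^sub>R x) < r / 4" using d by linarith
    moreover have "y - norm y *\<^sub>R x = norm y *\<^sub>R (sgn y - x)" 
    proof -
      have "norm y \<noteq> 0" using ny0 by linarith
      then show ?thesis by (simp add: sgn_div_norm scaleR_right_diff_distrib)
    qed
    ultimately have "norm y * norm (sgn y - x) < r / 4" by simp
    moreover have "norm y * norm (sgn y - x) \<ge> 1 / 4 * norm (sgn y - x)"
      using ny0 by (intro mult_right_mono) auto
    ultimately have "norm (sgn y - x) < r" by linarith
    then show "y \<in> ?C 1 - ?C (1 - r)" using ny ny0 r by (auto simp: dist_norm norm_minus_commute)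
  qed
  have "emeasure lborel (ball ?p (r / 8)) + emeasure lborel (?C (1 - r)) = emeasure lborel (ball ?p (r / 8) \<union> ?C (1 - r))"
    using sub by (intro plus_emeasure) (simp_all, measurable, blast)
  also have "\<dots> \<le> emeasure lborel (?C 1)"
    using sub r by (intro emeasure_mono) (simp_all, (measurable)?, fastforce?)
  finally have *: "emeasure lborel (ball ?p (r / 8)) + emeasure lborel (?C (1 - r)) \<le> ennreal V" using V by simp
  have C1r: "emeasure lborel (?C (1 - r)) = ennreal ((1 - r) ^ ?d * V)"
  proof (cases "r < 1")
    case True
    then have "emeasure lborel (?C (1 - r)) = ennreal ((1 - r) ^ ?d) * emeasure lborel (?C 1)"
      by (intro emeasure_cone_scale) auto
    then show ?thesis using V0 r unfolding V by (simp add: ennreal_mult)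
  next
    case False
    then have [simp]: "r = 1" using r by simp
    have "?C (1 - r) = {}" by auto
    then have "emeasure lborel (?C (1 - r)) = 0" by (simp only: emeasure_empty)
    moreover have "(1 - r) ^ ?d * V = 0" by simp
    ultimately show ?thesis by (simp only: ennreal_0)
  qed
  have "unit_ball_vol (real ?d) * (r / 8) ^ ?d + (1 - r) ^ ?d * V \<le> V"
    using * r V0 unfolding C1r by (simp add: emeasure_ball ennreal_plus[symmetric] del: ennreal_plus)
  then have "unit_ball_vol (real ?d) * (r / 8) ^ ?d \<le> (1 - (1 - r) ^ ?d) * V" by (simp add: algebra_simps)
  also have "\<dots> \<le> (?d * r) * V"
  proof (rule mult_right_mono)
    show "1 - (1 - r) ^ ?d \<le> ?d * r" using Bernoulli_inequality[of "-r" ?d] r by simp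
  qed (fact V0)
  finally have "unit_ball_vol (real ?d) * (r / 8) ^ ?d \<le> (?d * r) * V" .
  moreover have "r ^ ?d = r * r ^ (?d - 1)" using dim by (metis Suc_diff_1 power_Suc)
  ultimately have "r * (unit_ball_vol (real ?d) / 8 ^ ?d * r ^ (?d - 1)) \<le> r * (?d * V)"
    by (simp add: power_divide mult_ac)
  then have "unit_ball_vol (real ?d) / 8 ^ ?d * r ^ (?d - 1) \<le> ?d * V" using r(1) by (rule mult_left_le_imp_le)
  then have "ennreal (unit_ball_vol (real ?d) / 8 ^ ?d * r ^ (?d - 1)) \<le> ennreal (?d * V)" by (rule ennreal_leI)
  also have "\<dots> = emeasure sphere_area (ball x r)"
  proof -
    have "emeasure sphere_area (ball x r) = of_nat ?d * ennreal V"
      unfolding V[symmetric] by (rule emeasure_sphere_area) simp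
    then show ?thesis using V0 by (simp add: ennreal_mult ennreal_of_nat_eq_real_of_nat)
  qed
  finally show ?thesis .
qed

section \<open>Inversions preserving the sphere\<close>

text \<open>Reflection in the hyperplane orthogonal to \<open>w\<close>. For \<open>w = 0\<close> it
  is the identity, so it is an orthogonal map for every \<open>w\<close>.\<close>

definition reflection :: "'a::euclidean_space \<Rightarrow> 'a \<Rightarrow> 'a" where
  "reflection w x = x - (2 * (w \<bullet> x) / (w \<bullet> w)) *\<^sub>R w"

lemma reflection_scaleR: "reflection w (c *\<^sub>R x) = c *\<^sub>R reflection w x"
  by (simp add: reflection_def scaleR_diff_right)

lemma reflection_add: "reflection w (x + y) = reflection w x + reflection w y"
  by (simp add: reflection_def inner_add_right distrib_left add_divide_distrib scaleR_add_left)

lemma reflection_diff: "reflection w (x - y) = reflection w x - reflection w y"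
  by (simp add: reflection_def inner_diff_right right_diff_distrib diff_divide_distrib scaleR_diff_left)

lemma orthogonal_transformation_reflection: "orthogonal_transformation (reflection w)"
proof (cases "w = 0")
  case True
  then show ?thesis by (simp add: reflection_def[abs_def])
next
  case False
  then have "w \<bullet> w \<noteq> 0" by simp
  then have "reflection w x \<bullet> reflection w y = x \<bullet> y" for x y
    by (simp add: reflection_def inner_diff inner_commute field_simps)
  then show ?thesis
    unfolding orthogonal_transformation_def by (auto intro!: linearI simp: reflection_add reflection_scaleR)
qed

lemma norm_reflection [simp]: "norm (reflection w x) = norm x"
  by (simp add: orthogonal_transformation_norm orthogonal_transformation_reflection)

lemma reflection_swap: "norm x = norm y \<Longrightarrow> reflection (x - y) x = y"
proof (cases "x = y")
  case False
  assume "norm x = norm y"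
  then have "x \<bullet> x = y \<bullet> y" by (simp add: norm_eq_sqrt_inner)
  then have "2 * ((x - y) \<bullet> x) = (x - y) \<bullet> (x - y)"
    by (simp add: inner_diff inner_commute)
  moreover have "(x - y) \<bullet> (x - y) \<noteq> 0" using False by simp
  ultimately show ?thesis by (simp add: reflection_def)
qed (simp add: reflection_def)

lemma reflection_self [simp]: "reflection w w = - w"
  by (cases "w = 0") (simp_all add: reflection_def scaleR_2)

lemma borel_measurable_reflection [measurable]: "reflection w \<in> borel_measurable borel"
  by (rule orthogonal_transformation_measurable[OF orthogonal_transformation_reflection])

lemma reflection_orthogonal: "w \<bullet> x = 0 \<Longrightarrow> reflection w x = x"
  by (simp add: reflection_def)

text \<open>For \<open>x\<close> on the sphere this is the conformal factor of the inversion below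
  at \<open>x\<close>, and also the ratio in which \<open>z\<close> divides the chord through
  \<open>x\<close>.\<close>

definition inversion_factor :: "'a::euclidean_space \<Rightarrow> 'a \<Rightarrow> real" where
  "inversion_factor z x = (1 - (norm z)\<^sup>2) / (norm (x - z))\<^sup>2"

text \<open>The power of an interior point \<open>z\<close> is negative, hence the minus sign: the
  image lies on the opposite side of \<open>z\<close>, and a point of the sphere goes to the other
  end of its chord through \<open>z\<close>.\<close>

definition sphere_inversion :: "'a::euclidean_space \<Rightarrow> 'a \<Rightarrow> 'a" where
  "sphere_inversion z x = z - inversion_factor z x *\<^sub>R (x - z)"

text \<open>The hyperplane through the origin orthogonal to a chord bisects it, so the two ends are
  mirror images; invariance of the sphere is then immediate.\<close>

lemma sphere_inversion_eq_reflection: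
  assumes "norm x = 1" "norm z < 1"
  shows "sphere_inversion z x = reflection (x - z) x"
proof -
  have "x \<noteq> z" using assms by auto
  then have q: "(x - z) \<bullet> (x - z) \<noteq> 0" by simp
  have xx: "x \<bullet> x = 1" using assms by (simp add: norm_eq_sqrt_inner)
  have "2 * ((x - z) \<bullet> x) = (x - z) \<bullet> (x - z) + (1 - z \<bullet> z)"
    by (simp add: inner_diff inner_commute xx)
  then have "2 * ((x - z) \<bullet> x) / ((x - z) \<bullet> (x - z)) = 1 + inversion_factor z x"
    using q by (simp add: inversion_factor_def add_divide_distrib power2_norm_eq_inner)
  then show ?thesis
    by (simp add: reflection_def sphere_inversion_def scaleR_add_left)
qed

lemma norm_sphere_inversion: "norm x = 1 \<Longrightarrow> norm z < 1 \<Longrightarrow> norm (sphere_inversion z x) = 1"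
  by (simp add: sphere_inversion_eq_reflection)

lemma one_minus_norm_pos: "norm z < 1 \<Longrightarrow> 0 < 1 - (norm z)\<^sup>2"
  by (simp add: abs_square_less_1)

lemma inversion_factor_pos:
  assumes "norm x = 1" "norm z < 1" shows "inversion_factor z x > 0"
proof -
  have "x \<noteq> z" using assms by auto
  then show ?thesis using one_minus_norm_pos[OF assms(2)] by (simp add: inversion_factor_def)
qed

lemma inversion_factor_inversion:
  assumes "norm x = 1" "norm z < 1"
  shows "inversion_factor z (sphere_inversion z x) = inverse (inversion_factor z x)"
proof -
  have "x \<noteq> z" using assms by auto
  have c: "1 - (norm z)\<^sup>2 \<noteq> 0" using one_minus_norm_pos[OF assms(2)] by simp
  have "sphere_inversion z x - z = - (inversion_factor z x *\<^sub>R (x - z))" by (simp add: sphere_inversion_def)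
  then have "(norm (sphere_inversion z x - z))\<^sup>2 = (inversion_factor z x)\<^sup>2 * (norm (x - z))\<^sup>2"
    by (simp add: power_mult_distrib)
  also have "\<dots> = (1 - (norm z)\<^sup>2)\<^sup>2 / (norm (x - z))\<^sup>2"
    using \<open>x \<noteq> z\<close> by (simp add: inversion_factor_def power_divide power2_eq_square)
  finally show ?thesis using c
    by (simp add: inversion_factor_def power2_eq_square)
qed

lemma sphere_inversion_inversion:
  assumes "norm x = 1" "norm z < 1"
  shows "sphere_inversion z (sphere_inversion z x) = x"
  using inversion_factor_pos[OF assms]
  unfolding sphere_inversion_def[of z "sphere_inversion z x"] inversion_factor_inversion[OF assms]
  by (simp add: sphere_inversion_def)

lemma norm_inversion_diff:
  fixes a b :: "'a::real_inner"
  assumes "a \<noteq> 0" "b \<noteq> 0"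
  shows "norm ((1 / (norm a)\<^sup>2) *\<^sub>R a - (1 / (norm b)\<^sup>2) *\<^sub>R b) = norm (a - b) / (norm a * norm b)"
proof (rule power2_eq_imp_eq)
  have "a \<bullet> a \<noteq> 0" "b \<bullet> b \<noteq> 0" using assms by auto
  then show "(norm ((1 / (norm a)\<^sup>2) *\<^sub>R a - (1 / (norm b)\<^sup>2) *\<^sub>R b))\<^sup>2 = (norm (a - b) / (norm a * norm b))\<^sup>2"
    unfolding power_divide power_mult_distrib power2_norm_eq_inner
    by (simp add: inner_diff inner_commute field_simps)
qed auto

text \<open>Raised to the power d - 2 this is the rule by which the Newtonian kernel transforms
  under the inversion.\<close>

lemma dist_sphere_inversion:
  assumes "norm x = 1" "norm y = 1" "norm z < 1"
  shows "norm (sphere_inversion z x - sphere_inversion z y) =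
    (1 - (norm z)\<^sup>2) * norm (x - y) / (norm (x - z) * norm (y - z))"
proof -
  let ?c = "1 - (norm z)\<^sup>2"
  have xy: "x - z \<noteq> 0" "y - z \<noteq> 0" using assms by auto
  have "sphere_inversion z x - sphere_inversion z y =
    (- ?c) *\<^sub>R ((1 / (norm (x - z))\<^sup>2) *\<^sub>R (x - z) - (1 / (norm (y - z))\<^sup>2) *\<^sub>R (y - z))"
  proof -
    have "inversion_factor z x *\<^sub>R (x - z) = ?c *\<^sub>R ((1 / (norm (x - z))\<^sup>2) *\<^sub>R (x - z))" for x
      by (simp add: inversion_factor_def)
    then show ?thesis by (simp only: sphere_inversion_def scaleR_diff_right scaleR_minus_left) simp
  qed
  then have "norm (sphere_inversion z x - sphere_inversion z y) =
    \<bar>- ?c\<bar> * norm ((1 / (norm (x - z))\<^sup>2) *\<^sub>R (x - z) - (1 / (norm (y - z))\<^sup>2) *\<^sub>R (y - z))"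
    by (metis norm_scaleR)
  then show ?thesis
    using one_minus_norm_pos[OF assms(3)] norm_inversion_diff[OF xy] by simp
qed

section \<open>Jacobian of the inversion and change of variables on the sphere\<close>

lemma has_derivative_sgn:
  fixes x :: "'a::euclidean_space"
  assumes "x \<noteq> 0"
  shows "(sgn has_derivative (\<lambda>h. (1 / norm x) *\<^sub>R (h - (sgn x \<bullet> h) *\<^sub>R sgn x))) (at x)"
proof -
  have "((\<lambda>x. inverse (norm x) *\<^sub>R x) has_derivative (\<lambda>h. (1 / norm x) *\<^sub>R (h - (sgn x \<bullet> h) *\<^sub>R sgn x))) (at x)"
    by (rule derivative_eq_intros has_derivative_norm assms | simp add: assms)+
      (auto simp: fun_eq_iff sgn_div_norm algebra_simps divide_inverse inner_commute assms)
  then show ?thesis by (simp add: sgn_div_norm[abs_def])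
qed

lemma has_derivative_sphere_inversion:
  assumes "u \<noteq> z"
  shows "(sphere_inversion z has_derivative (\<lambda>h. - (inversion_factor z u *\<^sub>R reflection (u - z) h))) (at u)"
proof -
  have q: "(u - z) \<bullet> (u - z) \<noteq> 0" using assms by simp
  have "((\<lambda>x. z - ((1 - (norm z)\<^sup>2) * inverse ((x - z) \<bullet> (x - z))) *\<^sub>R (x - z)) has_derivative
     (\<lambda>h. - (inversion_factor z u *\<^sub>R reflection (u - z) h))) (at u)"
    apply (rule derivative_eq_intros q refl | simp)+
    apply (rule ext)
    using q
    apply (simp add: inversion_factor_def reflection_def power2_norm_eq_inner)
    apply (simp add: scaleR_diff_right inner_commute divide_simps)
    done
  then show ?thesis
    by (simp add: sphere_inversion_def[abs_def] inversion_factor_def[abs_def] power2_norm_eq_inner divide_inverse)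
qed

text \<open>The map fixes \<open>u\<close> and acts as \<open>- j\<close> on its orthogonal
  complement; rotating \<open>u\<close> to a coordinate axis makes it diagonal.\<close>

lemma det_axial:
  fixes u :: "real ^ 'n"
  assumes u: "norm u = 1"
  shows "\<bar>det (matrix (\<lambda>h. ((1 + j) * (u \<bullet> h)) *\<^sub>R u - j *\<^sub>R h))\<bar> = \<bar>j\<bar> ^ (CARD('n) - 1)"
proof -
  define i :: 'n where "i = undefined"
  let ?e = "axis i (1::real) :: real ^ 'n"
  obtain f where f: "orthogonal_transformation f" "f ?e = u"
    using orthogonal_transformation_exists_1[of ?e u] u by (auto simp: norm_axis_1)
  define A where "A w = (\<lambda>h. ((1 + j) * (w \<bullet> h)) *\<^sub>R w - j *\<^sub>R h)" for w :: "real ^ 'n"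
  have lin: "linear (A w)" for w
    unfolding A_def by (auto intro!: linearI simp: inner_add_right algebra_simps)
  have lf: "linear f" using f orthogonal_transformation_linear by blast
  have inner: "u \<bullet> f h = ?e \<bullet> h" for h
    using f by (metis orthogonal_transformation_def)
  have "A u \<circ> f = f \<circ> A ?e"
    by (auto simp: fun_eq_iff A_def inner linear_diff[OF lf] linear_scale[OF lf] f(2))
  then have "matrix (A u) ** matrix f = matrix f ** matrix (A ?e)"
    by (metis lin lf matrix_compose)
  then have "det (matrix (A u)) * det (matrix f) = det (matrix f) * det (matrix (A ?e))"
    by (metis det_mul)
  moreover have "\<bar>det (matrix f)\<bar> = 1" using f by simp
  ultimately have "\<bar>det (matrix (A u))\<bar> = \<bar>det (matrix (A ?e))\<bar>"
    by (metis abs_mult mult.commute mult.left_neutral)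
  also have entries: "matrix (A ?e) $ a $ b = (if a = b then (if a = i then 1 else - j) else 0)" for a b
  proof -
    have "?e \<bullet> axis b 1 = (if b = i then 1 else 0)"
      by (simp add: inner_axis) (simp add: axis_def)
    then show ?thesis by (auto simp: matrix_def A_def) (auto simp: axis_def)
  qed
  have "det (matrix (A ?e)) = (\<Prod>a\<in>UNIV. matrix (A ?e) $ a $ a)"
    by (rule det_diagonal) (simp add: entries)
  also have "\<dots> = (\<Prod>a\<in>UNIV. (if a = i then 1 else - j))" by (simp add: entries)
  also have "\<dots> = (- j) ^ (CARD('n) - 1)"
    by (subst prod.remove[of _ i]) (auto simp: card_Diff_singleton)
  finally show ?thesis by (simp add: A_def power_abs)
qed

text \<open>Surface measure is defined through volumes of cones, so the inversion is extended to be
  homogeneous of degree 1 and the change of variables takes place in the punctured ball.\<close>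

definition cone_inversion :: "'a::euclidean_space \<Rightarrow> 'a \<Rightarrow> 'a" where
  "cone_inversion z x = norm x *\<^sub>R sphere_inversion z (sgn x)"

text \<open>Radial lengths are kept and tangential ones are scaled by the conformal factor.
  Splitting off the reflection leaves the map of \<open>det_axial\<close>, so the Jacobian is the
  power d - 1 of the factor.\<close>

lemma has_derivative_cone_inversion:
  assumes x: "x \<noteq> 0" and z: "norm z < 1"
  shows "(cone_inversion z has_derivative
    reflection (sgn x - z) \<circ> (\<lambda>h. ((1 + inversion_factor z (sgn x)) * (sgn x \<bullet> h)) *\<^sub>R sgn x - inversion_factor z (sgn x) *\<^sub>R h)) (at x)"
proof -
  let ?u = "sgn x" and ?J = "inversion_factor z (sgn x)"
  have u: "norm ?u = 1" using x by (simp add: norm_sgn)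
  have "?u \<noteq> z" using u z by auto
  have "((\<lambda>y. sphere_inversion z (sgn y)) has_derivative
     (\<lambda>h. - (?J *\<^sub>R reflection (?u - z) ((1 / norm x) *\<^sub>R (h - (?u \<bullet> h) *\<^sub>R ?u))))) (at x)"
    by (rule has_derivative_compose[OF has_derivative_sgn[OF x] has_derivative_sphere_inversion[OF \<open>?u \<noteq> z\<close>]])
  from has_derivative_scaleR[OF has_derivative_norm[OF x] this]
  have "(cone_inversion z has_derivative (\<lambda>h. norm x *\<^sub>R (- (?J *\<^sub>R reflection (?u - z) ((1 / norm x) *\<^sub>R (h - (?u \<bullet> h) *\<^sub>R ?u)))) +
      (h \<bullet> ?u) *\<^sub>R sphere_inversion z ?u)) (at x)"
    unfolding cone_inversion_def[abs_def] .
  moreover have "norm x *\<^sub>R (- (?J *\<^sub>R reflection (?u - z) ((1 / norm x) *\<^sub>R (h - (?u \<bullet> h) *\<^sub>R ?u)))) +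
      (h \<bullet> ?u) *\<^sub>R sphere_inversion z ?u = reflection (?u - z) (((1 + ?J) * (?u \<bullet> h)) *\<^sub>R ?u - ?J *\<^sub>R h)" for h
    using x by (simp add: sphere_inversion_eq_reflection[OF u z] reflection_add reflection_diff reflection_scaleR algebra_simps inner_commute)
  ultimately show ?thesis by (simp add: o_def)
qed

lemma borel_measurable_inversion_factor [measurable]: "inversion_factor z \<in> borel_measurable borel"
  unfolding inversion_factor_def[abs_def] by measurable

lemma borel_measurable_sphere_inversion [measurable]: "sphere_inversion z \<in> borel_measurable borel"
  unfolding sphere_inversion_def[abs_def] by measurable

text \<open>The cone over \<open>A\<close> is the image of the cone over its preimage under
  \<open>cone_inversion z\<close>, an involution of the punctured ball. The Jacobian depends on
  \<open>sgn x\<close> only, so the volume integral is again a surface integral.\<close>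

lemma emeasure_sphere_area_inversion_aux:
  fixes z :: "real ^ 'n::{finite,wellorder}"
  assumes z: "norm z < 1" and A [measurable]: "A \<in> sets borel"
  shows "emeasure sphere_area A =
    (\<integral>\<^sup>+x. ennreal (inversion_factor z x ^ (CARD('n) - 1)) * indicator A (sphere_inversion z x) \<partial>sphere_area)"
proof -
  let ?\<phi> = "sphere_inversion z" and ?J = "inversion_factor z" and ?\<Phi> = "cone_inversion z"
  define E where "E A = {x \<in> ball 0 1 - {0}. sgn x \<in> A}" for A :: "(real ^ 'n::_) set"
  have E_sets [measurable]: "E B \<in> sets borel" if "B \<in> sets borel" for B
  proof -
    have "E B = (ball 0 1 - {0}) \<inter> sgn -` B" by (auto simp: E_def)
    then show ?thesis using measurable_sets[OF borel_measurable_sgn that] by auto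
  qed
  have E_fin: "emeasure lborel (E B) < \<infinity>" for B
  proof -
    have "emeasure lborel (E B) \<le> emeasure lborel (ball (0::real^'n::_) 1)" by (rule emeasure_mono) (auto simp: E_def)
    also have "\<dots> < \<infinity>" by (rule emeasure_lborel_ball_finite)
    finally show ?thesis .
  qed
  let ?B = "?\<phi> -` A"
  have B [measurable]: "?B \<in> sets borel" using measurable_sets[OF borel_measurable_sphere_inversion A] by simp
  have inv: "?\<Phi> (?\<Phi> x) = x" "?\<Phi> x \<in> ball 0 1 - {0}" "sgn (?\<Phi> x) = ?\<phi> (sgn x)" if "x \<in> ball 0 1 - {0}" for x
  proof -
    have u: "norm (sgn x) = 1" using that by (simp add: norm_sgn)
    note n = norm_sphere_inversion[OF u z]
    show s: "sgn (?\<Phi> x) = ?\<phi> (sgn x)"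
      using that n by (simp add: cone_inversion_def sgn_scaleR sgn_div_norm[of "?\<phi> (sgn x)"])
    have nn: "norm (?\<Phi> x) = norm x" by (simp add: cone_inversion_def n)
    then show "?\<Phi> x \<in> ball 0 1 - {0}" using that by (metis DiffD1 DiffD2 Diff_iff mem_ball_0 norm_eq_zero singleton_iff)
    show "?\<Phi> (?\<Phi> x) = x"
      unfolding cone_inversion_def[of z "?\<Phi> x"] nn s sphere_inversion_inversion[OF u z]
      using that by (simp add: sgn_div_norm)
  qed
  have img: "?\<Phi> ` E ?B = E A"
  proof
    show "?\<Phi> ` E ?B \<subseteq> E A" using inv by (auto simp: E_def)
    show "E A \<subseteq> ?\<Phi> ` E ?B"
    proof
      fix y assume y: "y \<in> E A"
      then have yb: "y \<in> ball 0 1 - {0}" by (simp add: E_def)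
      have "?\<phi> (sgn (?\<Phi> y)) = sgn y" using inv(3)[OF inv(2)[OF yb]] inv(1)[OF yb] by simp
      then have "?\<Phi> y \<in> E ?B" using inv(2)[OF yb] y by (auto simp: E_def)
      then show "y \<in> ?\<Phi> ` E ?B" using inv(1)[OF yb] by (metis imageI)
    qed
  qed
  have inj: "inj_on ?\<Phi> (E ?B)" by (rule inj_on_inverseI[where g="?\<Phi>"]) (auto simp: E_def inv)
  let ?D = "\<lambda>x. reflection (sgn x - z) \<circ> (\<lambda>h. ((1 + ?J (sgn x)) * (sgn x \<bullet> h)) *\<^sub>R sgn x - ?J (sgn x) *\<^sub>R h)"
  have det: "\<bar>det (matrix (?D x))\<bar> = ?J (sgn x) ^ (CARD('n) - 1)" if "x \<in> E ?B" for x
  proof -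
    have u: "norm (sgn x) = 1" using that by (simp add: norm_sgn E_def)
    have l1: "linear (reflection (sgn x - z))"
      by (simp add: orthogonal_transformation_linear orthogonal_transformation_reflection)
    have l2: "linear (\<lambda>h. ((1 + ?J (sgn x)) * (sgn x \<bullet> h)) *\<^sub>R sgn x - ?J (sgn x) *\<^sub>R h)"
      by (auto intro!: linearI simp: inner_add_right algebra_simps)
    show ?thesis
      using inversion_factor_pos[OF u z]
      by (simp only: matrix_compose[OF l2 l1] det_mul abs_mult det_axial[OF u]
          orthogonal_transformation_det[OF orthogonal_transformation_reflection])
  qed
  have "((\<lambda>x. \<bar>det (matrix (?D x))\<bar>) has_integral measure lebesgue (E A)) (E ?B)"
  proof -
    have "E A \<in> lmeasurable" using E_fin[of A] by (intro fmeasurableI) (auto simp: E_sets)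
    moreover have "(?\<Phi> ` E ?B \<in> lmeasurable \<and> measure lebesgue (?\<Phi> ` E ?B) = measure lebesgue (E A)) \<longleftrightarrow>
      ((\<lambda>x. \<bar>det (matrix (?D x))\<bar>) has_integral measure lebesgue (E A)) (E ?B)"
      by (rule has_measure_differentiable_image)
        (use E_sets[OF B] inj z in \<open>auto simp: E_def intro!: has_derivative_at_withinI[OF has_derivative_cone_inversion]\<close>)
    ultimately show ?thesis by (simp add: img)
  qed
  from nn_integral_has_integral_lebesgue[OF _ this]
  have "(\<integral>\<^sup>+x. indicator (E ?B) x * \<bar>det (matrix (?D x))\<bar> \<partial>lborel) = ennreal (measure lebesgue (E A))" by simp
  also have "\<dots> = emeasure lborel (E A)" using E_fin[of A] by (simp add: emeasure_eq_ennreal_measure)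
  finally have 1: "emeasure lborel (E A) = (\<integral>\<^sup>+x. ennreal (indicator (E ?B) x * \<bar>det (matrix (?D x))\<bar>) \<partial>lborel)" by simp
  also have "\<dots> = (\<integral>\<^sup>+x. indicator (ball 0 1 - {0}) x * (ennreal (?J (sgn x) ^ (CARD('n) - 1)) * indicator A (?\<phi> (sgn x))) \<partial>lborel)"
  proof (rule nn_integral_cong)
    fix x
    show "ennreal (indicator (E ?B) x * \<bar>det (matrix (?D x))\<bar>) =
      indicator (ball 0 1 - {0}) x * (ennreal (?J (sgn x) ^ (CARD('n) - 1)) * indicator A (?\<phi> (sgn x)))"
      using det[of x] by (cases "x \<in> E ?B") (auto simp: E_def indicator_def)
  qed
  finally show ?thesis
    by (subst nn_integral_sphere_area) (simp_all add: emeasure_sphere_area E_def)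
qed

text \<open>
  The change of variables theorem of the library needs a well-ordered index type; the type below
  provides one of the same cardinality as an arbitrary finite type.
\<close>

typedef (overloaded) 'n enum_index = "{..<CARD('n::finite)}"
  by (rule exI[of _ 0]) simp

instantiation enum_index :: (finite) wellorder
begin

definition "less_eq_enum_index (i :: 'a enum_index) (j :: 'a enum_index) \<longleftrightarrow> Rep_enum_index i \<le> Rep_enum_index j"
definition "less_enum_index (i :: 'a enum_index) (j :: 'a enum_index) \<longleftrightarrow> Rep_enum_index i < Rep_enum_index j"

instance
proof
  fix P :: "'a enum_index \<Rightarrow> bool" and a
  assume step: "\<And>x. (\<And>y. y < x \<Longrightarrow> P y) \<Longrightarrow> P x"
  show "P a"
    by (induction a rule: measure_induct_rule[of Rep_enum_index]) (rule step, simp add: less_enum_index_def)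
qed (auto simp: less_eq_enum_index_def less_enum_index_def Rep_enum_index_inject)

end

lemma card_enum_index: "CARD('n::finite enum_index) = CARD('n)"
  using type_definition.card[OF type_definition_enum_index] by simp

instance enum_index :: (finite) finite
proof
  have "(UNIV :: 'a enum_index set) = Abs_enum_index ` {..<CARD('a)}"
    using type_definition.univ[OF type_definition_enum_index] .
  then show "finite (UNIV :: 'a enum_index set)" by (metis finite_imageI finite_lessThan)
qed

text \<open>Relabelling coordinates along a bijection of index types is a linear isometry and
  commutes with the inversion and its factor.\<close>

lemma emeasure_sphere_area_inversion:
  fixes z :: "real ^ 'n"
  assumes z: "norm z < 1" and A [measurable]: "A \<in> sets borel"
  shows "emeasure sphere_area A =
    (\<integral>\<^sup>+x. ennreal (inversion_factor z x ^ (CARD('n) - 1)) * indicator A (sphere_inversion z x) \<partial>sphere_area)"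
proof -
  obtain h :: "'n \<Rightarrow> 'n enum_index" where h: "bij h"
    using finite_same_card_bij[of "UNIV :: 'n set" "UNIV :: 'n enum_index set"] card_enum_index[where 'n='n] by auto
  define f :: "real ^ 'n enum_index \<Rightarrow> real ^ 'n" where "f y = (\<chi> j. y $ h j)" for y
  have lin: "linear f" by (auto intro!: linearI simp: f_def vec_eq_iff)
  have inner: "f x \<bullet> f y = x \<bullet> y" for x y
    unfolding inner_vec_def f_def using sum.reindex_bij_betw[OF h, of "\<lambda>i. x $ i \<bullet> y $ i"] by simp
  then have norm: "norm (f x) = norm x" for x by (simp add: norm_eq_sqrt_inner)
  have surj: "surj f"
  proof (rule surjI)
    show "f (\<chi> i. x $ inv h i) = x" for x
      using h by (simp add: f_def vec_eq_iff bij_is_inj)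
  qed
  then obtain z' where z': "f z' = z" by (metis surjD)
  have fm [measurable]: "f \<in> borel_measurable borel"
    using lin by (intro borel_measurable_continuous_onI linear_continuous_on) (simp add: linear_conv_bounded_linear[symmetric])
  have distr: "distr sphere_area borel f = sphere_area"
    by (rule distr_sphere_area_isometry) (use lin norm surj card_enum_index[where 'n='n] in simp_all)
  have fA [measurable]: "f -` A \<in> sets borel" using measurable_sets[OF fm A] by simp
  have J: "inversion_factor z' x = inversion_factor z (f x)" for x
    by (simp add: inversion_factor_def linear_diff[OF lin, symmetric] norm flip: z')
  have \<phi>: "f (sphere_inversion z' x) = sphere_inversion z (f x)" for x
    by (simp add: sphere_inversion_def linear_diff[OF lin] linear_scale[OF lin] J z')
  have "emeasure sphere_area A = emeasure (distr sphere_area borel f) A" by (simp add: distr)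
  also have "\<dots> = emeasure sphere_area (f -` A)" by (subst emeasure_distr) simp_all
  also have "\<dots> = (\<integral>\<^sup>+x. ennreal (inversion_factor z' x ^ (CARD('n enum_index) - 1)) * indicator (f -` A) (sphere_inversion z' x) \<partial>sphere_area)"
    by (rule emeasure_sphere_area_inversion_aux) (use z norm[of z'] z' in simp_all)
  also have "\<dots> = (\<integral>\<^sup>+x. ennreal (inversion_factor z (f x) ^ (CARD('n) - 1)) * indicator A (sphere_inversion z (f x)) \<partial>sphere_area)"
    by (simp add: card_enum_index J flip: \<phi>) (simp add: indicator_def)
  also have "\<dots> = (\<integral>\<^sup>+x. ennreal (inversion_factor z x ^ (CARD('n) - 1)) * indicator A (sphere_inversion z x) \<partial>distr sphere_area borel f)"
    by (subst nn_integral_distr) simp_all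
  finally show ?thesis by (simp only: distr)
qed

lemma nn_integral_sphere_inversion:
  fixes z :: "real ^ 'n"
  assumes z: "norm z < 1" and g [measurable]: "g \<in> borel_measurable borel"
  shows "(\<integral>\<^sup>+x. g x \<partial>sphere_area) =
    (\<integral>\<^sup>+x. ennreal (inversion_factor z x ^ (CARD('n) - 1)) * g (sphere_inversion z x) \<partial>sphere_area)"
proof -
  let ?D = "density sphere_area (\<lambda>x. ennreal (inversion_factor z x ^ (CARD('n) - 1)))"
  have "sphere_area = distr ?D borel (sphere_inversion z)"
  proof (rule measure_eqI)
    fix A :: "(real ^ 'n) set" assume "A \<in> sets sphere_area"
    then have A [measurable]: "A \<in> sets borel" by simp
    have [measurable]: "sphere_inversion z -` A \<in> sets borel"
      using measurable_sets[OF borel_measurable_sphere_inversion A] by simp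
    show "emeasure sphere_area A = emeasure (distr ?D borel (sphere_inversion z)) A"
      unfolding emeasure_sphere_area_inversion[OF z A]
      by (subst emeasure_distr) (simp_all add: emeasure_density, simp add: indicator_def)
  qed simp
  then have "(\<integral>\<^sup>+x. g x \<partial>sphere_area) = (\<integral>\<^sup>+x. g x \<partial>distr ?D borel (sphere_inversion z))"
    by (rule arg_cong)
  also have "\<dots> = (\<integral>\<^sup>+x. g (sphere_inversion z x) \<partial>?D)" by (subst nn_integral_distr) simp_all
  also have "\<dots> = (\<integral>\<^sup>+x. ennreal (inversion_factor z x ^ (CARD('n) - 1)) * g (sphere_inversion z x) \<partial>sphere_area)"
    by (subst nn_integral_density) simp_all
  finally show ?thesis .
qed

section \<open>Newtonian potentials of the sphere\<close>

definition newton_kernel :: "'a::euclidean_space \<Rightarrow> 'a \<Rightarrow> ennreal" where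
  "newton_kernel x y = 1 / ennreal (norm (x - y) ^ (DIM('a) - 2))"

lemma newton_kernel_commute: "newton_kernel x y = newton_kernel y x"
  by (simp add: newton_kernel_def norm_minus_commute)

lemma newton_kernel_measurable [measurable]:
  "(\<lambda>(x, y). newton_kernel x y) \<in> borel_measurable (borel \<Otimes>\<^sub>M borel)"
  unfolding newton_kernel_def by measurable

lemma newton_kernel_orthogonal:
  "orthogonal_transformation f \<Longrightarrow> newton_kernel (f x) (f y) = newton_kernel x y"
  for f :: "'a::euclidean_space \<Rightarrow> 'a"
  by (simp add: newton_kernel_def orthogonal_transformation_dist[unfolded dist_norm])

lemma newton_kernel_neq:
  "x \<noteq> y \<Longrightarrow> newton_kernel x y = ennreal (1 / norm (x - y) ^ (DIM('a) - 2))" for x y :: "'a::euclidean_space"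
  unfolding newton_kernel_def by (subst ennreal_1[symmetric], subst divide_ennreal) auto

lemma newton_kernel_refl: "DIM('a) > 2 \<Longrightarrow> newton_kernel x x = \<infinity>" for x :: "'a::euclidean_space"
  by (simp add: newton_kernel_def zero_power)

lemma newton_kernel_pos: "newton_kernel x y > 0"
  by (auto simp: newton_kernel_def ennreal_zero_less_divide)

text \<open>Continuity into the extended half-line includes the diagonal. Together with Fatou's
  lemma it yields lower semicontinuity of potentials.\<close>

lemma newton_kernel_tendsto:
  fixes x :: "nat \<Rightarrow> 'a::euclidean_space"
  assumes "x \<longlonglongrightarrow> x0"
  shows "(\<lambda>m. newton_kernel (x m) y) \<longlonglongrightarrow> newton_kernel x0 y"
proof -
  have cont: "continuous_on UNIV (inverse :: ennreal \<Rightarrow> ennreal)"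
    using continuous_on_inverse_ennreal[OF continuous_on_id, of UNIV] by simp
  have "(\<lambda>m. ennreal (norm (x m - y) ^ (DIM('a) - 2))) \<longlonglongrightarrow> ennreal (norm (x0 - y) ^ (DIM('a) - 2))"
    by (intro tendsto_intros assms tendsto_ennrealI)
  then have "(\<lambda>m. inverse (ennreal (norm (x m - y) ^ (DIM('a) - 2)))) \<longlonglongrightarrow> inverse (ennreal (norm (x0 - y) ^ (DIM('a) - 2)))"
    by (rule continuous_on_tendsto_compose[OF cont]) auto
  then show ?thesis by (simp add: newton_kernel_def divide_ennreal_def)
qed

section \<open>The Poisson density under inversion\<close>

lemma norm_sphere_inversion_diff:
  assumes u: "norm u = 1" and z: "norm z < 1"
  shows "norm (sphere_inversion z u - z) = (1 - (norm z)\<^sup>2) / norm (u - z)"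
proof -
  have q: "norm (u - z) > 0" using u z by auto
  have "sphere_inversion z u - z = - (inversion_factor z u *\<^sub>R (u - z))" by (simp add: sphere_inversion_def)
  then have "norm (sphere_inversion z u - z) = \<bar>inversion_factor z u\<bar> * norm (u - z)" by simp
  also have "\<dots> = (1 - (norm z)\<^sup>2) / norm (u - z)"
    unfolding abs_of_pos[OF inversion_factor_pos[OF u z]]
    using q by (simp add: inversion_factor_def power2_eq_square)
  finally show ?thesis .
qed

text \<open>Write \<open>q = norm (u - z)\<close> and \<open>J\<close> for the conformal factor at
  \<open>u\<close>. The power of \<open>z\<close> has absolute value \<open>J * q * q\<close> and
  the image of \<open>u\<close> is at distance \<open>J * q\<close> from \<open>z\<close>, so all
  powers of \<open>J\<close> cancel.\<close>

lemma poisson_factor: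
  fixes z :: "real ^ 'n"
  assumes n: "CARD('n) \<ge> 3" and u: "norm u = 1" and z: "norm z < 1"
  shows "inversion_factor z u ^ (CARD('n) - 1) * ((1 - (norm z)\<^sup>2) / norm (sphere_inversion z u - z) ^ CARD('n)) =
    1 / norm (u - z) ^ (CARD('n) - 2)"
proof -
  let ?c = "1 - (norm z)\<^sup>2" and ?q = "norm (u - z)" and ?t = "inversion_factor z u" and ?s = "CARD('n) - 2"
  have d: "CARD('n) = Suc (Suc ?s)" "CARD('n) - 1 = Suc ?s" using n by auto
  have t: "?t > 0" by (rule inversion_factor_pos[OF u z])
  have q: "?q > 0" using u z by auto
  have c: "?c = ?t * ?q * ?q" using q by (simp add: inversion_factor_def power2_eq_square)
  have n: "norm (sphere_inversion z u - z) = ?t * ?q"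
    using q by (simp add: norm_sphere_inversion_diff[OF u z] c)
  have "?t ^ Suc ?s * (?t * ?q * ?q / (?t * ?q) ^ Suc (Suc ?s)) = 1 / ?q ^ ?s"
    using t q by (simp add: power_mult_distrib)
  then show ?thesis unfolding n c using d by (simp only:)
qed

lemma poisson_mass:
  fixes z :: "real ^ 'n"
  assumes n: "CARD('n) \<ge> 3" and z: "norm z < 1"
  shows "(\<integral>\<^sup>+x. ennreal ((1 - (norm z)\<^sup>2) / norm (x - z) ^ CARD('n)) \<partial>sphere_area) =
    (\<integral>\<^sup>+u. ennreal (1 / norm (u - z) ^ (CARD('n) - 2)) \<partial>sphere_area)"
proof -
  have "(\<integral>\<^sup>+x. ennreal ((1 - (norm z)\<^sup>2) / norm (x - z) ^ CARD('n)) \<partial>sphere_area) =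
    (\<integral>\<^sup>+u. ennreal (inversion_factor z u ^ (CARD('n) - 1)) * ennreal ((1 - (norm z)\<^sup>2) / norm (sphere_inversion z u - z) ^ CARD('n)) \<partial>sphere_area)"
    by (rule nn_integral_sphere_inversion[OF z]) measurable
  also have "\<dots> = (\<integral>\<^sup>+u. ennreal (1 / norm (u - z) ^ (CARD('n) - 2)) \<partial>sphere_area)"
  proof (rule nn_integral_cong_AE)
    show "AE u in sphere_area. ennreal (inversion_factor z u ^ (CARD('n) - 1)) * ennreal ((1 - (norm z)\<^sup>2) / norm (sphere_inversion z u - z) ^ CARD('n)) =
      ennreal (1 / norm (u - z) ^ (CARD('n) - 2))"
      using AE_sphere_area
    proof eventually_elim
      case (elim u)
      show ?case using inversion_factor_pos[OF elim z] one_minus_norm_pos[OF z]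
        unfolding poisson_factor[OF n elim z, symmetric] by (intro ennreal_mult[symmetric]) auto
    qed
  qed
  finally show ?thesis .
qed

text \<open>Substituting the inversion moves the pole from \<open>y\<close> to its image. The factor
  of the kernel at \<open>u\<close> cancels against the Jacobian times the Poisson density, and the
  factor at \<open>y\<close> is \<open>newton_kernel z y\<close>.\<close>

lemma poisson_potential:
  fixes z y :: "real ^ 'n"
  assumes n: "CARD('n) \<ge> 3" and z: "norm z < 1" and y: "norm y = 1"
  shows "(\<integral>\<^sup>+x. newton_kernel x y * ennreal ((1 - (norm z)\<^sup>2) / norm (x - z) ^ CARD('n)) \<partial>sphere_area) =
    newton_kernel z y * (\<integral>\<^sup>+u. newton_kernel u (sphere_inversion z y) \<partial>sphere_area)"
proof -
  let ?s = "CARD('n) - 2" and ?c = "1 - (norm z)\<^sup>2" and ?v = "sphere_inversion z y" and ?\<phi> = "sphere_inversion z"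
  have s: "?s > 0" using n by simp
  have v: "norm ?v = 1" by (rule norm_sphere_inversion[OF y z])
  have "(\<integral>\<^sup>+x. newton_kernel x y * ennreal (?c / norm (x - z) ^ CARD('n)) \<partial>sphere_area) =
    (\<integral>\<^sup>+u. ennreal (inversion_factor z u ^ (CARD('n) - 1)) * (newton_kernel (?\<phi> u) y * ennreal (?c / norm (?\<phi> u - z) ^ CARD('n))) \<partial>sphere_area)"
    by (rule nn_integral_sphere_inversion[OF z]) measurable
  also have "\<dots> = (\<integral>\<^sup>+u. newton_kernel z y * newton_kernel u ?v \<partial>sphere_area)"
  proof (rule nn_integral_cong_AE)
    show "AE u in sphere_area. ennreal (inversion_factor z u ^ (CARD('n) - 1)) * (newton_kernel (?\<phi> u) y * ennreal (?c / norm (?\<phi> u - z) ^ CARD('n))) =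
      newton_kernel z y * newton_kernel u ?v"
      using AE_sphere_area
    proof eventually_elim
      case (elim u)
      have uz: "u \<noteq> z" and yz: "y \<noteq> z" and vz: "?v \<noteq> z" using elim y v z by auto
      note J = inversion_factor_pos[OF elim z] and c = one_minus_norm_pos[OF z]
      have "ennreal (inversion_factor z u ^ (CARD('n) - 1)) * (newton_kernel (?\<phi> u) y * ennreal (?c / norm (?\<phi> u - z) ^ CARD('n))) =
        newton_kernel (?\<phi> u) y * ennreal (inversion_factor z u ^ (CARD('n) - 1) * (?c / norm (?\<phi> u - z) ^ CARD('n)))"
        using J c by (subst ennreal_mult) (auto simp: ac_simps)
      also have "\<dots> = newton_kernel (?\<phi> u) y * ennreal (1 / norm (u - z) ^ ?s)"
        by (simp only: poisson_factor[OF n elim z])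
      also have "\<dots> = newton_kernel z y * newton_kernel u ?v"
      proof (cases "u = ?v")
        \<comment> \<open>The substitution sends \<open>?v\<close> to \<open>y\<close>, so both
          sides are infinite here.\<close>
        case True
        then have "?\<phi> u = y" by (simp add: sphere_inversion_inversion[OF y z])
        then show ?thesis using True s uz newton_kernel_pos[of z y]
          by (simp add: newton_kernel_refl ennreal_mult_top ennreal_top_mult)
      next
        case False
        then have "?\<phi> u \<noteq> y" using sphere_inversion_inversion[OF elim z] by metis
        have "norm (?\<phi> u - y) = norm (?\<phi> u - ?\<phi> ?v)" by (simp add: sphere_inversion_inversion[OF y z])
        also have "\<dots> = ?c * norm (u - ?v) / (norm (u - z) * norm (?v - z))"
          by (rule dist_sphere_inversion[OF elim v z])
        also have "norm (?v - z) = ?c / norm (y - z)"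
          by (rule norm_sphere_inversion_diff[OF y z])
        finally have *: "norm (?\<phi> u - y) = norm (u - ?v) * norm (z - y) / norm (u - z)"
          using c by (simp add: norm_minus_commute)
        have "newton_kernel (?\<phi> u) y * ennreal (1 / norm (u - z) ^ ?s) = ennreal (1 / norm (?\<phi> u - y) ^ ?s * (1 / norm (u - z) ^ ?s))"
          using \<open>?\<phi> u \<noteq> y\<close> by (subst ennreal_mult) (auto simp: newton_kernel_neq)
        also have "1 / norm (?\<phi> u - y) ^ ?s * (1 / norm (u - z) ^ ?s) = 1 / norm (z - y) ^ ?s * (1 / norm (u - ?v) ^ ?s)"
          unfolding * using uz by (simp add: power_divide power_mult_distrib)
        also have "ennreal \<dots> = newton_kernel z y * newton_kernel u ?v"
          using False yz by (subst ennreal_mult) (auto simp: newton_kernel_neq)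
        finally show ?thesis .
      qed
      finally show ?case .
    qed
  qed
  also have "\<dots> = newton_kernel z y * (\<integral>\<^sup>+u. newton_kernel u ?v \<partial>sphere_area)"
    by (rule nn_integral_cmult) measurable
  finally show ?thesis .
qed

text \<open>Tangent line bound for the convex function taking \<open>p ^ 2\<close> to
  \<open>1 / p ^ s\<close>. The squared distance is the right variable because on the sphere it is
  affine in the inner product with the direction of the pole.\<close>

lemma inverse_power_tangent:
  fixes p q :: real
  assumes "p > 0" "q > 0"
  shows "1 / q ^ s - 1 / p ^ s \<ge> - (s / 2) * (1 / p ^ (s + 2)) * (q\<^sup>2 - p\<^sup>2)"
proof -
  define x where "x = q / p"
  have x: "x > 0" using assms by (simp add: x_def)
  have "ln (x\<^sup>2) \<le> x\<^sup>2 - 1" using x by (intro ln_le_minus_one) simp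
  then have "s * (2 * ln x) \<le> s * (x\<^sup>2 - 1)" using x by (intro mult_left_mono) (simp_all add: ln_realpow)
  then have "s * ln x \<le> s / 2 * (x\<^sup>2 - 1)" by simp
  moreover have "1 + (- (s * ln x)) \<le> exp (- (s * ln x))" by (rule exp_ge_add_one_self)
  moreover have "exp (- (s * ln x)) = 1 / x ^ s"
    using x by (simp add: exp_minus ln_realpow[symmetric] divide_inverse)
  ultimately have "1 / x ^ s - 1 \<ge> - (s / 2) * (x\<^sup>2 - 1)" by simp
  then have "1 / p ^ s * (- (s / 2) * (x\<^sup>2 - 1)) \<le> 1 / p ^ s * (1 / x ^ s - 1)"
    using assms by (intro mult_left_mono) auto
  moreover have "1 / p ^ s * (1 / x ^ s - 1) = 1 / q ^ s - 1 / p ^ s"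
    using assms by (simp add: x_def power_divide field_simps)
  moreover have "1 / p ^ s * (- (s / 2) * (x\<^sup>2 - 1)) = - (s / 2) * (1 / p ^ (s + 2)) * (q\<^sup>2 - p\<^sup>2)"
    using assms by (simp add: x_def power_divide power_add power2_eq_square field_simps)
  ultimately show ?thesis by linarith
qed

lemma integrable_sphere_area_inverse_power:
  fixes z :: "'a::euclidean_space"
  assumes z: "norm z < 1"
  shows "integrable sphere_area (\<lambda>u. 1 / norm (u - z) ^ k)"
proof -
  interpret finite_measure "sphere_area :: 'a measure" by (rule finite_measure_sphere_area)
  show ?thesis
  proof (rule integrable_const_bound)
    show "AE u in sphere_area. norm (1 / norm (u - z) ^ k) \<le> 1 / (1 - norm z) ^ k"
      using AE_sphere_area
    proof eventually_elim
      case (elim u)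
      have "1 - norm z \<le> norm (u - z)" using norm_triangle_ineq2[of u z] elim by simp
      then have "(1 - norm z) ^ k \<le> norm (u - z) ^ k" "0 < norm (u - z)" using z by (auto intro!: power_mono)
      then show ?case using z by (auto intro!: divide_left_mono mult_pos_pos zero_less_power simp del: zero_less_norm_iff)
    qed
  qed measurable
qed

text \<open>
  Let \<open>F\<close> and \<open>G\<close> be the means over the sphere of the powers \<open>2 - d\<close> and \<open>-d\<close> of the distance to
  \<open>\<rho> e\<close>. The change of variables by the inversion gives \<open>F = (1 - \<rho>\<^sup>2) G\<close>. With this identity the first order
  terms in the tangent inequality cancel, so \<open>F\<close> changes at most quadratically and is constant.
\<close>

lemma nn_integral_newton_kernel_inside:
  fixes z :: "real ^ 'n"
  assumes n: "CARD('n) \<ge> 3" and z: "norm z < 1"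
  shows "(\<integral>\<^sup>+u. ennreal (1 / norm (u - z) ^ (CARD('n) - 2)) \<partial>sphere_area) = emeasure sphere_area (UNIV :: (real ^ 'n) set)"
proof -
  interpret finite_measure "sphere_area :: (real ^ 'n) measure" by (rule finite_measure_sphere_area)
  obtain e :: "real ^ 'n" where e: "norm e = 1" and ze: "z = norm z *\<^sub>R e"
  proof (cases "z = 0")
    case True
    then show ?thesis using that[of "axis undefined 1"] by simp
  next
    case False
    then show ?thesis using that[of "sgn z"] by (simp add: norm_sgn sgn_div_norm)
  qed
  let ?s = "CARD('n) - 2"
  have d: "CARD('n) = ?s + 2" using n by simp
  define F where "F \<rho> = (\<integral>u. 1 / norm (u - \<rho> *\<^sub>R e) ^ ?s \<partial>sphere_area)" for \<rho>
  define G where "G \<rho> = (\<integral>u. 1 / norm (u - \<rho> *\<^sub>R e) ^ CARD('n) \<partial>sphere_area)" for \<rho>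
  define W where "W = measure sphere_area (UNIV :: (real ^ 'n) set)"
  have nz: "norm (\<rho> *\<^sub>R e) < 1" if "0 \<le> \<rho>" "\<rho> < 1" for \<rho> using that e by simp
  have nnF: "(\<integral>\<^sup>+u. ennreal (1 / norm (u - \<rho> *\<^sub>R e) ^ ?s) \<partial>sphere_area) = ennreal (F \<rho>)" if "0 \<le> \<rho>" "\<rho> < 1" for \<rho>
    unfolding F_def by (intro nn_integral_eq_integral integrable_sphere_area_inverse_power nz that) auto
  have FG: "F \<rho> = (1 - \<rho>\<^sup>2) * G \<rho>" if \<rho>: "0 \<le> \<rho>" "\<rho> < 1" for \<rho>
  proof -
    have c: "1 - \<rho>\<^sup>2 > 0" using one_minus_norm_pos[OF nz[OF \<rho>]] e \<rho> by simp
    have "ennreal (F \<rho>) = (\<integral>\<^sup>+x. ennreal ((1 - (norm (\<rho> *\<^sub>R e))\<^sup>2) / norm (x - \<rho> *\<^sub>R e) ^ CARD('n)) \<partial>sphere_area)"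
      unfolding nnF[OF \<rho>, symmetric] by (rule poisson_mass[OF n nz[OF \<rho>], symmetric])
    also have "\<dots> = (\<integral>\<^sup>+x. ennreal ((1 - \<rho>\<^sup>2) * (1 / norm (x - \<rho> *\<^sub>R e) ^ CARD('n))) \<partial>sphere_area)"
      using e by simp
    also have "\<dots> = ennreal (\<integral>x. (1 - \<rho>\<^sup>2) * (1 / norm (x - \<rho> *\<^sub>R e) ^ CARD('n)) \<partial>sphere_area)"
      using c by (intro nn_integral_eq_integral integrable_mult_right integrable_sphere_area_inverse_power nz \<rho>) auto
    also have "\<dots> = ennreal ((1 - \<rho>\<^sup>2) * G \<rho>)"
      unfolding G_def by (subst integral_mult_right_zero) simp
    finally show ?thesis using c
      by (subst (asm) ennreal_inj) (auto simp: F_def G_def intro!: integral_nonneg_AE mult_nonneg_nonneg)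
  qed
  have lower: "F \<rho>' - F \<rho> \<ge> - (?s / 2) * (\<rho>' - \<rho>)\<^sup>2 * G \<rho>"
    if \<rho>: "0 < \<rho>" "\<rho> < 1" and \<rho>': "0 < \<rho>'" "\<rho>' < 1" for \<rho> \<rho>'
  proof -
    note nz1 = nz[OF less_imp_le[OF \<rho>(1)] \<rho>(2)] nz[OF less_imp_le[OF \<rho>'(1)] \<rho>'(2)]
    note int = integrable_sphere_area_inverse_power[OF nz1(1)] integrable_sphere_area_inverse_power[OF nz1(2)]
    let ?h = "\<lambda>u. - (?s / 2) * (\<rho>' - \<rho>) * ((\<rho>' - 1 / \<rho>) * (1 / norm (u - \<rho> *\<^sub>R e) ^ CARD('n)) + (1 / \<rho>) * (1 / norm (u - \<rho> *\<^sub>R e) ^ ?s))"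
    have "(\<integral>u. ?h u \<partial>sphere_area) \<le> (\<integral>u. 1 / norm (u - \<rho>' *\<^sub>R e) ^ ?s - 1 / norm (u - \<rho> *\<^sub>R e) ^ ?s \<partial>sphere_area)"
    proof (rule integral_mono_AE)
      show "AE u in sphere_area. ?h u \<le> 1 / norm (u - \<rho>' *\<^sub>R e) ^ ?s - 1 / norm (u - \<rho> *\<^sub>R e) ^ ?s"
        using AE_sphere_area
      proof eventually_elim
        case (elim u)
        let ?p = "norm (u - \<rho> *\<^sub>R e)" and ?q = "norm (u - \<rho>' *\<^sub>R e)"
        have p: "?p > 0" "?q > 0" using elim nz1 by auto
        have uu: "u \<bullet> u = 1" "e \<bullet> e = 1" using elim e by (simp_all add: norm_eq_sqrt_inner)
        \<comment> \<open>Both squares are affine in \<open>u \<bullet> e\<close>, so their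
          difference can be written with \<open>?p\<close> alone and only the integrands of
          \<open>F\<close> and \<open>G\<close> remain.\<close>
        have p2: "?p\<^sup>2 = 1 - 2 * \<rho> * (u \<bullet> e) + \<rho>\<^sup>2" "?q\<^sup>2 = 1 - 2 * \<rho>' * (u \<bullet> e) + \<rho>'\<^sup>2"
          unfolding power2_norm_eq_inner by (simp_all add: inner_diff inner_commute uu power2_eq_square)
        have "?q\<^sup>2 - ?p\<^sup>2 = (\<rho>' - \<rho>) * ((\<rho>' - 1 / \<rho>) + (1 / \<rho>) * ?p\<^sup>2)"
          unfolding p2 using \<rho> by (simp add: power2_eq_square field_simps)
        moreover have "- (S / 2) * (1 / P) * (X * (Y + R * Z)) = - (S / 2) * X * (Y * (1 / P) + R * (Z / P))" for S P X Y R Z :: real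
          by (simp add: algebra_simps)
        ultimately have "- (?s / 2) * (1 / ?p ^ (?s + 2)) * (?q\<^sup>2 - ?p\<^sup>2) =
           - (?s / 2) * (\<rho>' - \<rho>) * ((\<rho>' - 1 / \<rho>) * (1 / ?p ^ (?s + 2)) + (1 / \<rho>) * (?p\<^sup>2 / ?p ^ (?s + 2)))"
          by (simp only:)
        also have "?p\<^sup>2 / ?p ^ (?s + 2) = 1 / ?p ^ ?s" using p by (simp add: power_add power2_eq_square)
        finally have eq: "- (?s / 2) * (1 / ?p ^ (?s + 2)) * (?q\<^sup>2 - ?p\<^sup>2) = ?h u"
          unfolding d[symmetric] .
        show ?case by (rule ord_eq_le_trans[OF eq[symmetric] inverse_power_tangent[OF p]])
      qed
    qed (intro Bochner_Integration.integrable_diff integrable_mult_right Bochner_Integration.integrable_add int)+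
    also have "\<dots> = F \<rho>' - F \<rho>"
      unfolding F_def by (intro Bochner_Integration.integral_diff int)
    also have "(\<integral>u. ?h u \<partial>sphere_area) = - (?s / 2) * (\<rho>' - \<rho>) * ((\<rho>' - 1 / \<rho>) * G \<rho> + (1 / \<rho>) * F \<rho>)"
      unfolding F_def G_def integral_mult_right_zero
      by (subst Bochner_Integration.integral_add) (intro integrable_mult_right int, intro integrable_mult_right int, simp only: integral_mult_right_zero)
    \<comment> \<open>\<open>FG\<close> cancels the first order part: a second factor
      \<open>\<rho>' - \<rho>\<close> appears.\<close>
    also have "(\<rho>' - 1 / \<rho>) * G \<rho> + (1 / \<rho>) * F \<rho> = (\<rho>' - \<rho>) * G \<rho>"
      using \<rho> by (simp add: FG power2_eq_square field_simps)
    finally show ?thesis by (simp add: power2_eq_square mult_ac)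
  qed
  have W0: "W \<ge> 0" by (simp add: W_def)
  have Gb: "0 \<le> G \<rho>" "G \<rho> \<le> W / (1 - b) ^ CARD('n)" if "0 < \<rho>" "\<rho> \<le> b" "b < 1" for \<rho> b
  proof -
    show "0 \<le> G \<rho>" unfolding G_def by (intro integral_nonneg_AE) auto
    have "G \<rho> \<le> (\<integral>u. 1 / (1 - b) ^ CARD('n) \<partial>(sphere_area :: (real ^ 'n) measure))"
      unfolding G_def
    proof (rule integral_mono_AE)
      show "AE u in sphere_area. 1 / norm (u - \<rho> *\<^sub>R e) ^ CARD('n) \<le> 1 / (1 - b) ^ CARD('n)"
        using AE_sphere_area
      proof eventually_elim
        case (elim u)
        have "1 - b \<le> norm (u - \<rho> *\<^sub>R e)" using norm_triangle_ineq2[of u "\<rho> *\<^sub>R e"] elim e that by simp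
        then show ?case using that by (intro divide_left_mono power_mono mult_pos_pos zero_less_power) auto
      qed
    qed (use that in \<open>auto intro!: integrable_sphere_area_inverse_power nz\<close>)
    then show "G \<rho> \<le> W / (1 - b) ^ CARD('n)" by (simp add: W_def)
  qed
  have deriv: "(F has_real_derivative 0) (at \<rho>)" if \<rho>: "\<rho> \<in> {0<..<1}" for \<rho>
  proof -
    \<comment> \<open>\<open>b\<close> lies strictly between \<open>\<rho>\<close> and 1, so one
      bound on \<open>G\<close> serves both radii.\<close>
    define b where "b = (1 + \<rho>) / 2"
    define K where "K = ?s / 2 * (W / (1 - b) ^ CARD('n))"
    have b: "\<rho> < b" "b < 1" using \<rho> by (auto simp: b_def)
    have K: "\<bar>F \<rho>' - F \<rho>\<bar> \<le> K * (\<rho>' - \<rho>)\<^sup>2" if "\<rho>' \<in> {0<..<b}" for \<rho>'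
    proof -
      have *: "?s / 2 * (\<rho>' - \<rho>)\<^sup>2 * G t \<le> K * (\<rho>' - \<rho>)\<^sup>2" if "0 < t" "t < b" for t
      proof -
        have "?s / 2 * (\<rho>' - \<rho>)\<^sup>2 * G t \<le> ?s / 2 * (\<rho>' - \<rho>)\<^sup>2 * (W / (1 - b) ^ CARD('n))"
          using Gb[of t b] that b by (intro mult_left_mono) auto
        then show ?thesis by (simp add: K_def mult_ac)
      qed
      have "- (K * (\<rho>' - \<rho>)\<^sup>2) \<le> F \<rho>' - F \<rho>"
        using lower[of \<rho> \<rho>'] *[of \<rho>] that \<rho> b by simp
      \<comment> \<open>Exchanging the two radii in \<open>lower\<close> gives the matching upper
        bound, so the increment of \<open>F\<close> is quadratic.\<close>
      moreover have "- (K * (\<rho>' - \<rho>)\<^sup>2) \<le> F \<rho> - F \<rho>'"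
        using lower[of \<rho>' \<rho>] *[of \<rho>'] that \<rho> b by (simp add: power2_commute[of \<rho> \<rho>'])
      ultimately show ?thesis by linarith
    qed
    have "((\<lambda>\<rho>'. (F \<rho>' - F \<rho>) / (\<rho>' - \<rho>)) \<longlongrightarrow> 0) (at \<rho>)"
    proof (rule Lim_null_comparison)
      have "((\<lambda>\<rho>'. K * \<bar>\<rho>' - \<rho>\<bar>) \<longlongrightarrow> K * \<bar>\<rho> - \<rho>\<bar>) (at \<rho>)"
        by (intro tendsto_intros)
      then show "((\<lambda>\<rho>'. K * \<bar>\<rho>' - \<rho>\<bar>) \<longlongrightarrow> 0) (at \<rho>)" by simp
      have "eventually (\<lambda>\<rho>'. \<rho>' \<in> {0<..<b}) (at \<rho>)"
        using \<rho> b by (intro eventually_at_in_open') auto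
      moreover have "eventually (\<lambda>\<rho>'. \<rho>' \<noteq> \<rho>) (at \<rho>)" by (simp add: eventually_at_filter)
      ultimately show "eventually (\<lambda>\<rho>'. norm ((F \<rho>' - F \<rho>) / (\<rho>' - \<rho>)) \<le> K * \<bar>\<rho>' - \<rho>\<bar>) (at \<rho>)"
      proof eventually_elim
        case (elim \<rho>')
        then show ?case using K[OF elim(1)] by (simp add: divide_simps power2_eq_square abs_mult mult_ac)
      qed
    qed
    then show ?thesis by (simp add: has_field_derivative_iff)
  qed
  have const: "\<exists>L. \<forall>\<rho>\<in>{0<..<1}. F \<rho> = L"
    by (rule has_field_derivative_zero_constant) (auto intro!: has_field_derivative_at_within deriv)
  then obtain L where L: "\<And>\<rho>. \<rho> \<in> {0<..<1} \<Longrightarrow> F \<rho> = L" by blast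
  have bnd: "W / (1 + \<rho>) ^ ?s \<le> F \<rho>" "F \<rho> \<le> W / (1 - \<rho>) ^ ?s" if \<rho>: "0 \<le> \<rho>" "\<rho> < 1" for \<rho>
  proof -
    have "AE u in sphere_area. 1 - \<rho> \<le> norm (u - \<rho> *\<^sub>R e) \<and> norm (u - \<rho> *\<^sub>R e) \<le> 1 + \<rho>"
      using AE_sphere_area
    proof eventually_elim
      case (elim u)
      show ?case using norm_triangle_ineq2[of u "\<rho> *\<^sub>R e"] norm_triangle_ineq4[of u "\<rho> *\<^sub>R e"] elim e that by simp
    qed
    then have ae: "AE u in sphere_area. 1 / (1 + \<rho>) ^ ?s \<le> 1 / norm (u - \<rho> *\<^sub>R e) ^ ?s"
        "AE u in sphere_area. 1 / norm (u - \<rho> *\<^sub>R e) ^ ?s \<le> 1 / (1 - \<rho>) ^ ?s"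
      by (eventually_elim, use \<rho> in \<open>auto intro!: divide_left_mono power_mono mult_pos_pos zero_less_power\<close>)+
    have "(\<integral>u. 1 / (1 + \<rho>) ^ ?s \<partial>(sphere_area :: (real ^ 'n) measure)) \<le> F \<rho>"
      unfolding F_def using ae(1) by (intro integral_mono_AE integrable_sphere_area_inverse_power nz \<rho>) auto
    then show "W / (1 + \<rho>) ^ ?s \<le> F \<rho>" by (simp add: W_def)
    have "F \<rho> \<le> (\<integral>u. 1 / (1 - \<rho>) ^ ?s \<partial>(sphere_area :: (real ^ 'n) measure))"
      unfolding F_def using ae(2) by (intro integral_mono_AE integrable_sphere_area_inverse_power nz \<rho>) auto
    then show "F \<rho> \<le> W / (1 - \<rho>) ^ ?s" by (simp add: W_def)
  qed
  \<comment> \<open>The constant is known only for positive radii; the bounds \<open>bnd\<close>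
    identify it in the limit at the centre.\<close>
  have "L = W"
  proof (rule antisym)
    have *: "eventually (\<lambda>\<rho>::real. \<rho> \<in> {0<..<1}) (at_right 0)"
      by (rule eventually_at_right_real) simp
    have "((\<lambda>\<rho>. W / (1 - \<rho>) ^ ?s) \<longlongrightarrow> W / (1 - 0) ^ ?s) (at_right 0)" by (intro tendsto_intros) auto
    then show "L \<le> W"
      by (intro tendsto_lowerbound[where F="at_right (0::real)" and f="\<lambda>\<rho>. W / (1 - \<rho>) ^ ?s"])
        (use * in \<open>auto elim!: eventually_mono simp: L[symmetric] intro!: bnd\<close>)
    have "((\<lambda>\<rho>. W / (1 + \<rho>) ^ ?s) \<longlongrightarrow> W / (1 + 0) ^ ?s) (at_right 0)" by (intro tendsto_intros) auto
    then show "W \<le> L"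
      by (intro tendsto_upperbound[where F="at_right (0::real)" and f="\<lambda>\<rho>. W / (1 + \<rho>) ^ ?s"])
        (use * in \<open>auto elim!: eventually_mono simp: L[symmetric] intro!: bnd\<close>)
  qed
  have "F (norm z) = W"
  proof (cases "norm z = 0")
    case True
    then show ?thesis using bnd[of 0] by simp
  next
    case False
    then show ?thesis using L[of "norm z"] z \<open>L = W\<close> by simp
  qed
  then show ?thesis using nnF[of "norm z"] z ze by (simp add: W_def emeasure_eq_measure)
qed

text \<open>Fatou's lemma along the radius ending at \<open>v\<close>; at interior points the
  potential equals the total area.\<close>

lemma nn_integral_newton_kernel_sphere_le:
  fixes v :: "real ^ 'n"
  assumes n: "CARD('n) \<ge> 3" and v: "norm v = 1"
  shows "(\<integral>\<^sup>+u. newton_kernel u v \<partial>sphere_area) \<le> emeasure sphere_area (UNIV :: (real ^ 'n) set)"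
proof -
  let ?s = "CARD('n) - 2"
  define \<rho> where "\<rho> k = 1 - inverse (real (Suc (Suc k)))" for k
  have \<rho>: "norm (\<rho> k *\<^sub>R v) < 1" for k using v by (simp add: \<rho>_def field_simps)
  have "(\<lambda>k. inverse (real (Suc (Suc k)))) \<longlonglongrightarrow> 0" by (rule LIMSEQ_Suc[OF LIMSEQ_inverse_real_of_nat])
  then have lim: "\<rho> \<longlonglongrightarrow> 1" unfolding \<rho>_def using tendsto_diff[OF tendsto_const[of "1::real"]] by fastforce
  have "(\<integral>\<^sup>+u. newton_kernel u v \<partial>sphere_area) \<le> (\<integral>\<^sup>+u. liminf (\<lambda>k. newton_kernel u (\<rho> k *\<^sub>R v)) \<partial>sphere_area)"
  proof (rule nn_integral_mono)
    fix u :: "real ^ 'n"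
    have "(\<lambda>k. newton_kernel (\<rho> k *\<^sub>R v) u) \<longlonglongrightarrow> newton_kernel (1 *\<^sub>R v) u"
      by (intro newton_kernel_tendsto tendsto_intros lim)
    then have "(\<lambda>k. newton_kernel u (\<rho> k *\<^sub>R v)) \<longlonglongrightarrow> newton_kernel u v"
      by (simp add: newton_kernel_commute[of u])
    then show "newton_kernel u v \<le> liminf (\<lambda>k. newton_kernel u (\<rho> k *\<^sub>R v))"
      by (simp add: lim_imp_Liminf)
  qed
  also have "\<dots> \<le> liminf (\<lambda>k. \<integral>\<^sup>+u. newton_kernel u (\<rho> k *\<^sub>R v) \<partial>sphere_area)"
    by (rule nn_integral_liminf) measurable
  also have "(\<lambda>k. \<integral>\<^sup>+u. newton_kernel u (\<rho> k *\<^sub>R v) \<partial>sphere_area) = (\<lambda>_. emeasure sphere_area (UNIV :: (real ^ 'n) set))"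
  proof
    fix k
    have "(\<integral>\<^sup>+u. newton_kernel u (\<rho> k *\<^sub>R v) \<partial>sphere_area) = (\<integral>\<^sup>+u. ennreal (1 / norm (u - \<rho> k *\<^sub>R v) ^ ?s) \<partial>sphere_area)"
    proof (rule nn_integral_cong_AE)
      show "AE u in sphere_area. newton_kernel u (\<rho> k *\<^sub>R v) = ennreal (1 / norm (u - \<rho> k *\<^sub>R v) ^ ?s)"
        using AE_sphere_area
      proof eventually_elim
        case (elim u)
        then have "u \<noteq> \<rho> k *\<^sub>R v" using \<rho>[of k] by auto
        then show ?case by (simp add: newton_kernel_neq)
      qed
    qed
    then show "(\<integral>\<^sup>+u. newton_kernel u (\<rho> k *\<^sub>R v) \<partial>sphere_area) = emeasure sphere_area (UNIV :: (real ^ 'n) set)"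
      by (simp add: nn_integral_newton_kernel_inside[OF n \<rho>])
  qed
  also have "liminf (\<lambda>_::nat. emeasure sphere_area (UNIV :: (real ^ 'n) set)) = emeasure sphere_area (UNIV :: (real ^ 'n) set)"
    by (simp add: Liminf_const)
  finally show ?thesis .
qed

section \<open>Equilibrium conditions\<close>

definition potential :: "'a::euclidean_space measure \<Rightarrow> 'a \<Rightarrow> ennreal" where
  "potential M x = (\<integral>\<^sup>+y. newton_kernel x y \<partial>M)"

definition energy :: "'a::euclidean_space measure \<Rightarrow> 'a measure \<Rightarrow> ennreal" where
  "energy M N = (\<integral>\<^sup>+x. potential N x \<partial>M)"

lemma potential_eq: "potential M x = (\<integral>\<^sup>+y. newton_kernel y x \<partial>M)"
  unfolding potential_def by (intro nn_integral_cong newton_kernel_commute)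

lemma measurable_potential [measurable]:
  assumes "finite_measure M" and [measurable_cong]: "sets M = sets borel"
  shows "potential M \<in> borel_measurable borel"
proof -
  interpret finite_measure M by fact
  show ?thesis unfolding potential_def[abs_def] by measurable
qed

lemma energy_commute:
  assumes "finite_measure M" "finite_measure N" and [measurable_cong]: "sets M = sets borel" "sets N = sets borel"
  shows "energy M N = energy N M"
proof -
  interpret M: finite_measure M by fact
  interpret N: finite_measure N by fact
  interpret P: pair_sigma_finite M N ..
  have "energy M N = (\<integral>\<^sup>+y. \<integral>\<^sup>+x. newton_kernel x y \<partial>M \<partial>N)"
    unfolding energy_def potential_def by (rule P.Fubini'[symmetric]) measurable
  then show ?thesis unfolding energy_def potential_def by (simp add: newton_kernel_commute)
qed

text \<open>Built as a Bernoulli mixture with weight \<open>t\<close> on \<open>N\<close>, which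
  makes it a probability measure by construction and splits its integrals.\<close>

lemma mixture:
  fixes M N :: "'a::euclidean_space measure"
  assumes M: "prob_space M" "sets M = sets borel" and N: "prob_space N" "sets N = sets borel"
    and t: "0 \<le> t" "t \<le> 1"
  obtains P where "prob_space P" "sets P = sets borel"
    "\<And>f. f \<in> borel_measurable borel \<Longrightarrow> (\<integral>\<^sup>+x. f x \<partial>P) = ennreal t * (\<integral>\<^sup>+x. f x \<partial>N) + ennreal (1 - t) * (\<integral>\<^sup>+x. f x \<partial>M)"
proof -
  let ?K = "\<lambda>b. if b then N else M"
  have sub: "?K b \<in> space (prob_algebra borel)" for b
    using M N by (simp add: space_prob_algebra)
  then have K: "?K \<in> measure_pmf (bernoulli_pmf t) \<rightarrow>\<^sub>M prob_algebra borel" by auto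
  have K': "?K \<in> measure_pmf (bernoulli_pmf t) \<rightarrow>\<^sub>M subprob_algebra borel"
    by (rule measurable_prob_algebraD[OF K])
  define P where "P = measure_pmf (bernoulli_pmf t) \<bind> ?K"
  show thesis
  proof
    show "prob_space P" unfolding P_def
      by (rule prob_space_bind'[OF _ K]) (simp add: space_prob_algebra measure_pmf.prob_space_axioms)
    show "sets P = sets borel" unfolding P_def by (rule sets_bind[of _ _ borel]) (use M N in auto)
    fix f :: "'a \<Rightarrow> ennreal" assume f: "f \<in> borel_measurable borel"
    have "(\<integral>\<^sup>+x. f x \<partial>P) = (\<integral>\<^sup>+b. \<integral>\<^sup>+x. f x \<partial>?K b \<partial>measure_pmf (bernoulli_pmf t))"
      unfolding P_def by (rule nn_integral_bind[OF f K'])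
    also have "\<dots> = ennreal t * (\<integral>\<^sup>+x. f x \<partial>N) + ennreal (1 - t) * (\<integral>\<^sup>+x. f x \<partial>M)"
      using t by (simp add: nn_integral_bernoulli_pmf mult.commute)
    finally show "(\<integral>\<^sup>+x. f x \<partial>P) = ennreal t * (\<integral>\<^sup>+x. f x \<partial>N) + ennreal (1 - t) * (\<integral>\<^sup>+x. f x \<partial>M)" .
  qed
qed

text \<open>Conditioning on \<open>A\<close> has density at most \<open>1 / emeasure R A\<close>,
  once in each variable. This provides test measures of finite energy carried by a prescribed
  set.\<close>

lemma energy_uniform_measure_le:
  fixes R :: "'a::euclidean_space measure"
  assumes "finite_measure R" and [measurable_cong]: "sets R = sets borel" and A [measurable]: "A \<in> sets borel"
    and pos: "emeasure R A \<noteq> 0"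
  shows "energy (uniform_measure R A) (uniform_measure R A) \<le> energy R R / emeasure R A / emeasure R A"
proof -
  interpret R: finite_measure R by fact
  let ?N = "uniform_measure R A" and ?c = "emeasure R A"
  have N: "finite_measure ?N"
    using pos R.emeasure_finite by (intro prob_space.finite_measure prob_space_uniform_measure) auto
  have le: "(\<integral>\<^sup>+x. f x \<partial>?N) \<le> (\<integral>\<^sup>+x. f x \<partial>R) / ?c" if [measurable]: "f \<in> borel_measurable borel" for f :: "'a \<Rightarrow> ennreal"
    by (subst nn_integral_uniform_measure) (auto intro!: divide_right_mono_ennreal nn_integral_mono simp: indicator_def)
  have sN [measurable_cong]: "sets ?N = sets borel" using assms by simp
  have pN: "potential ?N x \<le> potential R x / ?c" for x
    unfolding potential_def by (rule le) measurable
  have [measurable]: "potential R \<in> borel_measurable borel" "potential ?N \<in> borel_measurable borel"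
    using N R.finite_measure_axioms sN assms(2) by (auto intro: measurable_potential)
  have "energy ?N ?N \<le> (\<integral>\<^sup>+x. potential ?N x \<partial>R) / ?c" unfolding energy_def by (rule le) measurable
  also have "\<dots> \<le> (\<integral>\<^sup>+x. potential R x / ?c \<partial>R) / ?c"
    by (intro divide_right_mono_ennreal nn_integral_mono pN)
  also have "\<dots> = energy R R / ?c / ?c"
    unfolding energy_def by (subst nn_integral_divide) auto
  finally show ?thesis .
qed

lemma energy_sphere_area:
  assumes n: "CARD('n) \<ge> 3"
  shows "energy sphere_area (sphere_area :: (real ^ 'n) measure) < \<infinity>"
proof -
  interpret finite_measure "sphere_area :: (real ^ 'n) measure" by (rule finite_measure_sphere_area)
  let ?w = "emeasure sphere_area (UNIV :: (real ^ 'n) set)"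
  have "energy sphere_area (sphere_area :: (real ^ 'n) measure) \<le> (\<integral>\<^sup>+x. ?w \<partial>(sphere_area :: (real ^ 'n) measure))"
    unfolding energy_def
  proof (rule nn_integral_mono_AE)
    show "AE x::real ^ 'n in sphere_area. potential sphere_area x \<le> ?w"
      using AE_sphere_area
    proof eventually_elim
      case (elim x)
      then show ?case unfolding potential_eq by (rule nn_integral_newton_kernel_sphere_le[OF n])
    qed
  qed
  also have "\<dots> < \<infinity>" by (simp add: emeasure_eq_measure ennreal_mult[symmetric] less_top[symmetric])
  finally show ?thesis .
qed

text \<open>The minimisation problem for Borel measures on the whole space that are carried by the
  sphere. The field enters as a Borel function; its semicontinuity and second differences are
  hypotheses of the lemmas that use them.\<close>

locale sphere_equilibrium =
  fixes M :: "(real ^ 'n) measure" and q :: "real ^ 'n \<Rightarrow> ennreal"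
  assumes dim: "CARD('n) \<ge> 3"
    and sets_M [measurable_cong, simp]: "sets M = sets borel"
    and prob_M: "prob_space M"
    and sphere_M: "AE x in M. norm x = 1"
    and q_measurable [measurable]: "q \<in> borel_measurable borel"
    and finite_energy: "energy M M + 2 * (\<integral>\<^sup>+x. q x \<partial>M) < \<infinity>"
    and minimal: "\<And>N. prob_space N \<Longrightarrow> sets N = sets borel \<Longrightarrow> AE x in N. norm x = 1 \<Longrightarrow>
      energy M M + 2 * (\<integral>\<^sup>+x. q x \<partial>M) \<le> energy N N + 2 * (\<integral>\<^sup>+x. q x \<partial>N)"
begin

sublocale prob_space M by (rule prob_M)

lemma space_M [simp]: "space M = UNIV"
  using sets_eq_imp_space_eq[OF sets_M] by simp

lemma potential_M_measurable [measurable]: "potential M \<in> borel_measurable borel"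
  by (rule measurable_potential) (simp_all add: finite_measure_axioms)

text \<open>The modified Robin constant: the minimal weighted energy minus the integral of the
  field.\<close>

definition level :: ennreal where
  "level = energy M M + (\<integral>\<^sup>+x. q x \<partial>M)"

lemma level_finite: "energy M M < \<infinity>" "(\<integral>\<^sup>+x. q x \<partial>M) < \<infinity>" "level < \<infinity>"
  using finite_energy by (auto simp: level_def ennreal_mult_less_top)

text \<open>First variation of the energy towards \<open>N\<close>: along the mixtures the weighted
  energy is a quadratic polynomial in the weight \<open>t\<close>, minimal at \<open>t = 0\<close>,
  so its right derivative there is non-negative.\<close>

lemma level_le:
  assumes N: "prob_space N" and sN [measurable_cong]: "sets N = sets borel" and "AE x in N. norm x = 1"
    and fin: "energy N N < \<infinity>"
  shows "level \<le> (\<integral>\<^sup>+x. potential M x + q x \<partial>N)"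
proof (rule ccontr)
  assume "\<not> ?thesis"
  then have less: "(\<integral>\<^sup>+x. potential M x + q x \<partial>N) < level" by simp
  have Nq: "(\<integral>\<^sup>+x. potential M x + q x \<partial>N) = energy N M + (\<integral>\<^sup>+x. q x \<partial>N)"
    unfolding energy_def by (rule nn_integral_add) measurable
  have fm: "finite_measure M" "finite_measure N" using N by (simp_all add: finite_measure_axioms prob_space.finite_measure)
  \<comment> \<open>The negated claim makes the mutual energy finite, so that all quantities can be
    taken as reals.\<close>
  have "energy N M + (\<integral>\<^sup>+x. q x \<partial>N) < \<infinity>" using less level_finite(3) Nq by (metis less_trans)
  then have "energy N M < \<infinity>" "(\<integral>\<^sup>+x. q x \<partial>N) < \<infinity>" by (auto simp: less_top)
  then obtain b qN where 1: "energy N M = ennreal b" "b \<ge> 0" "(\<integral>\<^sup>+x. q x \<partial>N) = ennreal qN" "qN \<ge> 0"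
    by (metis ennreal_cases infinity_ennreal_def less_irrefl)
  obtain a c qM where 2: "energy M M = ennreal a" "a \<ge> 0" "energy N N = ennreal c" "c \<ge> 0" "(\<integral>\<^sup>+x. q x \<partial>M) = ennreal qM" "qM \<ge> 0"
    using level_finite fin by (metis ennreal_cases infinity_ennreal_def less_irrefl)
  note reals = 1(1,3) 2(1,3,5) and nonneg = 1(2,4) 2(2,4,6)
  have *: "a + 2 * qM \<le> t * (t * c + (1 - t) * b) + (1 - t) * (t * b + (1 - t) * a) + 2 * (t * qN + (1 - t) * qM)"
    if t: "0 < t" "t < 1" for t
  proof -
    obtain P where P: "prob_space P" "sets P = sets borel"
      "\<And>f. f \<in> borel_measurable borel \<Longrightarrow> (\<integral>\<^sup>+x. f x \<partial>P) = ennreal t * (\<integral>\<^sup>+x. f x \<partial>N) + ennreal (1 - t) * (\<integral>\<^sup>+x. f x \<partial>M)"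
      using mixture[OF prob_M sets_M N sN, of t] t by auto
    have fP: "finite_measure P" by (rule prob_space.finite_measure[OF P(1)])
    have [measurable]: "potential N \<in> borel_measurable borel" "potential P \<in> borel_measurable borel"
      by (intro measurable_potential fm fP sN P)+
    have eP: "energy P X = ennreal t * energy N X + ennreal (1 - t) * energy M X"
      if "finite_measure X" "sets X = sets borel" for X
      unfolding energy_def by (rule P(3)) (rule measurable_potential[OF that])
    have "energy P P = ennreal t * energy N P + ennreal (1 - t) * energy M P" by (rule eP[OF fP P(2)])
    also have "energy N P = ennreal t * energy N N + ennreal (1 - t) * energy N M"
      using energy_commute[OF fm(2) fP sN P(2)] eP[OF fm(2) sN] energy_commute[OF fm(2) fm(1) sN sets_M] by simp
    also have "energy M P = ennreal t * energy N M + ennreal (1 - t) * energy M M"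
      using energy_commute[OF fm(1) fP sets_M P(2)] eP[OF fm(1) sets_M] by simp
    finally have "energy P P = ennreal (t * (t * c + (1 - t) * b) + (1 - t) * (t * b + (1 - t) * a))"
      using t nonneg by (simp add: reals ennreal_mult)
    moreover have "(\<integral>\<^sup>+x. q x \<partial>P) = ennreal (t * qN + (1 - t) * qM)"
      using t nonneg by (subst P(3)) (simp_all add: reals ennreal_mult)
    moreover have "AE x in P. norm x = 1"
    proof -
      have [measurable]: "{x :: real ^ 'n. norm x \<noteq> 1} \<in> sets borel" by measurable
      have "(\<integral>\<^sup>+x. indicator {x. norm x \<noteq> 1} x \<partial>N) = 0"
        using \<open>AE x in N. norm x = 1\<close> by (subst nn_integral_0_iff_AE) (auto simp: indicator_def)
      moreover have "(\<integral>\<^sup>+x. indicator {x. norm x \<noteq> 1} x \<partial>M) = 0"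
        using sphere_M by (subst nn_integral_0_iff_AE) (auto simp: indicator_def)
      ultimately have "(\<integral>\<^sup>+x. indicator {x. norm x \<noteq> 1} x \<partial>P) = 0" by (subst P(3)) simp_all
      then show ?thesis using P(2) by (subst (asm) nn_integral_0_iff_AE) (auto simp: indicator_def elim!: eventually_mono cong: measurable_cong_sets split: if_splits)
    qed
    ultimately have "energy M M + 2 * (\<integral>\<^sup>+x. q x \<partial>M) \<le> ennreal (t * (t * c + (1 - t) * b) + (1 - t) * (t * b + (1 - t) * a)) + 2 * ennreal (t * qN + (1 - t) * qM)"
      using minimal[OF P(1,2)] by simp
    moreover have two: "2 * ennreal x = ennreal (2 * x)" if "x \<ge> 0" for x
      using that by (simp add: ennreal_mult)
    ultimately have "ennreal (a + 2 * qM) \<le> ennreal (t * (t * c + (1 - t) * b) + (1 - t) * (t * b + (1 - t) * a) + 2 * (t * qN + (1 - t) * qM))"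
      using t nonneg by (simp add: reals two)
    then show ?thesis using t nonneg by (subst (asm) ennreal_le_iff) auto
  qed
  have "0 \<le> t * (c - 2 * b + a) + 2 * (b + qN - a - qM)" if t: "0 < t" "t < 1" for t
  proof -
    have "0 \<le> t * (t * (c - 2 * b + a) + 2 * (b + qN - a - qM))"
      using *[OF t] by (simp add: algebra_simps)
    then show ?thesis using t by (simp add: zero_le_mult_iff)
  qed
  moreover have "((\<lambda>t. t * (c - 2 * b + a) + 2 * (b + qN - a - qM)) \<longlongrightarrow> 0 * (c - 2 * b + a) + 2 * (b + qN - a - qM)) (at_right 0)"
    by (intro tendsto_intros)
  moreover have "eventually (\<lambda>t::real. t \<in> {0<..<1}) (at_right 0)" by (rule eventually_at_right_real) simp
  ultimately have "0 \<le> 0 * (c - 2 * b + a) + 2 * (b + qN - a - qM)"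
    by (intro tendsto_lowerbound[where F="at_right (0::real)"]) (auto elim!: eventually_mono)
  moreover have "b + qN < a + qM"
    using less nonneg unfolding Nq level_def reals by (simp add: ennreal_plus[symmetric] ennreal_less_iff del: ennreal_plus)
  ultimately show False by simp
qed

text \<open>If the inequality failed on a set of positive \<open>R\<close>-measure, it would fail by
  a fixed margin on such a set; \<open>R\<close> normalised on that set has finite energy and
  contradicts \<open>level_le\<close>.\<close>

lemma AE_level_le:
  assumes "finite_measure R" and sR [measurable_cong]: "sets R = sets borel" and sphere: "AE x in R. norm x = 1"
    and fin: "energy R R < \<infinity>"
  shows "AE x in R. level \<le> potential M x + q x"
proof -
  interpret R: finite_measure R by fact
  obtain f where f: "level = ennreal f" "f \<ge> 0" using level_finite(3) by (cases level) auto
  \<comment> \<open>The margin is \<open>inverse (Suc n)\<close>. Where the difference is negative,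
    \<open>ennreal\<close> gives 0, still below \<open>level\<close> because
    \<open>f > 0\<close>.\<close>
  have null: "AE x in R. \<not> (potential M x + q x \<le> ennreal (f - inverse (Suc n)))" if f0: "f > 0" for n
  proof (rule ccontr)
    define A where "A = {x. potential M x + q x \<le> ennreal (f - inverse (Suc n))}"
    assume "\<not> ?thesis"
    have A [measurable]: "A \<in> sets borel" unfolding A_def by measurable
    have pos: "emeasure R A \<noteq> 0"
    proof
      assume "emeasure R A = 0"
      then have "A \<in> null_sets R" using A sR by (auto simp: null_sets_def)
      then have "AE x in R. x \<notin> A" by (rule AE_not_in)
      with \<open>\<not> _\<close> show False by (simp add: A_def)
    qed
    let ?N = "uniform_measure R A"
    have "level \<le> (\<integral>\<^sup>+x. potential M x + q x \<partial>?N)"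
    proof (rule level_le)
      show "prob_space ?N" using pos by (intro prob_space_uniform_measure) (auto simp: R.emeasure_finite)
      show "AE x in ?N. norm x = 1"
        using sphere by (intro AE_uniform_measureI) (auto elim: eventually_mono)
      have "energy ?N ?N \<le> energy R R / emeasure R A / emeasure R A"
        by (rule energy_uniform_measure_le) (use pos A sR R.finite_measure_axioms in auto)
      also have "\<dots> < \<infinity>"
        using fin pos by (auto simp: less_top[symmetric] ennreal_divide_eq_top_iff)
      finally show "energy ?N ?N < \<infinity>" .
    qed (simp add: sR)
    also have "\<dots> = (\<integral>\<^sup>+x. (potential M x + q x) * indicator A x \<partial>R) / emeasure R A"
      by (rule nn_integral_uniform_measure) auto
    also have "\<dots> \<le> (\<integral>\<^sup>+x. ennreal (f - inverse (Suc n)) * indicator A x \<partial>R) / emeasure R A"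
      by (intro divide_right_mono_ennreal nn_integral_mono) (auto simp: A_def indicator_def)
    also have "\<dots> = ennreal (f - inverse (Suc n))"
      using pos by (subst nn_integral_cmult_indicator) (auto simp: ennreal_mult_divide_eq R.emeasure_finite)
    finally show False using f f0 by (simp add: ennreal_le_iff2)
  qed
  show ?thesis
  proof (cases "f > 0")
    case True
    have "AE x in R. \<forall>n. \<not> (potential M x + q x \<le> ennreal (f - inverse (Suc n)))"
      using null[OF True] by (simp add: AE_all_countable)
    then show ?thesis
    proof eventually_elim
      case (elim x)
      have "(\<lambda>n. ennreal (f - inverse (Suc n))) \<longlonglongrightarrow> ennreal (f - 0)"
        by (intro tendsto_ennrealI tendsto_diff tendsto_const LIMSEQ_inverse_real_of_nat)
      moreover have "ennreal (f - inverse (Suc n)) \<le> potential M x + q x" for n using elim by (meson linear)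
      ultimately show ?case unfolding f by (intro LIMSEQ_le_const2) auto
    qed
  qed (use f in simp)
qed

lemma AE_sphere_area_level_le: "AE x in sphere_area. level \<le> potential M x + q x"
  by (rule AE_level_le) (simp_all add: finite_measure_sphere_area AE_sphere_area energy_sphere_area[OF dim, simplified])

text \<open>\<open>potential M + q\<close> has mean \<open>level\<close> under \<open>M\<close> and
  is at least \<open>level\<close> almost everywhere, so equality holds.\<close>

lemma AE_M_le_level: "AE x in M. potential M x + q x \<le> level"
proof -
  have ge: "AE x in M. level \<le> potential M x + q x"
    by (rule AE_level_le) (use level_finite sphere_M finite_measure_axioms in auto)
  have int: "(\<integral>\<^sup>+x. potential M x + q x \<partial>M) = level"
    unfolding level_def energy_def by (rule nn_integral_add) measurable
  have "(\<integral>\<^sup>+x. (potential M x + q x) - level \<partial>M) = (\<integral>\<^sup>+x. potential M x + q x \<partial>M) - (\<integral>\<^sup>+x. level \<partial>M)"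
    using ge level_finite(3) by (intro nn_integral_diff) (use emeasure_space_1 in \<open>auto simp: ennreal_mult_eq_top_iff\<close>)
  also have "\<dots> = 0" using level_finite(3) using emeasure_space_1 by (simp add: int)
  finally have "AE x in M. (potential M x + q x) - level = 0"
    by (subst (asm) nn_integral_0_iff_AE) auto
  then show ?thesis using ge
  proof eventually_elim
    case (elim x)
    then show ?case by (simp add: diff_eq_0_iff_ennreal less_top[symmetric] level_finite)
  qed
qed

end

section \<open>Mass of small balls\<close>

lemma ennreal_add_right_cancel_le: "c \<noteq> \<infinity> \<Longrightarrow> a + c \<le> b + c \<longleftrightarrow> a \<le> b" for a b c :: ennreal
  using ennreal_add_left_cancel_le[of c a b] by (simp add: add.commute)

text \<open>The squared distance from \<open>z = (1 - t) x\<close> to \<open>y\<close> is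
  \<open>t ^ 2 + (1 - t) * (norm (x - y)) ^ 2\<close>, so the distance is at least \<open>t\<close>
  and at least \<open>1 - t\<close> times the distance from \<open>x\<close>. If \<open>y\<close> is
  closer to \<open>x\<close> than \<open>t / 2\<close>, the kernel at \<open>x\<close> is at least
  twice \<open>1 / t ^ (d - 2)\<close> and the kernel at \<open>z\<close> at most once.\<close>

lemma newton_kernel_gap:
  fixes x y :: "'a::euclidean_space"
  assumes n: "DIM('a) \<ge> 3" and x: "norm x = 1" and y: "norm y = 1" and t: "0 < t" "t \<le> 1 / 2"
  shows "newton_kernel ((1 - t) *\<^sub>R x) y + ennreal (1 / t ^ (DIM('a) - 2)) * indicator (ball x (t / 2)) y
    \<le> ennreal (1 / (1 - t) ^ (DIM('a) - 2)) * newton_kernel x y"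
proof (cases "x = y")
  case True
  then have "newton_kernel x y = \<infinity>" using n newton_kernel_refl[of x] by simp
  then show ?thesis using t by (simp add: ennreal_mult_top)
next
  case False
  let ?s = "DIM('a) - 2" and ?z = "(1 - t) *\<^sub>R x" and ?a = "norm (x - y)"
  have s: "?s \<ge> 1" using n by simp
  have a: "?a > 0" using False by simp
  have xx: "x \<bullet> x = 1" "y \<bullet> y = 1" using x y by (simp_all add: norm_eq_sqrt_inner)
  have b2: "(norm (?z - y))\<^sup>2 = t\<^sup>2 + (1 - t) * ?a\<^sup>2"
    unfolding power2_norm_eq_inner
    by (simp add: inner_diff inner_commute xx power2_eq_square algebra_simps)
  have "t\<^sup>2 \<le> (norm (?z - y))\<^sup>2" unfolding b2 using t by simp
  then have bt: "t \<le> norm (?z - y)" by (rule power2_le_imp_le) simp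
  have "((1 - t) * ?a)\<^sup>2 \<le> (norm (?z - y))\<^sup>2"
  proof -
    have "(1 - t) * ((1 - t) * ?a\<^sup>2) \<le> 1 * ((1 - t) * ?a\<^sup>2)"
      using t by (intro mult_right_mono) auto
    moreover have "((1 - t) * ?a)\<^sup>2 = (1 - t) * ((1 - t) * ?a\<^sup>2)" by (simp add: power_mult_distrib power2_eq_square)
    ultimately show ?thesis unfolding b2 using zero_le_power2[of t] by linarith
  qed
  then have ba: "(1 - t) * ?a \<le> norm (?z - y)" by (rule power2_le_imp_le) simp
  have b0: "norm (?z - y) > 0" using bt t by linarith
  have bs: "1 / norm (?z - y) ^ ?s \<le> 1 / (1 - t) ^ ?s * (1 / ?a ^ ?s)"
  proof -
    have "((1 - t) * ?a) ^ ?s \<le> norm (?z - y) ^ ?s" using t by (intro power_mono ba) auto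
    then have "1 / norm (?z - y) ^ ?s \<le> 1 / ((1 - t) * ?a) ^ ?s"
      using t a b0 by (intro divide_left_mono mult_pos_pos zero_less_power) auto
    then show ?thesis by (simp add: power_mult_distrib)
  qed
  have real: "1 / norm (?z - y) ^ ?s + 1 / t ^ ?s * indicator (ball x (t / 2)) y \<le> 1 / (1 - t) ^ ?s * (1 / ?a ^ ?s)"
  proof (cases "y \<in> ball x (t / 2)")
    case True
    then have at: "2 * ?a \<le> t" by (simp add: dist_norm)
    have "2 * (1 / t ^ ?s) \<le> 1 / ?a ^ ?s"
    proof -
      have "2 * ?a ^ ?s \<le> 2 ^ ?s * ?a ^ ?s"
        using s a by (intro mult_right_mono self_le_power) auto
      also have "\<dots> = (2 * ?a) ^ ?s" by (simp add: power_mult_distrib)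
      also have "\<dots> \<le> t ^ ?s" using at by (intro power_mono) auto
      finally show ?thesis using a t by (simp add: divide_simps)
    qed
    also have "\<dots> \<le> 1 / (1 - t) ^ ?s * (1 / ?a ^ ?s)"
    proof -
      have "(1 - t) ^ ?s \<le> 1" using t by (intro power_le_one) auto
      then have "1 \<le> 1 / (1 - t) ^ ?s" using t by (simp add: divide_simps)
      then show ?thesis using mult_right_mono[of 1 "1 / (1 - t) ^ ?s" "1 / ?a ^ ?s"] by simp
    qed
    moreover have "1 / norm (?z - y) ^ ?s \<le> 1 / t ^ ?s"
      using t b0 bt by (intro divide_left_mono power_mono mult_pos_pos zero_less_power) auto
    ultimately show ?thesis using True by simp
  qed (use bs in simp)
  have zy: "?z \<noteq> y" using b0 by auto
  have "newton_kernel ?z y + ennreal (1 / t ^ ?s) * indicator (ball x (t / 2)) y =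
    ennreal (1 / norm (?z - y) ^ ?s + 1 / t ^ ?s * indicator (ball x (t / 2)) y)"
    using zy t by (simp add: newton_kernel_neq indicator_def)
  also have "\<dots> \<le> ennreal (1 / (1 - t) ^ ?s * (1 / ?a ^ ?s))" by (rule ennreal_leI[OF real])
  also have "\<dots> = ennreal (1 / (1 - t) ^ ?s) * newton_kernel x y"
    using False t by (subst ennreal_mult) (auto simp: newton_kernel_neq)
  finally show ?thesis .
qed

lemma emeasure_sphere_area_ball_pos:
  fixes x :: "'a::euclidean_space"
  assumes x: "norm x = 1" and r: "r > 0"
  shows "emeasure sphere_area (ball x r) > 0"
proof -
  have "0 < ennreal (unit_ball_vol (real DIM('a)) / 8 ^ DIM('a) * min r 1 ^ (DIM('a) - 1))"
    using r by (simp add: ennreal_less_zero_iff)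
  also have "\<dots> \<le> emeasure sphere_area (ball x (min r 1))"
    using r by (intro emeasure_sphere_area_ball_ge x) auto
  also have "\<dots> \<le> emeasure sphere_area (ball x r)" by (intro emeasure_mono) auto
  finally show ?thesis .
qed

lemma one_over_power_le:
  fixes t :: real
  assumes t: "0 \<le> t" "t \<le> 1 / 2"
  shows "1 / (1 - t) ^ s \<le> 1 + s * 2 ^ s * t"
proof -
  have "1 - s * t \<le> (1 - t) ^ s" using Bernoulli_inequality[of "-t" s] t by simp
  then have 1: "1 - (1 - t) ^ s \<le> s * t" by simp
  have "(1 / 2) ^ s \<le> (1 - t) ^ s" using t by (intro power_mono) auto
  then have 2: "1 / (1 - t) ^ s \<le> 2 ^ s"
    using t by (simp add: power_divide divide_simps mult.commute)
  have "1 / (1 - t) ^ s - 1 = (1 - (1 - t) ^ s) * (1 / (1 - t) ^ s)"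
    using t by (simp add: field_simps)
  also have "\<dots> \<le> (s * t) * 2 ^ s" using 1 2 t by (intro mult_mono) auto
  finally show ?thesis by (simp add: mult_ac)
qed

section \<open>Boundary and interior values of the potential\<close>

context sphere_equilibrium
begin

text \<open>By Tonelli's theorem it suffices to treat a point mass at \<open>y\<close>. There
  \<open>poisson_potential\<close> leaves the potential of surface measure at a point of the sphere,
  which is at most the total area.\<close>

lemma potential_poisson_le:
  assumes z: "norm z < 1"
  shows "(\<integral>\<^sup>+x. potential M x * ennreal ((1 - (norm z)\<^sup>2) / norm (x - z) ^ CARD('n)) \<partial>sphere_area)
    \<le> emeasure sphere_area (UNIV :: (real ^ 'n) set) * potential M z"
proof -
  interpret \<sigma>: finite_measure "sphere_area :: (real ^ 'n) measure" by (rule finite_measure_sphere_area)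
  interpret P: pair_sigma_finite "sphere_area :: (real ^ 'n) measure" M ..
  let ?p = "\<lambda>x. ennreal ((1 - (norm z)\<^sup>2) / norm (x - z) ^ CARD('n))"
  have "(\<integral>\<^sup>+x. potential M x * ?p x \<partial>sphere_area) = (\<integral>\<^sup>+x. \<integral>\<^sup>+y. newton_kernel x y * ?p x \<partial>M \<partial>sphere_area)"
    unfolding potential_def by (intro nn_integral_cong nn_integral_multc[symmetric]) measurable
  also have "\<dots> = (\<integral>\<^sup>+y. \<integral>\<^sup>+x. newton_kernel x y * ?p x \<partial>sphere_area \<partial>M)"
    by (rule P.Fubini'[symmetric]) measurable
  also have "\<dots> \<le> (\<integral>\<^sup>+y. emeasure sphere_area (UNIV :: (real ^ 'n) set) * newton_kernel z y \<partial>M)"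
  proof (rule nn_integral_mono_AE)
    show "AE y in M. (\<integral>\<^sup>+x. newton_kernel x y * ?p x \<partial>sphere_area) \<le> emeasure sphere_area (UNIV :: (real ^ 'n) set) * newton_kernel z y"
      using sphere_M
    proof eventually_elim
      case (elim y)
      show ?case
        unfolding poisson_potential[OF dim z elim]
        using nn_integral_newton_kernel_sphere_le[OF dim norm_sphere_inversion[OF elim z]]
        by (subst mult.commute) (rule mult_right_mono, auto)
    qed
  qed
  also have "\<dots> = emeasure sphere_area (UNIV :: (real ^ 'n) set) * potential M z"
    unfolding potential_def by (rule nn_integral_cmult) measurable
  finally show ?thesis .
qed

text \<open>\<open>- reflection x0\<close> is the geodesic symmetry of the sphere at
  \<open>x0\<close>: it fixes \<open>x0\<close> and negates its orthogonal complement. It preserves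
  the Poisson density of a point on the axis through \<open>x0\<close>, so both potentials in the
  hypothesis have the same integral against it.\<close>

lemma potential_le_potential_inside:
  assumes x0: "norm x0 = 1" and t: "0 < t" "t \<le> 1 / 2"
    and ae: "AE x in sphere_area. 2 * u \<le> potential M x + potential M (- reflection x0 x) + ennreal (C * (norm (x - x0))\<^sup>2)"
    and C: "C \<ge> 0"
  shows "u \<le> potential M ((1 - t) *\<^sub>R x0) + ennreal (2 * C * t)"
proof -
  interpret \<sigma>: finite_measure "sphere_area :: (real ^ 'n) measure" by (rule finite_measure_sphere_area)
  let ?z = "(1 - t) *\<^sub>R x0" and ?R = "\<lambda>x. - reflection x0 x" and ?\<omega> = "emeasure sphere_area (UNIV :: (real ^ 'n) set)"
  let ?p = "\<lambda>x. ennreal ((1 - (norm ?z)\<^sup>2) / norm (x - ?z) ^ CARD('n))"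
  have nz: "norm ?z = 1 - t" and z: "norm ?z < 1" using x0 t by auto
  have R: "orthogonal_transformation ?R"
    by (simp add: orthogonal_transformation_neg orthogonal_transformation_reflection)
  note [measurable] = orthogonal_transformation_measurable[OF R]
  have Rz: "?R ?z = ?z" by (simp add: reflection_scaleR)
  have pR: "?p (?R x) = ?p x" for x
    using orthogonal_transformation_dist[OF R, of x ?z] by (simp only: Rz dist_norm)
  have \<omega>0: "?\<omega> \<noteq> 0" "?\<omega> \<noteq> \<infinity>"
    using emeasure_sphere_area_ball_pos[OF x0, of 1] emeasure_mono[of "ball x0 1" UNIV sphere_area]
    by (auto simp: top_unique \<sigma>.emeasure_eq_measure)
  have mass: "(\<integral>\<^sup>+x. ?p x \<partial>sphere_area) = ?\<omega>"
    using poisson_mass[OF dim z] nn_integral_newton_kernel_inside[OF dim z] by simp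
  have inv: "(\<integral>\<^sup>+x. f (?R x) \<partial>sphere_area) = (\<integral>\<^sup>+x. f x \<partial>sphere_area)"
    if [measurable]: "f \<in> borel_measurable borel" for f :: "real ^ 'n \<Rightarrow> ennreal"
  proof -
    have "(\<integral>\<^sup>+x. f x \<partial>sphere_area) = (\<integral>\<^sup>+x. f x \<partial>distr sphere_area borel ?R)"
      by (simp only: distr_sphere_area_orthogonal[OF R])
    also have "\<dots> = (\<integral>\<^sup>+x. f (?R x) \<partial>sphere_area)" by (rule nn_integral_distr) simp_all
    finally show ?thesis ..
  qed
  have I1: "(\<integral>\<^sup>+x. potential M x * ?p x \<partial>sphere_area) \<le> ?\<omega> * potential M ?z"
    by (rule potential_poisson_le[OF z])
  have "(\<integral>\<^sup>+x. potential M (?R x) * ?p (?R x) \<partial>sphere_area) = (\<integral>\<^sup>+x. potential M x * ?p x \<partial>sphere_area)"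
    by (rule inv) measurable
  then have I2: "(\<integral>\<^sup>+x. potential M (?R x) * ?p x \<partial>sphere_area) \<le> ?\<omega> * potential M ?z"
    using I1 by (simp only: pR)
  \<comment> \<open>The squared distance from \<open>x0\<close> is at most twice that from
    \<open>?z\<close>, and \<open>1 - (norm ?z)^2\<close> is at most \<open>2 * t\<close>. Two
    powers of the distance cancel and leave the Newtonian kernel with pole \<open>?z\<close>, whose
    integral is the area: the error is linear in \<open>t\<close>.\<close>
  have I3: "(\<integral>\<^sup>+x. ennreal (C * (norm (x - x0))\<^sup>2) * ?p x \<partial>sphere_area) \<le> ennreal (4 * C * t) * ?\<omega>"
  proof -
    have "(\<integral>\<^sup>+x. ennreal (C * (norm (x - x0))\<^sup>2) * ?p x \<partial>sphere_area) \<le>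
      (\<integral>\<^sup>+x. ennreal (4 * C * t) * ennreal (1 / norm (x - ?z) ^ (CARD('n) - 2)) \<partial>sphere_area)"
    proof (rule nn_integral_mono_AE)
      show "AE x in sphere_area. ennreal (C * (norm (x - x0))\<^sup>2) * ?p x \<le> ennreal (4 * C * t) * ennreal (1 / norm (x - ?z) ^ (CARD('n) - 2))"
        using AE_sphere_area
      proof eventually_elim
        case (elim x)
        let ?b = "norm (x - ?z)" and ?a = "norm (x - x0)" and ?s = "CARD('n) - 2"
        have b: "?b > 0" using elim z by auto
        have d: "CARD('n) = ?s + 2" using dim by simp
        have xx: "x \<bullet> x = 1" "x0 \<bullet> x0 = 1" using elim x0 by (simp_all add: norm_eq_sqrt_inner)
        have b2: "?b\<^sup>2 = t\<^sup>2 + (1 - t) * ?a\<^sup>2"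
          unfolding power2_norm_eq_inner
          by (simp add: inner_diff inner_commute xx power2_eq_square algebra_simps)
        have "?a\<^sup>2 \<le> 2 * ?b\<^sup>2"
        proof -
          have "0 \<le> 2 * t\<^sup>2 + (1 - 2 * t) * ?a\<^sup>2" using t by (intro add_nonneg_nonneg mult_nonneg_nonneg) auto
          then show ?thesis unfolding b2 by (simp add: algebra_simps)
        qed
        moreover have "1 - (norm ?z)\<^sup>2 \<le> 2 * t" unfolding nz by (simp add: power2_eq_square algebra_simps)
        ultimately have "?a\<^sup>2 * (1 - (norm ?z)\<^sup>2) \<le> (2 * ?b\<^sup>2) * (2 * t)"
          using one_minus_norm_pos[OF z] by (intro mult_mono) auto
        then have "C * (?a\<^sup>2 * (1 - (norm ?z)\<^sup>2)) / ?b ^ (?s + 2) \<le> C * ((2 * ?b\<^sup>2) * (2 * t)) / ?b ^ (?s + 2)"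
          using C by (intro divide_right_mono mult_left_mono) auto
        also have "\<dots> = 4 * C * t * (1 / ?b ^ ?s)" using b by (simp add: power_add power2_eq_square)
        finally have "C * ?a\<^sup>2 * ((1 - (norm ?z)\<^sup>2) / ?b ^ CARD('n)) \<le> 4 * C * t * (1 / ?b ^ ?s)"
          unfolding d[symmetric] by (simp add: mult_ac)
        moreover have "ennreal (C * ?a\<^sup>2) * ?p x = ennreal (C * ?a\<^sup>2 * ((1 - (norm ?z)\<^sup>2) / ?b ^ CARD('n)))"
          using C one_minus_norm_pos[OF z] by (intro ennreal_mult[symmetric]) auto
        moreover have "ennreal (4 * C * t) * ennreal (1 / ?b ^ ?s) = ennreal (4 * C * t * (1 / ?b ^ ?s))"
          using C t by (intro ennreal_mult[symmetric]) auto
        ultimately show ?case by (simp only: ennreal_leI)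
      qed
    qed
    also have "\<dots> = ennreal (4 * C * t) * ?\<omega>"
      unfolding nn_integral_newton_kernel_inside[OF dim z, symmetric] by (rule nn_integral_cmult) measurable
    finally show ?thesis .
  qed
  have "2 * u * ?\<omega> = (\<integral>\<^sup>+x. 2 * u * ?p x \<partial>sphere_area)"
    unfolding mass[symmetric] by (rule nn_integral_cmult[symmetric]) measurable
  also have "\<dots> \<le> (\<integral>\<^sup>+x. potential M x * ?p x + potential M (?R x) * ?p x + ennreal (C * (norm (x - x0))\<^sup>2) * ?p x \<partial>sphere_area)"
  proof (rule nn_integral_mono_AE)
    show "AE x in sphere_area. 2 * u * ?p x \<le> potential M x * ?p x + potential M (?R x) * ?p x + ennreal (C * (norm (x - x0))\<^sup>2) * ?p x"
      using ae
    proof eventually_elim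
      case (elim x)
      show ?case using mult_right_mono[OF elim, of "?p x"] by (simp only: distrib_right) simp
    qed
  qed
  also have "\<dots> = (\<integral>\<^sup>+x. potential M x * ?p x \<partial>sphere_area) + (\<integral>\<^sup>+x. potential M (?R x) * ?p x \<partial>sphere_area) +
      (\<integral>\<^sup>+x. ennreal (C * (norm (x - x0))\<^sup>2) * ?p x \<partial>sphere_area)"
    by (subst nn_integral_add, simp, simp, subst nn_integral_add) simp_all
  also have "\<dots> \<le> ?\<omega> * potential M ?z + ?\<omega> * potential M ?z + ennreal (4 * C * t) * ?\<omega>"
    by (intro add_mono I1 I2 I3)
  also have "\<dots> = 2 * (potential M ?z + ennreal (2 * C * t)) * ?\<omega>"
  proof -
    have "ennreal (4 * C * t) = ennreal (2 * (2 * C * t))" by (simp add: mult.assoc)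
    also have "\<dots> = ennreal 2 * ennreal (2 * C * t)" using C t by (intro ennreal_mult) auto
    finally have "ennreal (4 * C * t) = 2 * ennreal (2 * C * t)" by simp
    then show ?thesis by (simp add: distrib_left distrib_right mult_ac flip: mult_2)
  qed
  finally have "?\<omega> * (2 * u) \<le> ?\<omega> * (2 * (potential M ?z + ennreal (2 * C * t)))" by (simp only: mult.commute)
  then have "2 * u \<le> 2 * (potential M ?z + ennreal (2 * C * t))"
    using \<omega>0 by (subst (asm) ennreal_mult_le_mult_iff) auto
  then show ?thesis by (subst (asm) ennreal_mult_le_mult_iff) auto
qed

text \<open>The first summand comes from the factor \<open>1 / (1 - t) ^ (d - 2)\<close> on a
  potential bounded by \<open>level\<close>. The second is twice the constant for second
  differences, enlarged by \<open>2 * level / \<delta>^2\<close> so that the bound is trivial at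
  distance \<open>\<delta>\<close> or more.\<close>

definition "growth_constant C \<delta> =
  (real (CARD('n) - 2) * 2 ^ (CARD('n) - 2) * enn2real level + 2 * (C + 2 * enn2real level / \<delta>\<^sup>2))"

lemma emeasure_ball_le:
  assumes x0: "norm x0 = 1" and t: "0 < t" "t \<le> 1 / 2"
    and le: "potential M x0 + q x0 \<le> level"
    and C: "C \<ge> 0" and \<delta>: "\<delta> > 0"
    and snd_diff: "\<And>x. norm x = 1 \<Longrightarrow> norm (x - x0) < \<delta> \<Longrightarrow> q x + q (- reflection x0 x) \<le> 2 * q x0 + ennreal (C * (norm (x - x0))\<^sup>2)"
  shows "emeasure M (ball x0 (t / 2)) \<le> ennreal (growth_constant C \<delta> * t ^ (CARD('n) - 1))"
proof -
  let ?R = "\<lambda>x. - reflection x0 x" and ?z = "(1 - t) *\<^sub>R x0" and ?s = "CARD('n) - 2"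
  define f where "f = enn2real level"
  have f: "level = ennreal f" "f \<ge> 0" using level_finite(3) by (simp_all add: f_def)
  have "potential M x0 + q x0 \<noteq> \<infinity>" using le level_finite(3) by (auto simp: top_unique)
  then obtain u q0 where u: "potential M x0 = ennreal u" "u \<ge> 0" and q0: "q x0 = ennreal q0" "q0 \<ge> 0"
    by (metis ennreal_add_eq_top ennreal_cases infinity_ennreal_def)
  have uf: "u + q0 \<le> f" using le f u q0 by (simp add: ennreal_plus[symmetric] del: ennreal_plus)
  define C' where "C' = C + 2 * f / \<delta>\<^sup>2"
  have C': "C' \<ge> 0" using C f by (simp add: C'_def)
  have R: "orthogonal_transformation ?R"
    by (simp add: orthogonal_transformation_neg orthogonal_transformation_reflection)
  note [measurable] = orthogonal_transformation_measurable[OF R]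
  \<comment> \<open>Surface measure is invariant under the symmetry at \<open>x0\<close>, so the
    almost everywhere inequality also holds at the partner point.\<close>
  have lev: "AE x in sphere_area. level \<le> potential M (?R x) + q (?R x)"
  proof -
    have "AE x in distr sphere_area borel ?R. level \<le> potential M x + q x"
      by (simp only: distr_sphere_area_orthogonal[OF R] AE_sphere_area_level_le)
    then show ?thesis by (subst (asm) AE_distr_iff) simp_all
  qed
  have "AE x in sphere_area. 2 * ennreal u \<le> potential M x + potential M (?R x) + ennreal (C' * (norm (x - x0))\<^sup>2)"
    using AE_sphere_area AE_sphere_area_level_le lev
  proof eventually_elim
    case (elim x)
    let ?a = "norm (x - x0)"
    show ?case
    proof (cases "?a < \<delta>")
      case True
      have "2 * (ennreal u + ennreal q0) \<le> level + level" using add_mono[OF le le] by (simp only: u q0 mult_2)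
      also have "\<dots> \<le> (potential M x + q x) + (potential M (?R x) + q (?R x))"
        using elim by (intro add_mono) auto
      also have "\<dots> = potential M x + potential M (?R x) + (q x + q (?R x))" by (simp add: ac_simps)
      also have "\<dots> \<le> potential M x + potential M (?R x) + (2 * q x0 + ennreal (C * ?a\<^sup>2))"
        using elim True by (intro add_left_mono snd_diff) auto
      also have "\<dots> = (potential M x + potential M (?R x) + ennreal (C * ?a\<^sup>2)) + 2 * ennreal q0"
        by (simp add: q0 ac_simps)
      finally have "2 * ennreal u + 2 * ennreal q0 \<le> (potential M x + potential M (?R x) + ennreal (C * ?a\<^sup>2)) + 2 * ennreal q0"
        by (simp add: distrib_left)
      then have "2 * ennreal u \<le> potential M x + potential M (?R x) + ennreal (C * ?a\<^sup>2)"
        by (subst (asm) ennreal_add_right_cancel_le) (auto simp: ennreal_mult_eq_top_iff)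
      also have "\<dots> \<le> potential M x + potential M (?R x) + ennreal (C' * ?a\<^sup>2)"
        using f by (intro add_left_mono ennreal_leI mult_right_mono) (auto simp: C'_def)
      finally show ?thesis .
    next
      case False
      have "2 * ennreal u = ennreal (2 * u)" using u by (simp add: ennreal_mult)
      also have "\<dots> \<le> ennreal (C' * ?a\<^sup>2)"
      proof (rule ennreal_leI)
        have "\<delta>\<^sup>2 \<le> ?a\<^sup>2" using False \<delta> by (intro power_mono) auto
        then have "2 * f / \<delta>\<^sup>2 * \<delta>\<^sup>2 \<le> C' * ?a\<^sup>2"
          using f C C' by (intro mult_mono) (auto simp: C'_def)
        then show "2 * u \<le> C' * ?a\<^sup>2" using \<delta> uf q0 by simp
      qed
      finally show ?thesis by (simp add: add_increasing)
    qed
  qed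
  then have pot: "ennreal u \<le> potential M ?z + ennreal (2 * C' * t)"
    by (rule potential_le_potential_inside[OF x0 t _ C'])
  \<comment> \<open>The kernel gap integrated against \<open>M\<close>. It also makes
    \<open>potential M ?z\<close> finite, so that the bounds can be combined over the reals.\<close>
  have sum: "potential M ?z + ennreal (1 / t ^ ?s) * emeasure M (ball x0 (t / 2)) \<le> ennreal (1 / (1 - t) ^ ?s) * ennreal u"
  proof -
    have "potential M ?z + ennreal (1 / t ^ ?s) * emeasure M (ball x0 (t / 2)) =
      (\<integral>\<^sup>+y. newton_kernel ?z y + ennreal (1 / t ^ ?s) * indicator (ball x0 (t / 2)) y \<partial>M)"
      unfolding potential_def by (subst nn_integral_add) (simp_all add: nn_integral_cmult_indicator borel_measurable_indicator borel_measurable_times_ennreal)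
    also have "\<dots> \<le> (\<integral>\<^sup>+y. ennreal (1 / (1 - t) ^ ?s) * newton_kernel x0 y \<partial>M)"
    proof (rule nn_integral_mono_AE)
      show "AE y in M. newton_kernel ?z y + ennreal (1 / t ^ ?s) * indicator (ball x0 (t / 2)) y \<le> ennreal (1 / (1 - t) ^ ?s) * newton_kernel x0 y"
        using sphere_M
      proof eventually_elim
        case (elim y)
        then show ?case using newton_kernel_gap[OF _ x0 elim t] dim by simp
      qed
    qed
    also have "\<dots> = ennreal (1 / (1 - t) ^ ?s) * ennreal u"
      unfolding u(1)[symmetric] potential_def by (rule nn_integral_cmult) measurable
    finally show ?thesis .
  qed
  define m where "m = measure M (ball x0 (t / 2))"
  have m: "emeasure M (ball x0 (t / 2)) = ennreal m" "m \<ge> 0" by (simp_all add: m_def emeasure_eq_measure)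
  have "potential M ?z \<noteq> \<top>" using sum by (auto simp: ennreal_mult_eq_top_iff top_unique)
  then obtain v where v: "potential M ?z = ennreal v" "v \<ge> 0" by (cases "potential M ?z") auto
  have 1: "u \<le> v + 2 * C' * t" using pot v C' t u by (simp add: ennreal_plus[symmetric] del: ennreal_plus)
  have "ennreal (v + 1 / t ^ ?s * m) \<le> ennreal (1 / (1 - t) ^ ?s * u)"
  proof -
    have "ennreal (1 / t ^ ?s * m) = ennreal (1 / t ^ ?s) * ennreal m" using t m by (intro ennreal_mult) auto
    moreover have "ennreal (v + 1 / t ^ ?s * m) = ennreal v + ennreal (1 / t ^ ?s * m)" using t v m by (intro ennreal_plus) auto
    moreover have "ennreal (1 / (1 - t) ^ ?s * u) = ennreal (1 / (1 - t) ^ ?s) * ennreal u" using t u by (intro ennreal_mult) auto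
    ultimately show ?thesis using sum unfolding v(1) m(1) by (simp only:)
  qed
  moreover have "0 \<le> 1 / (1 - t) ^ ?s * u" using t u by auto
  ultimately have 2: "v + 1 / t ^ ?s * m \<le> 1 / (1 - t) ^ ?s * u" by (rule iffD1[OF ennreal_le_iff, rotated])
  have "1 / (1 - t) ^ ?s * u \<le> (1 + ?s * 2 ^ ?s * t) * u"
    using one_over_power_le[of t ?s] u t by (intro mult_right_mono) simp_all
  also have "\<dots> \<le> u + ?s * 2 ^ ?s * t * f"
    using uf q0 u t by (simp add: distrib_right mult_left_mono)
  \<comment> \<open>Eliminating \<open>v\<close> between \<open>1\<close> and \<open>2\<close>
    leaves a bound linear in \<open>t\<close>; multiplying by \<open>t ^ ?s\<close> yields the power
    d - 1.\<close>
  finally have "1 / t ^ ?s * m \<le> ?s * 2 ^ ?s * t * f + 2 * C' * t" using 1 2 by linarith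
  then have "t ^ ?s * (1 / t ^ ?s * m) \<le> t ^ ?s * (?s * 2 ^ ?s * t * f + 2 * C' * t)"
    using t by (intro mult_left_mono) auto
  moreover have "CARD('n) - 1 = Suc ?s" using dim by simp
  moreover have gc: "growth_constant C \<delta> = ?s * 2 ^ ?s * f + 2 * C'"
    by (simp add: growth_constant_def f_def C'_def)
  ultimately have "m \<le> growth_constant C \<delta> * t ^ (CARD('n) - 1)"
    using t unfolding gc by (simp add: algebra_simps)
  then show ?thesis unfolding m by (rule ennreal_leI)
qed

lemma le_sphere_area:
  assumes C: "C \<ge> 0" and \<delta>: "\<delta> > 0" and T: "AE x in M. x \<in> T"
    and T_sphere: "\<And>x. x \<in> T \<Longrightarrow> norm x = 1"
    and T_le: "\<And>x. x \<in> T \<Longrightarrow> potential M x + q x \<le> level"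
    and snd_diff: "\<And>x0 x. x0 \<in> T \<Longrightarrow> norm x = 1 \<Longrightarrow> norm (x - x0) < \<delta> \<Longrightarrow>
      q x + q (- reflection x0 x) \<le> 2 * q x0 + ennreal (C * (norm (x - x0))\<^sup>2)"
  obtains B where "B \<ge> 0" "\<And>A. A \<in> sets borel \<Longrightarrow> emeasure M A \<le> ennreal B * emeasure sphere_area A"
proof -
  interpret \<sigma>: finite_measure "sphere_area :: (real ^ 'n) measure" by (rule finite_measure_sphere_area)
  define v where "v = unit_ball_vol (real CARD('n)) / 8 ^ CARD('n)"
  have v: "v > 0" by (simp add: v_def)
  let ?m = "CARD('n) - 1"
  define K where "K = growth_constant C \<delta>"
  have K: "K \<ge> 0" using C \<delta> by (simp add: K_def growth_constant_def)
  define B where "B = K * 4 ^ ?m / v"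
  have B: "B \<ge> 0" using K v by (simp add: B_def)
  \<comment> \<open>A ball of radius \<open>r n\<close> meeting \<open>T\<close> lies in one of
    radius \<open>2 * r n\<close> about a point of \<open>T\<close>. This is \<open>t / 2\<close>
    for \<open>t = 4 * r n\<close>, and \<open>r n \<le> 1 / 8\<close> ensures
    \<open>t \<le> 1 / 2\<close>. The factor \<open>4 ^ ?m\<close> in \<open>B\<close> has the same
    origin.\<close>
  define r where "r n = inverse (real (Suc n)) / 8" for n
  have r: "0 < r n" "r n \<le> 1 / 8" for n by (auto simp: r_def field_simps)
  have r0: "r \<longlonglongrightarrow> 0" unfolding r_def by (rule tendsto_divide_zero[OF LIMSEQ_inverse_real_of_nat])
  have ball: "emeasure M (ball y (r n)) \<le> ennreal B * emeasure sphere_area (ball y (r n))" if y: "norm y = 1" for y n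
  proof (cases "T \<inter> ball y (r n) = {}")
    case True
    have "AE x in M. x \<notin> ball y (r n)" using T by eventually_elim (use True in auto)
    then have "ball y (r n) \<in> null_sets M" by (subst AE_iff_null_sets) auto
    then have "emeasure M (ball y (r n)) = 0" by (rule null_setsD1)
    then show ?thesis by simp
  next
    case False
    then obtain x0 where x0: "x0 \<in> T" "dist y x0 < r n" by auto
    have "ball y (r n) \<subseteq> ball x0 ((4 * r n) / 2)"
    proof
      fix w assume "w \<in> ball y (r n)"
      then show "w \<in> ball x0 ((4 * r n) / 2)"
        using x0 dist_triangle[of x0 w y] by (simp add: dist_commute)
    qed
    then have "emeasure M (ball y (r n)) \<le> emeasure M (ball x0 ((4 * r n) / 2))" by (intro emeasure_mono) auto
    also have "\<dots> \<le> ennreal (K * (4 * r n) ^ ?m)"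
      unfolding K_def
      by (rule emeasure_ball_le[OF T_sphere[OF x0(1)] _ _ T_le[OF x0(1)] C \<delta> snd_diff[OF x0(1)]]) (use r[of n] in auto)
    also have "K * (4 * r n) ^ ?m = B * (v * r n ^ ?m)" using v by (simp add: B_def power_mult_distrib)
    also have "ennreal \<dots> = ennreal B * ennreal (v * r n ^ ?m)" using B v r[of n] by (intro ennreal_mult) auto
    also have "\<dots> \<le> ennreal B * emeasure sphere_area (ball y (r n))"
      using emeasure_sphere_area_ball_ge[OF y r(1)[of n]] r(2)[of n]
      by (intro mult_left_mono) (auto simp: v_def)
    finally show ?thesis .
  qed
  define e :: "real ^ 'n" where "e = axis undefined 1"
  have e: "norm e = 1" by (simp add: e_def)
  have "emeasure M A \<le> ennreal B * emeasure sphere_area A" if A: "A \<in> sets borel" for A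
  proof (rule ball_domination[where \<sigma>=sphere_area and S="{x. norm x = 1}" and c="\<lambda>r. emeasure sphere_area (ball e r)" and r=r])
    show "AE y in sphere_area. emeasure M (ball y (r n)) \<le> ennreal B * emeasure sphere_area (ball y (r n))" for n
      using AE_sphere_area by eventually_elim (rule ball)
    show "emeasure sphere_area (ball x r) = emeasure sphere_area (ball e r)" if "x \<in> {x. norm x = 1}" for x :: "real ^ 'n" and r
      using emeasure_sphere_area_ball_cong e that by simp
  qed (use A r r0 AE_sphere_area sphere_M finite_measure_axioms finite_measure_sphere_area
    emeasure_sphere_area_ball_pos[OF e] \<sigma>.sigma_finite_measure_axioms in \<open>auto simp: \<sigma>.emeasure_eq_measure\<close>)
  then show thesis using B that by blast
qed

end

section \<open>Second differences of the field\<close>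

text \<open>The displacements from \<open>x0\<close> of \<open>x\<close> and of its partner add up
  to \<open>- (norm (x - x0)) ^ 2\<close> times \<open>x0\<close>. The first order terms of an
  ambient Taylor expansion therefore add up to a second order quantity.\<close>

lemma C2_reflection_bound_local:
  fixes g :: "'a::euclidean_space \<Rightarrow> real"
  assumes N: "openin (top_of_set usphere) N" and p: "p \<in> N" and C2: "C2_on_submanifold N g"
  obtains C \<delta> where "C \<ge> 0" "\<delta> > 0"
    "\<And>x0 x. x0 \<in> ball p \<delta> \<Longrightarrow> norm x0 = 1 \<Longrightarrow> norm x = 1 \<Longrightarrow> norm (x - x0) < \<delta> \<Longrightarrow>
      x \<in> N \<and> - reflection x0 x \<in> N \<and> g x + g (- reflection x0 x) \<le> 2 * g x0 + C * (norm (x - x0))\<^sup>2"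
proof -
  have "\<exists>U h. open U \<and> p \<in> U \<and> C2_on U h \<and> (\<forall>y\<in>U \<inter> N. g y = h y)"
    using bspec[OF C2[unfolded C2_on_submanifold_def] p] .
  then obtain U h where Uh: "open U \<and> p \<in> U \<and> C2_on U h \<and> (\<forall>y\<in>U \<inter> N. g y = h y)"
    by (elim exE) (rule that)
  then have U: "open U" "p \<in> U" and h: "\<And>y. y \<in> U \<inter> N \<Longrightarrow> g y = h y" and C2h: "C2_on U h" by simp_all
  obtain h' :: "'a \<Rightarrow> 'a \<Rightarrow>\<^sub>L real" and h'' :: "'a \<Rightarrow> 'a \<Rightarrow>\<^sub>L 'a \<Rightarrow>\<^sub>L real"
    where hh: "(\<forall>x\<in>U. (h has_derivative blinfun_apply (h' x)) (at x)) \<and>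
      (\<forall>x\<in>U. (h' has_derivative blinfun_apply (h'' x)) (at x)) \<and> continuous_on U h''"
    using C2h[unfolded C2_on_def] by (elim exE) (rule that)
  then have d1: "\<And>x. x \<in> U \<Longrightarrow> (h has_derivative blinfun_apply (h' x)) (at x)"
      and d2: "\<And>x. x \<in> U \<Longrightarrow> (h' has_derivative blinfun_apply (h'' x)) (at x)"
      and c2: "continuous_on U h''"
    by simp_all
  obtain W where W: "open W" "N = usphere \<inter> W" using N by (auto simp: openin_open)
  have "open (U \<inter> W)" "p \<in> U \<inter> W" using U W p by auto
  then obtain r where r: "r > 0" "cball p r \<subseteq> U \<inter> W" using open_contains_cball by blast
  have c1: "continuous_on U h'"
    using d2 by (intro continuous_at_imp_continuous_on) (auto intro: has_derivative_continuous)
  have bnd: "\<exists>B\<ge>0. \<forall>x\<in>cball p r. norm (f x) \<le> B" if "continuous_on U f" for f :: "'a \<Rightarrow> 'b::real_normed_vector"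
  proof -
    have "compact (f ` cball p r)"
      using that r by (intro compact_continuous_image) (auto intro: continuous_on_subset)
    then obtain B where B: "\<And>x. x \<in> cball p r \<Longrightarrow> norm (f x) \<le> B"
      using compact_imp_bounded bounded_iff by (metis imageI)
    moreover have "B \<ge> 0" using order_trans[OF norm_ge_zero B[of p]] r by simp
    ultimately show ?thesis by blast
  qed
  obtain B1 where B1: "B1 \<ge> 0" "\<And>x. x \<in> cball p r \<Longrightarrow> norm (h' x) \<le> B1" using bnd[OF c1] by blast
  obtain B2 where B2: "B2 \<ge> 0" "\<And>x. x \<in> cball p r \<Longrightarrow> norm (h'' x) \<le> B2" using bnd[OF c2] by blast
  have lip: "norm (h' x - h' y) \<le> B2 * norm (x - y)" if "x \<in> cball p r" "y \<in> cball p r" for x y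
  proof (rule differentiable_bound[where S="cball p r" and f'="\<lambda>x. blinfun_apply (h'' x)"])
    show "(h' has_derivative blinfun_apply (h'' x)) (at x within cball p r)" if "x \<in> cball p r" for x
    proof -
      have "x \<in> U" using r that by blast
      then show ?thesis by (rule has_derivative_at_withinI[OF d2])
    qed
    show "onorm (blinfun_apply (h'' x)) \<le> B2" if "x \<in> cball p r" for x
      using B2(2)[OF that] by (simp add: norm_blinfun.rep_eq)
  qed (use that in auto)
  \<comment> \<open>Mean value inequality for \<open>h\<close> minus its linear part at
    \<open>x0\<close>; the derivative \<open>h' y - h' x0\<close> has norm at most
    \<open>B2 * ?a\<close> on the ball.\<close>
  have taylor: "\<bar>h x - h x0 - h' x0 (x - x0)\<bar> \<le> B2 * (norm (x - x0))\<^sup>2"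
    if x0: "x0 \<in> ball p (r / 2)" and x: "norm (x - x0) < r / 2" for x x0
  proof -
    let ?a = "norm (x - x0)"
    have sub: "cball x0 ?a \<subseteq> cball p r"
    proof
      fix w assume "w \<in> cball x0 ?a"
      then have "dist x0 w \<le> ?a" by simp
      then show "w \<in> cball p r" using dist_triangle[of p w x0] x0 x by auto
    qed
    have "norm ((h x - h' x0 x) - (h x0 - h' x0 x0)) \<le> (B2 * ?a) * norm (x - x0)"
    proof (rule differentiable_bound[where S="cball x0 ?a" and f="\<lambda>y. h y - h' x0 y" and f'="\<lambda>y. blinfun_apply (h' y - h' x0)"])
      fix y assume y: "y \<in> cball x0 ?a"
      then have y': "y \<in> cball p r" using sub by blast
      then have "y \<in> U" using r by blast
      have "((\<lambda>y. h y - h' x0 y) has_derivative (\<lambda>v. h' y v - h' x0 v)) (at y)"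
        by (rule has_derivative_diff[OF d1[OF \<open>y \<in> U\<close>] bounded_linear_imp_has_derivative[OF blinfun.bounded_linear_right]])
      then have "((\<lambda>y. h y - h' x0 y) has_derivative blinfun_apply (h' y - h' x0)) (at y)"
        by (simp add: blinfun.diff_left[abs_def])
      then show "((\<lambda>y. h y - h' x0 y) has_derivative blinfun_apply (h' y - h' x0)) (at y within cball x0 ?a)"
        by (rule has_derivative_at_withinI)
      have "onorm (blinfun_apply (h' y - h' x0)) = norm (h' y - h' x0)" by (simp add: norm_blinfun.rep_eq)
      also have "\<dots> \<le> B2 * norm (y - x0)" by (rule lip[OF y']) (use x0 r in auto)
      also have "\<dots> \<le> B2 * ?a" using y B2(1) by (intro mult_left_mono) (auto simp: dist_norm norm_minus_commute)
      finally show "onorm (blinfun_apply (h' y - h' x0)) \<le> B2 * ?a" .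
    qed (auto simp: dist_norm norm_minus_commute)
    then show ?thesis by (simp add: blinfun.diff_right power2_eq_square algebra_simps)
  qed
  show thesis
  \<comment> \<open>\<open>B1\<close> bounds the normal term left by the two displacements,
    \<open>B2\<close> each of the two Taylor remainders. Half the radius leaves room for
    \<open>x\<close> and its partner inside \<open>cball p r\<close>.\<close>
  proof (rule that[of "B1 + 2 * B2" "r / 2"])
    fix x0 x :: 'a
    assume x0: "x0 \<in> ball p (r / 2)" "norm x0 = 1" and x: "norm x = 1" "norm (x - x0) < r / 2"
    let ?R = "\<lambda>x. - reflection x0 x" and ?a = "norm (x - x0)"
    have R: "orthogonal_transformation ?R"
      by (simp add: orthogonal_transformation_neg orthogonal_transformation_reflection)
    have Ra: "norm (?R x - x0) = ?a"
      using orthogonal_transformation_dist[OF R, of x x0] by (simp add: dist_norm)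
    have xx: "x0 \<bullet> x0 = 1" "x \<bullet> x = 1" using x0 x by (simp_all add: norm_eq_sqrt_inner)
    have sum: "(x - x0) + (?R x - x0) = - (?a\<^sup>2 *\<^sub>R x0)"
    proof -
      have "(x - x0) + (?R x - x0) = (2 * (x0 \<bullet> x) - 2) *\<^sub>R x0"
        using xx by (simp add: reflection_def scaleR_diff_left scaleR_2)
      also have "2 * (x0 \<bullet> x) - 2 = - ?a\<^sup>2"
        unfolding power2_norm_eq_inner by (simp add: inner_diff inner_commute xx)
      finally show ?thesis by simp
    qed
    have mem: "y \<in> U \<inter> N" if "norm y = 1" "norm (y - x0) < r / 2" for y
    proof -
      have "dist p y \<le> dist p x0 + dist x0 y" by (rule dist_triangle)
      then have "y \<in> cball p r" using that x0 by (simp add: dist_norm norm_minus_commute)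
      then show ?thesis using r that W by auto
    qed
    have m: "x \<in> U \<inter> N" "?R x \<in> U \<inter> N" "x0 \<in> U \<inter> N"
      using mem x Ra x0 r by auto
    have "h x + h (?R x) - 2 * h x0 \<le> h' x0 (x - x0) + h' x0 (?R x - x0) + 2 * B2 * ?a\<^sup>2"
      using taylor[OF x0(1) x(2)] taylor[OF x0(1), of "?R x"] x Ra by simp
    also have "h' x0 (x - x0) + h' x0 (?R x - x0) = h' x0 (- (?a\<^sup>2 *\<^sub>R x0))"
      unfolding sum[symmetric] by (simp only: blinfun.add_right)
    also have "\<dots> \<le> norm (h' x0) * norm (- (?a\<^sup>2 *\<^sub>R x0))"
      using norm_blinfun[of "h' x0" "- (?a\<^sup>2 *\<^sub>R x0)"] by simp
    also have "\<dots> \<le> B1 * ?a\<^sup>2"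
      using B1(2)[of x0] x0 r by (simp add: mult_right_mono)
    finally have "h x + h (?R x) \<le> 2 * h x0 + (B1 + 2 * B2) * ?a\<^sup>2" by (simp add: algebra_simps)
    then show "x \<in> N \<and> ?R x \<in> N \<and> g x + g (?R x) \<le> 2 * g x0 + (B1 + 2 * B2) * ?a\<^sup>2"
      using m h by simp
  qed (use B1 B2 r in auto)
qed

text \<open>The local bound is uniform over centres \<open>x0\<close> near \<open>p\<close>, so
  finitely many neighbourhoods covering the compact set \<open>T\<close> give common
  constants.\<close>

lemma C2_reflection_bound:
  fixes g :: "'a::euclidean_space \<Rightarrow> real"
  assumes N: "openin (top_of_set usphere) N" and T: "compact T" "T \<subseteq> N" and C2: "C2_on_submanifold N g"
  obtains C \<delta> where "C \<ge> 0" "\<delta> > 0"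
    "\<And>x0 x. x0 \<in> T \<Longrightarrow> norm x = 1 \<Longrightarrow> norm (x - x0) < \<delta> \<Longrightarrow>
      x \<in> N \<and> - reflection x0 x \<in> N \<and> g x + g (- reflection x0 x) \<le> 2 * g x0 + C * (norm (x - x0))\<^sup>2"
proof -
  let ?P = "\<lambda>p C \<delta>. C \<ge> 0 \<and> \<delta> > 0 \<and> (\<forall>x0 x. x0 \<in> ball p \<delta> \<longrightarrow> norm x0 = 1 \<longrightarrow> norm x = 1 \<longrightarrow> norm (x - x0) < \<delta> \<longrightarrow>
      x \<in> N \<and> - reflection x0 x \<in> N \<and> g x + g (- reflection x0 x) \<le> 2 * g x0 + C * (norm (x - x0))\<^sup>2)"
  have "\<forall>p\<in>N. \<exists>C \<delta>. ?P p C \<delta>"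
  proof
    fix p assume p: "p \<in> N"
    show "\<exists>C \<delta>. ?P p C \<delta>"
    proof (rule C2_reflection_bound_local[OF N p C2])
      fix C \<delta> assume *: "C \<ge> 0" "\<delta> > 0"
        "\<And>x0 x. x0 \<in> ball p \<delta> \<Longrightarrow> norm x0 = 1 \<Longrightarrow> norm x = 1 \<Longrightarrow> norm (x - x0) < \<delta> \<Longrightarrow>
          x \<in> N \<and> - reflection x0 x \<in> N \<and> g x + g (- reflection x0 x) \<le> 2 * g x0 + C * (norm (x - x0))\<^sup>2"
      show ?thesis by (rule exI[of _ C], rule exI[of _ \<delta>]) (use * in simp)
    qed
  qed
  then obtain C \<delta> where P: "\<And>p. p \<in> N \<Longrightarrow> ?P p (C p) (\<delta> p)" by metis
  have "\<exists>D\<subseteq>T. finite D \<and> T \<subseteq> (\<Union>p\<in>D. ball p (\<delta> p))"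
  proof (rule compactE_image[OF T(1), of T "\<lambda>p. ball p (\<delta> p)"])
    show "T \<subseteq> (\<Union>p\<in>T. ball p (\<delta> p))" using P T(2) by (force intro: centre_in_ball[THEN iffD2])
  qed auto
  then obtain D where D: "D \<subseteq> T" "finite D" "T \<subseteq> (\<Union>p\<in>D. ball p (\<delta> p))" by blast
  \<comment> \<open>Inserting 0 here and 1 below keeps \<open>Max\<close> and \<open>Min\<close>
    meaningful for an empty \<open>D\<close>.\<close>
  define C0 where "C0 = Max (insert 0 (C ` D))"
  define \<delta>0 where "\<delta>0 = Min (insert 1 (\<delta> ` D))"
  have "\<delta>0 > 0" using D P T by (auto simp: \<delta>0_def)
  moreover have "C0 \<ge> 0" using D by (simp add: C0_def)
  moreover have "x \<in> N \<and> - reflection x0 x \<in> N \<and> g x + g (- reflection x0 x) \<le> 2 * g x0 + C0 * (norm (x - x0))\<^sup>2"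
    if x: "x0 \<in> T" "norm x = 1" "norm (x - x0) < \<delta>0" for x0 x
  proof -
    obtain p where p: "p \<in> D" "x0 \<in> ball p (\<delta> p)" using D x by blast
    have "norm x0 = 1" using x T(2) openin_imp_subset[OF N] by auto
    moreover have "\<delta>0 \<le> \<delta> p" using D p by (simp add: \<delta>0_def)
    moreover have "C p * (norm (x - x0))\<^sup>2 \<le> C0 * (norm (x - x0))\<^sup>2"
      using D p by (intro mult_right_mono) (simp_all add: C0_def)
    moreover have "x \<in> N \<and> - reflection x0 x \<in> N \<and> g x + g (- reflection x0 x) \<le> 2 * g x0 + C p * (norm (x - x0))\<^sup>2"
    proof -
      have "?P p (C p) (\<delta> p)" using P D p T(2) by blast
      moreover have "norm (x - x0) < \<delta> p" using x(3) \<open>\<delta>0 \<le> \<delta> p\<close> by linarith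
      ultimately show ?thesis using p(2) \<open>norm x0 = 1\<close> x(2) by simp
    qed
    ultimately show ?thesis by linarith
  qed
  ultimately show thesis using that by blast
qed

section \<open>Positive definiteness of the energy\<close>

text \<open>The total weight of the balls \<open>ball w r\<close> containing both points, where
  \<open>p = (r, w)\<close> has density \<open>1 / r ^ (2 * d - 1)\<close>. This exponent gives the
  homogeneity 2 - d of the Newtonian kernel: volumes scale like \<open>r ^ d\<close> and the radial
  integration adds one more power.\<close>

definition ball_kernel :: "'a::euclidean_space \<Rightarrow> 'a \<Rightarrow> ennreal" where
  "ball_kernel x y = (\<integral>\<^sup>+p. ennreal (indicator {0<..} (fst p) / fst p ^ (2 * DIM('a) - 1)) *
     ((if dist x (snd p) < fst p then 1 else 0) * (if dist y (snd p) < fst p then 1 else 0)) \<partial>(lborel \<Otimes>\<^sub>M lborel))"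

lemma ball_kernel_eq:
  fixes x y :: "'a::euclidean_space"
  shows "ball_kernel x y = (\<integral>\<^sup>+r. ennreal (indicator {0<..} r / r ^ (2 * DIM('a) - 1)) * emeasure lborel (ball x r \<inter> ball y r) \<partial>lborel)"
proof -
  have "ball_kernel x y = (\<integral>\<^sup>+r. \<integral>\<^sup>+w. ennreal (indicator {0<..} r / r ^ (2 * DIM('a) - 1)) *
     ((if dist x w < r then 1 else 0) * (if dist y w < r then 1 else 0)) \<partial>lborel \<partial>lborel)"
    unfolding ball_kernel_def by (subst lborel.nn_integral_fst[symmetric]) (simp_all, measurable)
  also have "\<dots> = (\<integral>\<^sup>+r. ennreal (indicator {0<..} r / r ^ (2 * DIM('a) - 1)) * emeasure lborel (ball x r \<inter> ball y r) \<partial>lborel)"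
  proof (rule nn_integral_cong)
    fix r :: real
    have "(\<integral>\<^sup>+w. ennreal (indicator {0<..} r / r ^ (2 * DIM('a) - 1)) * ((if dist x w < r then 1 else 0) * (if dist y w < r then 1 else 0)) \<partial>lborel) =
      (\<integral>\<^sup>+w. ennreal (indicator {0<..} r / r ^ (2 * DIM('a) - 1)) * indicator (ball x r \<inter> ball y r) w \<partial>lborel)"
      by (intro nn_integral_cong) (auto simp: indicator_def)
    also have "\<dots> = ennreal (indicator {0<..} r / r ^ (2 * DIM('a) - 1)) * emeasure lborel (ball x r \<inter> ball y r)"
      by (rule nn_integral_cmult_indicator) simp
    finally show "(\<integral>\<^sup>+w. ennreal (indicator {0<..} r / r ^ (2 * DIM('a) - 1)) * ((if dist x w < r then 1 else 0) * (if dist y w < r then 1 else 0)) \<partial>lborel) =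
      ennreal (indicator {0<..} r / r ^ (2 * DIM('a) - 1)) * emeasure lborel (ball x r \<inter> ball y r)" .
  qed
  finally show ?thesis .
qed

lemma ball_kernel_isometry:
  fixes f :: "'a::euclidean_space \<Rightarrow> 'a"
  assumes iso: "\<And>x y. dist (f x) (f y) = dist x y" and "surj f"
  shows "ball_kernel (f x) (f y) = ball_kernel x y"
proof -
  have [measurable]: "f \<in> borel_measurable borel"
    using iso by (intro borel_measurable_continuous_onI) (auto simp: continuous_on_iff)
  have "emeasure lborel (ball (f x) r \<inter> ball (f y) r) = emeasure lborel (ball x r \<inter> ball y r)" for r
  proof -
    have "emeasure lborel (ball (f x) r \<inter> ball (f y) r) = emeasure (distr lborel borel f) (ball (f x) r \<inter> ball (f y) r)"
      by (simp only: distr_lborel_isometry[OF iso \<open>surj f\<close> refl])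
    also have "\<dots> = emeasure lborel (f -` (ball (f x) r \<inter> ball (f y) r))"
      by (subst emeasure_distr) simp_all
    also have "f -` (ball (f x) r \<inter> ball (f y) r) = ball x r \<inter> ball y r" by (auto simp: iso)
    finally show ?thesis .
  qed
  then show ?thesis by (simp only: ball_kernel_eq)
qed

lemma ball_kernel_scale:
  fixes x y :: "'a::euclidean_space"
  assumes c: "c > 0" and n: "DIM('a) \<ge> 2"
  shows "ball_kernel (c *\<^sub>R x) (c *\<^sub>R y) = ennreal (1 / c ^ (DIM('a) - 2)) * ball_kernel x y"
proof -
  let ?d = "DIM('a)"
  have ball: "emeasure lborel (ball (c *\<^sub>R x) (c * r) \<inter> ball (c *\<^sub>R y) (c * r)) = ennreal (c ^ ?d) * emeasure lborel (ball x r \<inter> ball y r)" for r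
  proof -
    let ?B = "ball (c *\<^sub>R x) (c * r) \<inter> ball (c *\<^sub>R y) (c * r)"
    have "emeasure lborel ?B = emeasure (density (distr lborel borel (\<lambda>x. 0 + c *\<^sub>R x)) (\<lambda>_. \<bar>c\<bar> ^ ?d)) ?B"
      using c by (subst lborel_affine[of c 0]) auto
    also have "\<dots> = ennreal (c ^ ?d) * emeasure (distr lborel borel (\<lambda>x. 0 + c *\<^sub>R x)) ?B"
      using c by (subst emeasure_density_const) simp_all
    also have "emeasure (distr lborel borel (\<lambda>x. 0 + c *\<^sub>R x)) ?B = emeasure lborel ((\<lambda>x. 0 + c *\<^sub>R x) -` ?B)"
      by (subst emeasure_distr) simp_all
    also have "(\<lambda>x. 0 + c *\<^sub>R x) -` ?B = ball x r \<inter> ball y r"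
      using c by (auto simp: dist_norm norm_scaleR[symmetric] simp flip: scaleR_diff_right)
    finally show ?thesis .
  qed
  have meas: "(\<lambda>r. emeasure lborel (ball x r \<inter> ball y r)) \<in> borel_measurable borel" for x y :: 'a
  proof -
    have eq: "emeasure lborel (ball x r \<inter> ball y r) = (\<integral>\<^sup>+w. (if dist x w < r \<and> dist y w < r then 1 else 0) \<partial>lborel)" for r
    proof -
      have "emeasure lborel (ball x r \<inter> ball y r) = (\<integral>\<^sup>+w. indicator (ball x r \<inter> ball y r) w \<partial>lborel)"
        by (rule nn_integral_indicator[symmetric]) simp
      also have "\<dots> = (\<integral>\<^sup>+w. (if dist x w < r \<and> dist y w < r then 1 else 0) \<partial>lborel)"
        by (intro nn_integral_cong) (auto simp: indicator_def)
      finally show ?thesis .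
    qed
    show ?thesis unfolding eq by measurable
  qed
  note [measurable] = meas
  have "ball_kernel (c *\<^sub>R x) (c *\<^sub>R y) =
    \<bar>c\<bar> * (\<integral>\<^sup>+r. ennreal (indicator {0<..} (0 + c * r) / (0 + c * r) ^ (2 * ?d - 1)) *
      emeasure lborel (ball (c *\<^sub>R x) (0 + c * r) \<inter> ball (c *\<^sub>R y) (0 + c * r)) \<partial>lborel)"
    unfolding ball_kernel_eq by (rule nn_integral_real_affine) (use c in simp_all)
  also have "\<dots> = ennreal c * (\<integral>\<^sup>+r. ennreal (1 / c ^ (?d - 1)) * (ennreal (indicator {0<..} r / r ^ (2 * ?d - 1)) * emeasure lborel (ball x r \<inter> ball y r)) \<partial>lborel)"
  proof -
    have d: "2 * ?d - 1 = (?d - 1) + Suc (?d - 1)" "?d = Suc (?d - 1)" using n by simp_all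
    have alg: "1 / (c * r) ^ (k + Suc k) * c ^ Suc k = 1 / c ^ k * (1 / r ^ (k + Suc k))" if "r > 0" for r k
      using c that by (simp add: power_add power_mult_distrib)
    have "ennreal (indicator {0<..} (c * r) / (c * r) ^ (2 * ?d - 1)) * ennreal (c ^ ?d) =
      ennreal (1 / c ^ (?d - 1)) * ennreal (indicator {0<..} r / r ^ (2 * ?d - 1))" for r
    proof (cases "r > 0")
      case True
      have "1 / (c * r) ^ (2 * ?d - 1) * c ^ ?d = 1 / c ^ (?d - 1) * (1 / r ^ (2 * ?d - 1))"
        using alg[OF True, of "?d - 1"] d by (simp only:)
      then show ?thesis using True c
        by (subst (1 2) ennreal_mult[symmetric]) (auto simp: indicator_def)
    next
      case False
      then have "\<not> c * r > 0" using c by (simp add: zero_less_mult_iff)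
      then show ?thesis using False by (simp add: indicator_def)
    qed
    then have "ennreal (indicator {0<..} (0 + c * r) / (0 + c * r) ^ (2 * ?d - 1)) *
      emeasure lborel (ball (c *\<^sub>R x) (0 + c * r) \<inter> ball (c *\<^sub>R y) (0 + c * r)) =
      ennreal (1 / c ^ (?d - 1)) * (ennreal (indicator {0<..} r / r ^ (2 * ?d - 1)) * emeasure lborel (ball x r \<inter> ball y r))" for r
      by (simp only: ball add_0 mult.assoc[symmetric])
    then show ?thesis using c by simp
  qed
  also have "\<dots> = ennreal c * (ennreal (1 / c ^ (?d - 1)) * ball_kernel x y)"
    unfolding ball_kernel_eq by (subst nn_integral_cmult) simp_all
  also have "\<dots> = ennreal (c * (1 / c ^ (?d - 1))) * ball_kernel x y"
    using c by (subst ennreal_mult) (auto simp: mult.assoc)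
  also have "c * (1 / c ^ (?d - 1)) = 1 / c ^ (?d - 2)"
  proof -
    have "?d - 1 = Suc (?d - 2)" using n by simp
    then show ?thesis using c by simp
  qed
  finally show ?thesis .
qed

lemma ball_kernel_pos:
  fixes x y :: "'a::euclidean_space"
  shows "ball_kernel x y > 0"
proof -
  define m where "m = (1 / 2) *\<^sub>R (x + y)"
  \<comment> \<open>Any ball of radius above \<open>R\<close> about either point contains the ball
    of radius 1/2 about the midpoint, so the integrand is positive on an interval of radii.\<close>
  define R where "R = dist x y + 1"
  have R: "R > 0" unfolding R_def using zero_le_dist[of x y] by linarith
  let ?v = "emeasure lborel (ball m (1 / 2))"
  let ?k = "ennreal (1 / (R + 1) ^ (2 * DIM('a) - 1))"
  have sub: "ball m (1 / 2) \<subseteq> ball x r \<inter> ball y r" if "r > R" for r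
  proof -
    have "x - m = (1 / 2) *\<^sub>R (x - y)" "y - m = (1 / 2) *\<^sub>R (y - x)"
      by (simp_all add: m_def algebra_simps flip: scaleR_add_left)
    then have "dist x m = dist x y / 2" "dist y m = dist x y / 2"
      by (simp_all add: dist_norm norm_minus_commute)
    moreover have "dist x w < r" "dist y w < r" if "dist m w < 1 / 2" for w
      using that calculation \<open>r > R\<close> zero_le_dist[of x y] dist_triangle[of x w m] dist_triangle[of y w m]
      unfolding R_def by linarith+
    ultimately show ?thesis by auto
  qed
  have "0 < ?k * ?v"
    using R by (auto simp: ennreal_zero_less_mult_iff emeasure_ball ennreal_less_zero_iff)
  also have "\<dots> = (\<integral>\<^sup>+r. ?k * ?v * indicator {R<..<R+1} r \<partial>lborel)"
    by (subst nn_integral_cmult_indicator) simp_all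
  also have "\<dots> \<le> ball_kernel x y"
    unfolding ball_kernel_eq
  proof (rule nn_integral_mono)
    fix r
    show "?k * ?v * indicator {R<..<R+1} r \<le> ennreal (indicator {0<..} r / r ^ (2 * DIM('a) - 1)) * emeasure lborel (ball x r \<inter> ball y r)"
    proof (cases "r \<in> {R<..<R+1}")
      case True
      have "1 / (R + 1) ^ (2 * DIM('a) - 1) \<le> 1 / r ^ (2 * DIM('a) - 1)"
        using True R by (intro divide_left_mono power_mono mult_pos_pos zero_less_power) auto
      then show ?thesis using True R sub[of r]
        by (auto intro!: mult_mono emeasure_mono ennreal_leI)
    qed simp
  qed
  finally show ?thesis .
qed

text \<open>No ball of radius below 1/2 contains two points at distance 1, and for larger radii the
  integrand is of order at most \<open>1 / r ^ (d - 1)\<close>, which is integrable at infinity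
  because \<open>d \<ge> 3\<close>.\<close>

lemma ball_kernel_finite:
  fixes e :: "'a::euclidean_space"
  assumes e: "norm e = 1" and n: "DIM('a) \<ge> 3"
  shows "ball_kernel 0 e < \<infinity>"
proof -
  let ?d = "DIM('a)"
  define v where "v = unit_ball_vol (real ?d) * 2 ^ (?d - 3)"
  have v: "v \<ge> 0" by (simp add: v_def)
  have "ball_kernel 0 e \<le> (\<integral>\<^sup>+r. ennreal v * (ennreal (1 / r\<^sup>2) * indicator {1/2..} r) \<partial>lborel)"
    unfolding ball_kernel_eq
  proof (rule nn_integral_mono)
    fix r :: real
    show "ennreal (indicator {0<..} r / r ^ (2 * ?d - 1)) * emeasure lborel (ball 0 r \<inter> ball e r) \<le> ennreal v * (ennreal (1 / r\<^sup>2) * indicator {1/2..} r)"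
    proof (cases "r \<ge> 1 / 2")
      case True
      have "emeasure lborel (ball 0 r \<inter> ball e r) \<le> emeasure lborel (ball (0::'a) r)" by (rule emeasure_mono) auto
      also have "\<dots> = ennreal (unit_ball_vol (real ?d) * r ^ ?d)" using True by (intro emeasure_ball) simp
      finally have "ennreal (indicator {0<..} r / r ^ (2 * ?d - 1)) * emeasure lborel (ball 0 r \<inter> ball e r) \<le>
        ennreal (1 / r ^ (2 * ?d - 1)) * ennreal (unit_ball_vol (real ?d) * r ^ ?d)"
        using True by (intro mult_mono) auto
      also have "\<dots> = ennreal (1 / r ^ (2 * ?d - 1) * (unit_ball_vol (real ?d) * r ^ ?d))"
        using True by (intro ennreal_mult[symmetric]) auto
      also have "\<dots> \<le> ennreal (v * (1 / r\<^sup>2))"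
      proof (rule ennreal_leI)
        have d: "2 * ?d - 1 = (?d - 3) + 2 + ?d" using n by simp
        have "1 / r ^ (2 * ?d - 1) * (unit_ball_vol (real ?d) * r ^ ?d) = unit_ball_vol (real ?d) * (1 / r\<^sup>2) * (1 / r ^ (?d - 3))"
          unfolding d power_add using True by simp
        also have "\<dots> \<le> unit_ball_vol (real ?d) * (1 / r\<^sup>2) * 2 ^ (?d - 3)"
        proof (intro mult_left_mono)
          have "1 \<le> (2 * r) ^ (?d - 3)" using True by (intro one_le_power) simp
          then show "1 / r ^ (?d - 3) \<le> 2 ^ (?d - 3)" using True by (simp add: power_mult_distrib divide_simps)
        qed auto
        finally show "1 / r ^ (2 * ?d - 1) * (unit_ball_vol (real ?d) * r ^ ?d) \<le> v * (1 / r\<^sup>2)"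
          by (simp add: v_def mult_ac)
      qed
      also have "\<dots> = ennreal v * ennreal (1 / r\<^sup>2)" using v by (intro ennreal_mult) auto
      also have "\<dots> = ennreal v * (ennreal (1 / r\<^sup>2) * indicator {1/2..} r)"
        using True by simp
      finally show ?thesis .
    next
      case False
      have "ball 0 r \<inter> ball e r = {}"
      proof (rule ccontr)
        assume "ball 0 r \<inter> ball e r \<noteq> {}"
        then obtain w where "norm w < r" "dist e w < r" by auto
        then show False using norm_triangle_ineq[of "e - w" w] e False by (simp add: dist_norm)
      qed
      then show ?thesis by (simp only: emeasure_empty) simp
    qed
  qed
  also have "\<dots> = ennreal v * (\<integral>\<^sup>+r. ennreal (1 / r\<^sup>2) * indicator {1/2..} r \<partial>lborel)"
    by (rule nn_integral_cmult) simp
  also have "(\<integral>\<^sup>+r. ennreal (1 / r\<^sup>2) * indicator {1/2..} r \<partial>lborel) = ennreal (0 - (- (1 / (1/2::real))))"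
  proof (rule nn_integral_FTC_atLeast)
    show "((\<lambda>r::real. - (1 / r)) has_real_derivative 1 / r\<^sup>2) (at r)" if "1 / 2 \<le> r" for r :: real
      using that by (auto intro!: derivative_eq_intros simp: power2_eq_square)
    have "((\<lambda>r::real. 1 / r) \<longlongrightarrow> 0) at_top"
      by (rule tendsto_divide_0[OF tendsto_const]) (simp add: filterlim_at_top_imp_at_infinity filterlim_ident)
    then show "((\<lambda>r::real. - (1 / r)) \<longlongrightarrow> 0) at_top" using tendsto_minus by fastforce
  qed auto
  also have "ennreal v * ennreal (0 - (- (1 / (1/2::real)))) < \<infinity>" by (simp add: ennreal_mult_less_top)
  finally show ?thesis .
qed

text \<open>
  Up to a constant factor, the kernel counts the balls containing both points, with a weight
  depending only on the radius. This makes the energy a positive definite quadratic form.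
\<close>

lemma ball_kernel_eq_newton_kernel:
  fixes x y :: "real ^ 'n"
  assumes n: "CARD('n) \<ge> 3"
  shows "ball_kernel x y = ball_kernel 0 (axis undefined 1 :: real ^ 'n) * newton_kernel x y"
proof (cases "x = y")
  case True
  have tr: "ball_kernel x x = ball_kernel (0 :: real ^ 'n) 0"
    using ball_kernel_isometry[of "(+) x" 0 0] by simp
  \<comment> \<open>Scaling fixes the origin but multiplies the kernel by a factor above 1; being
    positive, the value on the diagonal must be infinite.\<close>
  have self: "ball_kernel (0 :: real ^ 'n) 0 = ennreal (1 / (1 / 2) ^ (CARD('n) - 2)) * ball_kernel (0 :: real ^ 'n) 0"
    using ball_kernel_scale[of "1 / 2" "0 :: real ^ 'n" 0] n by simp
  have pos: "ball_kernel (0 :: real ^ 'n) 0 > 0" by (rule ball_kernel_pos)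
  have gt: "1 / (1 / 2) ^ (CARD('n) - 2) > (1 :: real)" using n by (simp add: power_divide one_less_power)
  have "ball_kernel (0 :: real ^ 'n) 0 = \<infinity>"
  proof (cases "ball_kernel (0 :: real ^ 'n) 0")
    case (real a)
    then have "a > 0" using pos by (simp add: ennreal_less_zero_iff)
    have "ennreal a = ennreal (1 / (1 / 2) ^ (CARD('n) - 2) * a)"
      using self real \<open>a > 0\<close> by (subst ennreal_mult) auto
    then have "a = 1 / (1 / 2) ^ (CARD('n) - 2) * a"
      using \<open>a > 0\<close> by (subst (asm) ennreal_inj) auto
    moreover have "1 * a < 1 / (1 / 2) ^ (CARD('n) - 2) * a"
      using gt \<open>a > 0\<close> by (rule mult_strict_right_mono)
    ultimately show ?thesis by simp
  qed simp
  then show ?thesis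
    using True tr n ball_kernel_pos[of 0 "axis undefined 1 :: real ^ 'n"] newton_kernel_refl[of y]
    by (simp add: ennreal_mult_top)
next
  case False
  let ?e = "axis undefined 1 :: real ^ 'n"
  define a where "a = norm (y - x)"
  have a: "a > 0" using False by (simp add: a_def)
  obtain T where T: "orthogonal_transformation T" "T ?e = sgn (y - x)"
    using orthogonal_transformation_exists_1[of ?e "sgn (y - x)"] False by (auto simp: norm_sgn)
  let ?f = "\<lambda>w. x + T w"
  have "ball_kernel (?f 0) (?f (a *\<^sub>R ?e)) = ball_kernel 0 (a *\<^sub>R ?e)"
  proof (rule ball_kernel_isometry)
    show "dist (?f u) (?f v) = dist u v" for u v using orthogonal_transformation_dist[OF T(1)] by simp
    show "surj ?f"
    proof (rule surjI)
      show "?f (inv T (w - x)) = w" for w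
        using orthogonal_transformation_surj[OF T(1)] by (simp add: surj_f_inv_f)
    qed
  qed
  moreover have "?f 0 = x" using orthogonal_transformation_scaleR[OF T(1), of 0] by simp
  moreover have "?f (a *\<^sub>R ?e) = y"
    using a by (simp add: orthogonal_transformation_scaleR[OF T(1)] T(2) sgn_div_norm a_def)
  ultimately have "ball_kernel x y = ball_kernel (a *\<^sub>R 0) (a *\<^sub>R ?e)" by simp
  also have "\<dots> = ennreal (1 / a ^ (CARD('n) - 2)) * ball_kernel 0 ?e"
    using ball_kernel_scale[OF a, of 0 ?e] n by simp
  finally show ?thesis using False by (simp add: newton_kernel_neq a_def norm_minus_commute mult.commute)
qed

section \<open>The energy as a square integral of ball masses\<close>

definition ball_weight :: "'a::euclidean_space itself \<Rightarrow> real \<Rightarrow> ennreal" where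
  "ball_weight _ r = ennreal (indicator {0<..} r / r ^ (2 * DIM('a) - 1))"

text \<open>Tonelli's theorem. The mutual energy becomes a weighted inner product of the functions
  that give the masses of balls, and for \<open>A = B\<close> a weighted square integral.\<close>

lemma energy_ball_kernel:
  fixes A B :: "(real ^ 'n) measure"
  assumes n: "CARD('n) \<ge> 3" and "finite_measure A" "finite_measure B"
    and [measurable_cong]: "sets A = sets borel" "sets B = sets borel"
  shows "ball_kernel 0 (axis undefined 1 :: real ^ 'n) * energy A B =
    (\<integral>\<^sup>+p. ball_weight TYPE(real ^ 'n) (fst p) * (emeasure A (ball (snd p) (fst p)) * emeasure B (ball (snd p) (fst p))) \<partial>(lborel \<Otimes>\<^sub>M lborel))"
proof -
  interpret A: finite_measure A by fact
  interpret B: finite_measure B by fact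
  let ?P = "lborel \<Otimes>\<^sub>M lborel :: (real \<times> (real ^ 'n)) measure"
  let ?w = "ball_weight TYPE(real ^ 'n)"
  let ?i = "\<lambda>x p. (if dist x (snd p) < fst p then 1 else 0) :: ennreal"
  interpret P: sigma_finite_measure ?P by (rule lborel_pair.sigma_finite_measure_axioms)
  interpret AP: pair_sigma_finite A ?P ..
  interpret BP: pair_sigma_finite B ?P ..
  let ?\<kappa> = "ball_kernel 0 (axis undefined 1 :: real ^ 'n)"
  have [measurable]: "?w \<in> borel_measurable borel" unfolding ball_weight_def[abs_def] by measurable
  have bk: "ball_kernel x y = (\<integral>\<^sup>+p. ?w (fst p) * (?i x p * ?i y p) \<partial>?P)" for x y :: "real ^ 'n"
    unfolding ball_kernel_def ball_weight_def ..
  have em: "(\<integral>\<^sup>+x. ?i x p \<partial>N) = emeasure N (ball (snd p) (fst p))"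
    if [measurable_cong]: "sets N = sets borel" for N :: "(real ^ 'n) measure" and p
  proof -
    have "(\<integral>\<^sup>+x. ?i x p \<partial>N) = (\<integral>\<^sup>+x. indicator (ball (snd p) (fst p)) x \<partial>N)"
      by (intro nn_integral_cong) (auto simp: indicator_def dist_commute)
    then show ?thesis using that by simp
  qed
  have [measurable]: "(\<lambda>p. emeasure B (ball (snd p) (fst p))) \<in> borel_measurable ?P"
    unfolding em[OF assms(5), symmetric] by measurable
  have "?\<kappa> * energy A B = (\<integral>\<^sup>+x. \<integral>\<^sup>+y. ?\<kappa> * newton_kernel x y \<partial>B \<partial>A)"
    unfolding energy_def potential_def
    by (subst nn_integral_cmult[symmetric], measurable, intro nn_integral_cong nn_integral_cmult[symmetric]) measurable
  also have "\<dots> = (\<integral>\<^sup>+x. \<integral>\<^sup>+y. ball_kernel x y \<partial>B \<partial>A)"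
    by (simp only: ball_kernel_eq_newton_kernel[OF n, symmetric])
  also have "\<dots> = (\<integral>\<^sup>+x. \<integral>\<^sup>+y. \<integral>\<^sup>+p. ?w (fst p) * (?i x p * ?i y p) \<partial>?P \<partial>B \<partial>A)"
    by (simp only: bk)
  also have "\<dots> = (\<integral>\<^sup>+x. \<integral>\<^sup>+p. \<integral>\<^sup>+y. ?w (fst p) * (?i x p * ?i y p) \<partial>B \<partial>?P \<partial>A)"
    by (intro nn_integral_cong BP.Fubini'[symmetric]) measurable
  also have "\<dots> = (\<integral>\<^sup>+x. \<integral>\<^sup>+p. ?w (fst p) * (?i x p * emeasure B (ball (snd p) (fst p))) \<partial>?P \<partial>A)"
  proof (intro nn_integral_cong)
    fix x p
    have "(\<integral>\<^sup>+y. ?w (fst p) * (?i x p * ?i y p) \<partial>B) = (\<integral>\<^sup>+y. (?w (fst p) * ?i x p) * ?i y p \<partial>B)"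
      by (simp only: mult.assoc)
    also have "\<dots> = (?w (fst p) * ?i x p) * (\<integral>\<^sup>+y. ?i y p \<partial>B)" by (rule nn_integral_cmult) measurable
    finally show "(\<integral>\<^sup>+y. ?w (fst p) * (?i x p * ?i y p) \<partial>B) = ?w (fst p) * (?i x p * emeasure B (ball (snd p) (fst p)))"
      by (simp only: em[OF assms(5)] mult.assoc)
  qed
  also have "\<dots> = (\<integral>\<^sup>+p. \<integral>\<^sup>+x. ?w (fst p) * (?i x p * emeasure B (ball (snd p) (fst p))) \<partial>A \<partial>?P)"
    by (rule AP.Fubini'[symmetric]) measurable
  also have "\<dots> = (\<integral>\<^sup>+p. ?w (fst p) * (emeasure A (ball (snd p) (fst p)) * emeasure B (ball (snd p) (fst p))) \<partial>?P)"
  proof (intro nn_integral_cong)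
    fix p
    let ?b = "emeasure B (ball (snd p) (fst p))"
    have "(\<integral>\<^sup>+x. ?w (fst p) * (?i x p * ?b) \<partial>A) = (\<integral>\<^sup>+x. (?w (fst p) * ?b) * ?i x p \<partial>A)"
      by (simp only: mult_ac)
    also have "\<dots> = (?w (fst p) * ?b) * (\<integral>\<^sup>+x. ?i x p \<partial>A)" by (rule nn_integral_cmult) measurable
    finally show "(\<integral>\<^sup>+x. ?w (fst p) * (?i x p * ?b) \<partial>A) = ?w (fst p) * (emeasure A (ball (snd p) (fst p)) * ?b)"
      by (simp only: em[OF assms(4)] mult_ac)
  qed
  finally show ?thesis .
qed

text \<open>By \<open>energy_ball_kernel\<close> the hypothesis says that the weighted square
  integral of the difference of ball masses is at most 0. So almost all balls have equal masses, and
  small balls determine the measure.\<close>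

lemma measure_eq_of_energy:
  fixes A B :: "(real ^ 'n) measure"
  assumes n: "CARD('n) \<ge> 3" and fm: "finite_measure A" "finite_measure B"
    and sets [measurable_cong]: "sets A = sets borel" "sets B = sets borel"
    and fin: "energy A A < \<infinity>" "energy B B < \<infinity>"
    and le: "energy A A + energy B B \<le> 2 * energy A B"
  shows "A = B"
proof -
  interpret A: finite_measure A by fact
  interpret B: finite_measure B by fact
  let ?P = "lborel \<Otimes>\<^sub>M lborel :: (real \<times> (real ^ 'n)) measure"
  let ?w = "ball_weight TYPE(real ^ 'n)"
  let ?\<kappa> = "ball_kernel 0 (axis undefined 1 :: real ^ 'n)"
  define a where "a p = measure A (ball (snd p) (fst p))" for p
  define b where "b p = measure B (ball (snd p) (fst p))" for p
  have [measurable]: "?w \<in> borel_measurable borel" unfolding ball_weight_def[abs_def] by measurable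
  have em: "(\<lambda>p. emeasure N (ball (snd p) (fst p))) \<in> borel_measurable ?P"
    if "finite_measure N" and [measurable_cong]: "sets N = sets borel" for N :: "(real ^ 'n) measure"
  proof -
    interpret N: finite_measure N by fact
    have eq: "emeasure N (ball (snd p) (fst p)) = (\<integral>\<^sup>+x. (if dist x (snd p) < fst p then 1 else 0) \<partial>N)" for p :: "real \<times> (real ^ 'n)"
    proof -
      have "(\<integral>\<^sup>+x. (if dist x (snd p) < fst p then 1 else 0) \<partial>N) = (\<integral>\<^sup>+x. indicator (ball (snd p) (fst p)) x \<partial>N)"
        by (intro nn_integral_cong) (auto simp: indicator_def dist_commute)
      then show ?thesis using that by simp
    qed
    show ?thesis unfolding eq by measurable
  qed
  have am [measurable]: "a \<in> borel_measurable ?P" and bm [measurable]: "b \<in> borel_measurable ?P"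
    unfolding a_def[abs_def] b_def[abs_def] measure_def
    using em[OF fm(1) sets(1)] em[OF fm(2) sets(2)] by measurable
  have ab: "a p \<ge> 0" "b p \<ge> 0" for p by (auto simp: a_def b_def)
  have en: "?\<kappa> * energy A A = (\<integral>\<^sup>+p. ?w (fst p) * ennreal (a p * a p) \<partial>?P)"
    "?\<kappa> * energy B B = (\<integral>\<^sup>+p. ?w (fst p) * ennreal (b p * b p) \<partial>?P)"
    "?\<kappa> * energy A B = (\<integral>\<^sup>+p. ?w (fst p) * ennreal (a p * b p) \<partial>?P)"
    by (simp_all only: energy_ball_kernel[OF n] fm sets A.emeasure_eq_measure B.emeasure_eq_measure
        ennreal_mult[OF measure_nonneg measure_nonneg] a_def b_def)
  have \<kappa>: "?\<kappa> \<noteq> \<infinity>" using ball_kernel_finite[of "axis undefined 1 :: real ^ 'n"] n by simp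
  \<comment> \<open>The expanded square with the mixed term moved to the left, since subtraction in
    \<open>ennreal\<close> is truncated.\<close>
  have sum: "(\<integral>\<^sup>+p. ?w (fst p) * ennreal ((a p - b p)\<^sup>2) \<partial>?P) + 2 * (?\<kappa> * energy A B) = ?\<kappa> * energy A A + ?\<kappa> * energy B B"
  proof -
    have "(\<integral>\<^sup>+p. ?w (fst p) * ennreal ((a p - b p)\<^sup>2) \<partial>?P) + 2 * (?\<kappa> * energy A B) =
      (\<integral>\<^sup>+p. ?w (fst p) * ennreal ((a p - b p)\<^sup>2) + 2 * (?w (fst p) * ennreal (a p * b p)) \<partial>?P)"
      unfolding en by (subst nn_integral_add, measurable, subst nn_integral_cmult) simp_all
    also have "\<dots> = (\<integral>\<^sup>+p. ?w (fst p) * ennreal (a p * a p) + ?w (fst p) * ennreal (b p * b p) \<partial>?P)"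
    proof (rule nn_integral_cong)
      fix p
      have "ennreal ((a p - b p)\<^sup>2) + 2 * ennreal (a p * b p) = ennreal ((a p - b p)\<^sup>2 + 2 * (a p * b p))"
        using ab[of p] by (simp add: ennreal_mult)
      also have "(a p - b p)\<^sup>2 + 2 * (a p * b p) = a p * a p + b p * b p"
        by (simp add: power2_eq_square algebra_simps)
      also have "ennreal \<dots> = ennreal (a p * a p) + ennreal (b p * b p)" using ab[of p] by simp
      finally have "?w (fst p) * (ennreal ((a p - b p)\<^sup>2) + 2 * ennreal (a p * b p)) = ?w (fst p) * (ennreal (a p * a p) + ennreal (b p * b p))"
        by simp
      then show "?w (fst p) * ennreal ((a p - b p)\<^sup>2) + 2 * (?w (fst p) * ennreal (a p * b p)) =
        ?w (fst p) * ennreal (a p * a p) + ?w (fst p) * ennreal (b p * b p)"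
        by (simp only: distrib_left) (simp only: mult_ac)
    qed
    also have "\<dots> = ?\<kappa> * energy A A + ?\<kappa> * energy B B"
      unfolding en by (rule nn_integral_add) measurable
    finally show ?thesis .
  qed
  have "?\<kappa> * energy A A + ?\<kappa> * energy B B < \<infinity>"
    using fin \<kappa> by (auto simp: ennreal_mult_less_top less_top[symmetric] ennreal_mult_eq_top_iff)
  moreover have "?\<kappa> * energy A A + ?\<kappa> * energy B B \<le> 2 * (?\<kappa> * energy A B)"
    using mult_left_mono[OF le, of ?\<kappa>] by (simp add: distrib_left mult_ac)
  moreover have "2 * (?\<kappa> * energy A B) \<le> ?\<kappa> * energy A A + ?\<kappa> * energy B B"
    unfolding sum[symmetric] by simp
  ultimately have "2 * (?\<kappa> * energy A B) \<noteq> \<infinity>"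
    and "(\<integral>\<^sup>+p. ?w (fst p) * ennreal ((a p - b p)\<^sup>2) \<partial>?P) + 2 * (?\<kappa> * energy A B) \<le> 0 + 2 * (?\<kappa> * energy A B)"
    unfolding sum by (auto simp only: add_0 top_unique infinity_ennreal_def less_irrefl)
  then have "(\<integral>\<^sup>+p. ?w (fst p) * ennreal ((a p - b p)\<^sup>2) \<partial>?P) \<le> 0"
    by (rule iffD1[OF ennreal_add_right_cancel_le])
  then have "(\<integral>\<^sup>+p. ?w (fst p) * ennreal ((a p - b p)\<^sup>2) \<partial>?P) = 0" by simp
  then have "AE p in ?P. ?w (fst p) * ennreal ((a p - b p)\<^sup>2) = 0"
    by (subst (asm) nn_integral_0_iff_AE) measurable
  then have "AE p in ?P. fst p > 0 \<longrightarrow> a p = b p"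
  proof eventually_elim
    case (elim p)
    show ?case
    proof
      assume p: "fst p > 0"
      then have "0 < fst p ^ (2 * DIM(real ^ 'n) - 1)" by (rule zero_less_power)
      then have "?w (fst p) \<noteq> 0" using p by (simp only: ball_weight_def) (simp add: ennreal_eq_0_iff not_le)
      then have "(a p - b p)\<^sup>2 \<le> 0" using elim by (simp add: ennreal_eq_0_iff)
      then show "a p = b p" by simp
    qed
  qed
  then have "AE r in lborel. AE w in lborel. r > 0 \<longrightarrow> a (r, w) = b (r, w)"
    using lborel_pair.AE_pair by fastforce
  then have ae: "AE r in lborel. r > 0 \<longrightarrow> (AE w in lborel. a (r, w) = b (r, w))"
    by (rule eventually_mono) (auto elim: eventually_mono)
  \<comment> \<open>Almost every radius is admissible and an interval has positive length, so
    admissible radii tending to 0 exist.\<close>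
  have "\<exists>r\<in>{0<..<inverse (real (Suc m))}. AE w in lborel. a (r, w) = b (r, w)" for m
  proof (rule ccontr)
    assume *: "\<not> ?thesis"
    have "AE r in lborel. r \<notin> {0<..<inverse (real (Suc m))}"
      using ae by eventually_elim (use * in auto)
    then have "{0<..<inverse (real (Suc m))} \<in> null_sets lborel" by (subst AE_iff_null_sets) auto
    then have "emeasure lborel {0<..<inverse (real (Suc m))} = 0" by (rule null_setsD1)
    then show False by simp
  qed
  then obtain r where r: "\<And>m. r m \<in> {0<..<inverse (real (Suc m))}" "\<And>m. AE w in lborel. a (r m, w) = b (r m, w)"
    by metis
  have lim: "r \<longlonglongrightarrow> 0"
    using r(1) by (intro tendsto_sandwich[OF _ _ tendsto_const LIMSEQ_inverse_real_of_nat]) (auto intro!: always_eventually less_imp_le)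
  show ?thesis
  proof (rule measure_eq_of_balls[where \<sigma>=lborel and S=UNIV and r=r and c="\<lambda>r. ennreal (unit_ball_vol (real DIM(real ^ 'n)) * r ^ DIM(real ^ 'n))"])
    show "AE y in lborel. emeasure A (ball y (r m)) = emeasure B (ball y (r m))" for m
      using r(2)[of m] by eventually_elim (simp add: a_def b_def A.emeasure_eq_measure B.emeasure_eq_measure)
  qed (use r(1) lim fm sets in \<open>auto simp: sigma_finite_lborel emeasure_ball ennreal_less_zero_iff\<close>)
qed

context sphere_equilibrium
begin

text \<open>The image of \<open>M\<close> has the same energy and the same field integral. Used as a
  test measure in \<open>level_le\<close> it gives \<open>energy M M \<le> energy ?N M\<close>, and
  positive definiteness then forces equality of the two measures.\<close>

lemma distr_eq_of_invariant:
  assumes H: "orthogonal_transformation H" and q: "\<And>x. norm x = 1 \<Longrightarrow> q (H x) = q x"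
  shows "distr M borel H = M"
proof -
  note [measurable] = orthogonal_transformation_measurable[OF H]
  let ?N = "distr M borel H"
  have N: "prob_space ?N" by (rule prob_space_distr) simp
  have fN: "finite_measure ?N" using N by (rule prob_space.finite_measure)
  have pN: "potential ?N (H x) = potential M x" for x
    unfolding potential_def by (subst nn_integral_distr) (simp_all add: newton_kernel_orthogonal[OF H])
  have [measurable]: "potential ?N \<in> borel_measurable borel" by (rule measurable_potential[OF fN]) simp
  have eN: "energy ?N ?N = energy M M"
    unfolding energy_def by (subst nn_integral_distr) (simp_all add: pN)
  have qN: "(\<integral>\<^sup>+x. q x \<partial>?N) = (\<integral>\<^sup>+x. q x \<partial>M)"
  proof -
    have "(\<integral>\<^sup>+x. q x \<partial>?N) = (\<integral>\<^sup>+x. q (H x) \<partial>M)" by (subst nn_integral_distr) simp_all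
    also have "\<dots> = (\<integral>\<^sup>+x. q x \<partial>M)"
      using sphere_M by (intro nn_integral_cong_AE) (auto elim!: eventually_mono simp: q)
    finally show ?thesis .
  qed
  have "level \<le> (\<integral>\<^sup>+x. potential M x + q x \<partial>?N)"
  proof (rule level_le[OF N])
    show "AE x in ?N. norm x = 1"
      using sphere_M by (subst AE_distr_iff) (simp_all add: orthogonal_transformation_norm[OF H])
    show "energy ?N ?N < \<infinity>" using eN level_finite by simp
  qed simp
  also have "\<dots> = energy ?N M + (\<integral>\<^sup>+x. q x \<partial>M)"
    unfolding energy_def qN[symmetric] by (rule nn_integral_add) measurable
  finally have "energy M M \<le> energy ?N M"
    unfolding level_def using level_finite(2) by (subst (asm) ennreal_add_right_cancel_le) (auto simp: less_top[symmetric])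
  then have "energy ?N ?N + energy M M \<le> 2 * energy ?N M" by (simp add: eN mult_2 add_mono)
  then show ?thesis
    using level_finite eN by (intro measure_eq_of_energy[OF dim]) (simp_all add: fN finite_measure_axioms)
qed

end

section \<open>Axially symmetric measures\<close>

lemma reflection_scaleR_axis: "c \<noteq> 0 \<Longrightarrow> reflection (c *\<^sub>R w) x = reflection w x"
  by (simp add: reflection_def)

text \<open>Reflections are conjugate under orthogonal maps. Equality of their determinants makes
  the product of two reflections a rotation.\<close>

lemma det_reflection_cong:
  fixes v w :: "real ^ 'n"
  assumes "v \<noteq> 0" "w \<noteq> 0"
  shows "det (matrix (reflection v)) = det (matrix (reflection w))"
proof -
  obtain T where T: "orthogonal_transformation T" "T (sgn w) = sgn v"
    using orthogonal_transformation_exists_1[of "sgn w" "sgn v"] assms by (auto simp: norm_sgn)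
  have lin: "linear T" "linear (reflection u)" for u :: "real ^ 'n"
    using T by (simp_all add: orthogonal_transformation_linear orthogonal_transformation_reflection)
  have sgn: "reflection u = reflection (sgn u)" if "u \<noteq> 0" for u :: "real ^ 'n"
    using reflection_scaleR_axis[of "inverse (norm u)" u] that by (simp add: fun_eq_iff sgn_div_norm)
  have "reflection (sgn v) \<circ> T = T \<circ> reflection (sgn w)"
  proof
    fix x
    have "sgn v \<bullet> T x = sgn w \<bullet> x" "sgn v \<bullet> sgn v = sgn w \<bullet> sgn w"
      using T unfolding orthogonal_transformation_def by metis+
    then show "(reflection (sgn v) \<circ> T) x = (T \<circ> reflection (sgn w)) x"
      by (simp add: reflection_def linear_diff[OF lin(1)] linear_scale[OF lin(1)] T(2))
  qed
  then have "matrix (reflection (sgn v)) ** matrix T = matrix T ** matrix (reflection (sgn w))"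
    by (metis lin matrix_compose)
  then have "det (matrix (reflection (sgn v))) * det (matrix T) = det (matrix T) * det (matrix (reflection (sgn w)))"
    by (metis det_mul)
  moreover have "\<bar>det (matrix T)\<bar> = 1" using T by simp
  ultimately show ?thesis unfolding sgn[OF assms(1)] sgn[OF assms(2)] by auto
qed

text \<open>The reflection along \<open>x - y\<close> maps \<open>x\<close> to \<open>y\<close> and
  fixes the axis but reverses orientation. A second reflection, along a vector orthogonal to the
  axis and to \<open>y\<close>, restores it; such a vector exists in dimension at least 3.\<close>

lemma exists_axial_rotation:
  fixes x y :: "real ^ 'n"
  assumes n: "CARD('n) \<ge> 3" and norm: "norm x = norm y" and k: "x $ k = y $ k"
  obtains R where "rotation_matrix R" "R *v axis k 1 = axis k 1" "R *v x = y"
proof (cases "x = y")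
  case True
  then show ?thesis using that[of "mat 1"] by (simp add: rotation_matrix_def orthogonal_matrix_id)
next
  case False
  let ?e = "axis k 1 :: real ^ 'n"
  have "dim {?e, y} \<le> card {?e, y}" by (rule dim_le_card') simp
  also have "\<dots> < DIM(real ^ 'n)" using n by (simp add: card_insert_if)
  finally obtain v where v: "v \<noteq> 0" "\<And>u. u \<in> span {?e, y} \<Longrightarrow> orthogonal v u"
    using orthogonal_to_subspace_exists[of "{?e, y}"] by blast
  have sp: "?e \<in> span {?e, y}" "y \<in> span {?e, y}" by (auto intro: span_base)
  have "orthogonal v ?e" "orthogonal v y" using v(2)[OF sp(1)] v(2)[OF sp(2)] by simp_all
  then have ve: "v \<bullet> ?e = 0" and vy: "v \<bullet> y = 0" by (simp_all add: orthogonal_def)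
  have we: "(x - y) \<bullet> ?e = 0" using k by (simp add: inner_axis)
  let ?f = "reflection v \<circ> reflection (x - y)"
  have ot: "orthogonal_transformation ?f"
    by (intro orthogonal_transformation_compose orthogonal_transformation_reflection)
  have lin: "linear (reflection u)" for u :: "real ^ 'n"
    by (simp add: orthogonal_transformation_linear orthogonal_transformation_reflection)
  have R: "matrix ?f *v u = ?f u" for u
    by (rule fun_cong[OF matrix_vector_mul(2)[OF orthogonal_transformation_linear[OF ot]]])
  show ?thesis
  proof
    have "det (matrix ?f) = det (matrix (reflection v)) * det (matrix (reflection (x - y)))"
      by (simp add: matrix_compose[OF lin lin] det_mul)
    also have "\<dots> = det (matrix (reflection v)) * det (matrix (reflection v))"
      using det_reflection_cong[of "x - y" v] False v(1) by simp
    also have "\<dots> = 1"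
      using orthogonal_transformation_det[OF orthogonal_transformation_reflection[of v]]
      by (metis abs_mult_self_eq mult_1)
    finally show "rotation_matrix (matrix ?f)"
      using ot by (simp add: rotation_matrix_def orthogonal_transformation_matrix)
    show "matrix ?f *v ?e = ?e" unfolding R using ve we by (simp add: reflection_orthogonal)
    show "matrix ?f *v x = y" unfolding R using vy by (simp add: reflection_swap norm reflection_orthogonal)
  qed
qed

lemma rotationally_invariant_eq:
  fixes x y :: "real ^ 'n"
  assumes "CARD('n) \<ge> 3" "rotationally_invariant k Q" "norm x = 1" "norm y = 1" "x $ k = y $ k"
  shows "Q x = Q y"
proof -
  obtain R where "rotation_matrix R" "R *v axis k 1 = axis k 1" "R *v x = y"
    using exists_axial_rotation[of x y k] assms by auto
  then show ?thesis using assms(2,3) unfolding rotationally_invariant_def by fastforce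
qed

section \<open>Invariance under the reflections that preserve the height\<close>

lemma reflection_component:
  fixes w x :: "real ^ 'n"
  shows "w $ k = 0 \<Longrightarrow> reflection w x $ k = x $ k"
  by (simp add: reflection_def)

lemma measurable_vec_nth [measurable (raw)]:
  fixes f :: "'a \<Rightarrow> real ^ 'n"
  assumes "f \<in> borel_measurable M" shows "(\<lambda>x. f x $ k) \<in> borel_measurable M"
proof -
  have "(\<lambda>x :: real ^ 'n. x $ k) \<in> borel_measurable borel"
    by (intro borel_measurable_continuous_onI continuous_intros)
  with assms show ?thesis by (rule measurable_compose)
qed

text \<open>The mirrors are the hyperplanes containing the axis. Reflections are preferred to
  rotations because a single one exchanges two given points of equal norm and height.\<close>

definition axial_invariant :: "'n \<Rightarrow> (real ^ 'n) measure \<Rightarrow> bool" where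
  "axial_invariant k A \<longleftrightarrow> (\<forall>w. w $ k = 0 \<longrightarrow> distr A borel (reflection w) = A)"

lemma axial_invariant_nn_integral_ball:
  fixes A :: "(real ^ 'n) measure"
  assumes A: "axial_invariant k A" "sets A = sets borel"
    and [measurable]: "c \<in> borel_measurable borel"
    and xy: "norm x = norm y" "x $ k = y $ k"
  shows "(\<integral>\<^sup>+w. (if dist x w < r then 1 else 0) * c (w $ k) \<partial>A) = (\<integral>\<^sup>+w. (if dist y w < r then 1 else 0) * c (w $ k) \<partial>A)"
proof -
  let ?H = "reflection (x - y)"
  note [measurable_cong] = A(2)
  have H: "orthogonal_transformation ?H" by (rule orthogonal_transformation_reflection)
  have k: "(x - y) $ k = 0" using xy by simp
  have "(\<integral>\<^sup>+w. (if dist y w < r then 1 else 0) * c (w $ k) \<partial>A) =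
    (\<integral>\<^sup>+w. (if dist y w < r then 1 else 0) * c (w $ k) \<partial>distr A borel ?H)"
    using A k by (simp add: axial_invariant_def)
  also have "\<dots> = (\<integral>\<^sup>+w. (if dist y (?H w) < r then 1 else 0) * c (?H w $ k) \<partial>A)"
    by (rule nn_integral_distr) measurable
  also have "\<dots> = (\<integral>\<^sup>+w. (if dist x w < r then 1 else 0) * c (w $ k) \<partial>A)"
    using orthogonal_transformation_dist[OF H, of x] by (simp add: reflection_swap xy reflection_component)
  finally show ?thesis ..
qed

lemma emeasure_ball_eq_nn_integral:
  "sets A = sets borel \<Longrightarrow> emeasure A (ball y r) = (\<integral>\<^sup>+w. (if dist y w < r then 1 else 0) \<partial>A)"
proof -
  assume "sets A = sets borel"
  then have "emeasure A (ball y r) = (\<integral>\<^sup>+w. indicator (ball y r) w \<partial>A)" by simp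
  also have "\<dots> = (\<integral>\<^sup>+w. (if dist y w < r then 1 else 0) \<partial>A)"
    by (intro nn_integral_cong) (auto simp: indicator_def)
  finally show ?thesis .
qed

lemma axial_invariant_sphere_area: "axial_invariant k (sphere_area :: (real ^ 'n) measure)"
  by (simp add: axial_invariant_def distr_sphere_area_orthogonal orthogonal_transformation_reflection)

text \<open>A Borel section of the height on the sphere: for \<open>\<bar>t\<bar> \<le> 1\<close>,
  one chosen point on the parallel of height \<open>t\<close>.\<close>

definition parallel_point :: "'n \<Rightarrow> 'n \<Rightarrow> real \<Rightarrow> real ^ 'n" where
  "parallel_point k j t = t *\<^sub>R axis k 1 + sqrt (1 - t\<^sup>2) *\<^sub>R axis j 1"

lemma parallel_point:
  assumes "j \<noteq> k" "\<bar>t\<bar> \<le> 1"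
  shows "norm (parallel_point k j t) = 1" "parallel_point k j t $ k = t"
proof -
  have "t\<^sup>2 \<le> 1" using assms by (simp add: abs_square_le_1)
  have ax: "axis k (1::real) \<bullet> axis j 1 = 0" "axis j (1::real) \<bullet> axis k 1 = 0"
    "axis k (1::real) \<bullet> axis k 1 = 1" "axis j (1::real) \<bullet> axis j 1 = 1"
    using assms by (simp_all add: inner_axis_axis)
  have "(norm (parallel_point k j t))\<^sup>2 = 1"
    unfolding power2_norm_eq_inner parallel_point_def using \<open>t\<^sup>2 \<le> 1\<close>
    by (simp add: inner_add_left inner_add_right ax flip: power2_eq_square)
  then show "norm (parallel_point k j t) = 1" by (simp add: power2_eq_1_iff) (metis norm_ge_zero not_one_le_zero neg_0_le_iff_le order_trans zero_le_one)
  show "parallel_point k j t $ k = t" using assms by (simp add: parallel_point_def axis_def)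
qed

lemma parallel_point_measurable [measurable]: "parallel_point k j \<in> borel_measurable borel"
  unfolding parallel_point_def[abs_def] by measurable

text \<open>
  Averages over balls of an invariant measure depend on the height alone, so the integral of such
  averages over a set is unchanged when the indicator of the set is replaced by its conditional
  expectation given the height. By Fubini the ball may then be moved to that function.
\<close>

lemma axial_invariant_eqI:
  fixes A B :: "(real ^ 'n) measure"
  assumes n: "CARD('n) \<ge> 3"
    and fin: "finite_measure A" "finite_measure B" and sets [measurable_cong]: "sets A = sets borel" "sets B = sets borel"
    and sphere: "AE x in A. norm x = 1" "AE x in B. norm x = 1"
    and inv: "axial_invariant k A" "axial_invariant k B"
    and eq: "distr A borel (\<lambda>x. x $ k) = distr B borel (\<lambda>x. x $ k)"
  shows "A = B"
proof -
  let ?\<sigma> = "sphere_area :: (real ^ 'n) measure" and ?T = "\<lambda>x :: real ^ 'n. x $ k"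
  interpret \<sigma>: finite_measure ?\<sigma> by (rule finite_measure_sphere_area)
  have "\<exists>j. j \<noteq> k"
  proof (rule ccontr)
    assume "\<nexists>j. j \<noteq> k"
    then have "(UNIV :: 'n set) = {k}" by auto
    then have "CARD('n) = card {k}" by simp
    then show False using n by simp
  qed
  then obtain j where j: "j \<noteq> k" by blast
  let ?p = "parallel_point k j"
  have comp: "\<bar>y $ k\<bar> \<le> 1" if "norm y = 1" for y :: "real ^ 'n"
    using component_le_norm_cart[of y k] that by simp
  have inner: "(\<lambda>y. emeasure N (ball y r)) \<in> borel_measurable borel"
    if "finite_measure N" and [measurable_cong]: "sets N = sets borel" for N :: "(real ^ 'n) measure" and r
  proof -
    interpret N: finite_measure N by fact
    show ?thesis unfolding emeasure_ball_eq_nn_integral[OF that(2)] by measurable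
  qed
  have main: "(\<integral>\<^sup>+y. indicator C y * emeasure A (ball y r) \<partial>?\<sigma>) = (\<integral>\<^sup>+y. indicator C y * emeasure B (ball y r) \<partial>?\<sigma>)"
    if C [measurable]: "C \<in> sets borel" for C r
  proof -
    let ?L = "distr ?\<sigma> borel ?T" and ?LC = "distr (density ?\<sigma> (indicator C)) borel ?T"
    interpret L: finite_measure ?L by (rule \<sigma>.finite_measure_distr) simp
    \<comment> \<open>The density \<open>c\<close> obtained from this, evaluated at the height, is
      the conditional expectation of the indicator of \<open>C\<close> given the height.\<close>
    have "absolutely_continuous ?L ?LC"
      unfolding absolutely_continuous_def
    proof
      fix X assume X: "X \<in> null_sets ?L"
      then have [measurable]: "X \<in> sets borel" by auto
      have [measurable]: "?T -` X \<in> sets borel" using measurable_sets[of ?T borel borel X] by simp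
      have "emeasure ?\<sigma> (?T -` X) = 0" using X by (auto simp: null_sets_def emeasure_distr)
      then have "?T -` X \<in> null_sets ?\<sigma>" by (simp add: null_sets_def)
      then have "AE y in ?\<sigma>. y \<notin> ?T -` X" by (rule AE_not_in)
      then have "(\<integral>\<^sup>+y. indicator C y * indicator (?T -` X) y \<partial>?\<sigma>) = 0"
        by (subst nn_integral_0_iff_AE) (auto simp: indicator_def)
      then show "X \<in> null_sets ?LC"
        by (simp add: null_sets_def emeasure_distr emeasure_density)
    qed
    then obtain c where c [measurable]: "c \<in> borel_measurable borel" and dc: "density ?L c = ?LC"
      using L.Radon_Nikodym[of ?LC] by auto
    define G where "G x = (\<integral>\<^sup>+y. (if dist x y < r then 1 else 0) * c (y $ k) \<partial>?\<sigma>)" for x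
    have [measurable]: "G \<in> borel_measurable borel" unfolding G_def[abs_def] by measurable
    \<comment> \<open>The right side depends on \<open>N\<close> only through its image under the
      height, so it takes the same value for \<open>A\<close> and \<open>B\<close>.\<close>
    have *: "(\<integral>\<^sup>+y. indicator C y * emeasure N (ball y r) \<partial>?\<sigma>) = (\<integral>\<^sup>+t. G (?p t) \<partial>distr N borel ?T)"
      if N: "finite_measure N" and sN [measurable_cong]: "sets N = sets borel" and sp: "AE x in N. norm x = 1" and inv: "axial_invariant k N" for N
    proof -
      interpret N: finite_measure N by fact
      interpret P: pair_sigma_finite N ?\<sigma> ..
      define a where "a t = emeasure N (ball (?p t) r)" for t
      note [measurable] = inner[OF N sN]
      have [measurable]: "a \<in> borel_measurable borel" unfolding a_def[abs_def] by measurable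
      have aN: "emeasure N (ball y r) = a (y $ k)" if "norm y = 1" for y
        unfolding a_def emeasure_ball_eq_nn_integral[OF sN]
        using axial_invariant_nn_integral_ball[OF inv sN, of "\<lambda>_. 1" y "?p (y $ k)" r] parallel_point[OF j comp[OF that]] that
        by simp
      have aeN: "AE y in ?\<sigma>. emeasure N (ball y r) = a (y $ k)"
        using AE_sphere_area by eventually_elim (rule aN)
      have "(\<integral>\<^sup>+y. indicator C y * emeasure N (ball y r) \<partial>?\<sigma>) = (\<integral>\<^sup>+y. indicator C y * a (y $ k) \<partial>?\<sigma>)"
        using aeN by (intro nn_integral_cong_AE) auto
      also have "\<dots> = (\<integral>\<^sup>+t. a t \<partial>?LC)"
        by (subst nn_integral_distr, simp, simp, subst nn_integral_density) simp_all
      also have "\<dots> = (\<integral>\<^sup>+t. c t * a t \<partial>?L)"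
        unfolding dc[symmetric] by (rule nn_integral_density) simp_all
      also have "\<dots> = (\<integral>\<^sup>+y. c (y $ k) * a (y $ k) \<partial>?\<sigma>)"
        by (rule nn_integral_distr) simp_all
      also have "\<dots> = (\<integral>\<^sup>+y. c (y $ k) * emeasure N (ball y r) \<partial>?\<sigma>)"
        using aeN by (intro nn_integral_cong_AE) auto
      also have "\<dots> = (\<integral>\<^sup>+y. \<integral>\<^sup>+x. (if dist x y < r then 1 else 0) * c (y $ k) \<partial>N \<partial>?\<sigma>)"
      proof (intro nn_integral_cong)
        fix y
        have "(\<integral>\<^sup>+x. (if dist x y < r then 1 else 0) * c (y $ k) \<partial>N) = (\<integral>\<^sup>+x. (if dist x y < r then 1 else 0) \<partial>N) * c (y $ k)"
          by (rule nn_integral_multc) measurable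
        then show "c (y $ k) * emeasure N (ball y r) = (\<integral>\<^sup>+x. (if dist x y < r then 1 else 0) * c (y $ k) \<partial>N)"
          by (simp add: emeasure_ball_eq_nn_integral[OF sN] dist_commute mult.commute)
      qed
      also have "\<dots> = (\<integral>\<^sup>+x. G x \<partial>N)"
        unfolding G_def by (rule P.Fubini') measurable
      also have "\<dots> = (\<integral>\<^sup>+x. G (?p (x $ k)) \<partial>N)"
      proof (rule nn_integral_cong_AE)
        show "AE x in N. G x = G (?p (x $ k))"
          using sp
        proof eventually_elim
          case (elim x)
          show ?case unfolding G_def
            using parallel_point[OF j comp[OF elim]] elim
            by (intro axial_invariant_nn_integral_ball[OF axial_invariant_sphere_area]) simp_all
        qed
      qed
      also have "\<dots> = (\<integral>\<^sup>+t. G (?p t) \<partial>distr N borel ?T)"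
        by (rule nn_integral_distr[symmetric]) simp_all
      finally show ?thesis .
    qed
    show ?thesis
      unfolding *[OF fin(1) sets(1) sphere(1) inv(1)] *[OF fin(2) sets(2) sphere(2) inv(2)] by (simp only: eq)
  qed
  define e :: "real ^ 'n" where "e = axis k 1"
  have e: "norm e = 1" by (simp add: e_def)
  show ?thesis
  proof (rule measure_eq_of_balls[where \<sigma>="?\<sigma>" and S="{x. norm x = 1}" and c="\<lambda>r. emeasure ?\<sigma> (ball e r)" and r="\<lambda>m. inverse (real (Suc m))"])
    fix m
    define r where "r = inverse (real (Suc m))"
    note [measurable] = inner[OF fin(1) sets(1), of r] inner[OF fin(2) sets(2), of r]
    have "density ?\<sigma> (\<lambda>y. emeasure A (ball y r)) = density ?\<sigma> (\<lambda>y. emeasure B (ball y r))"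
    proof (rule measure_eqI)
      fix C assume "C \<in> sets (density ?\<sigma> (\<lambda>y. emeasure A (ball y r)))"
      then have C [measurable]: "C \<in> sets borel" by simp
      show "emeasure (density ?\<sigma> (\<lambda>y. emeasure A (ball y r))) C = emeasure (density ?\<sigma> (\<lambda>y. emeasure B (ball y r))) C"
        using main[OF C, of r] by (subst (1 2) emeasure_density) (simp_all add: mult.commute)
    qed simp
    then have "AE y in ?\<sigma>. emeasure A (ball y r) = emeasure B (ball y r)"
      by (subst (asm) \<sigma>.density_unique_iff) simp_all
    then show "AE y in ?\<sigma>. emeasure A (ball y (inverse (real (Suc m)))) = emeasure B (ball y (inverse (real (Suc m))))"
      by (simp only: r_def)
  next
    show "emeasure ?\<sigma> (ball x r) = emeasure ?\<sigma> (ball e r)" if "x \<in> {x. norm x = 1}" for x :: "real ^ 'n" and r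
      using emeasure_sphere_area_ball_cong e that by simp
  qed (use fin sets sphere LIMSEQ_inverse_real_of_nat emeasure_sphere_area_ball_pos[OF e]
      \<sigma>.sigma_finite_measure_axioms in \<open>auto simp: \<sigma>.emeasure_eq_measure\<close>)
qed

text \<open>On the set where the density is at least \<open>B\<close> its excess over
  \<open>B\<close> has integral 0, so truncation changes it on a null set only. The bound is
  \<open>max 0 B\<close> because \<open>B\<close> may be negative.\<close>

lemma bounded_Radon_Nikodym:
  fixes A L :: "real measure"
  assumes "finite_measure L" and sets [measurable_cong]: "sets L = sets borel" "sets A = sets borel"
    and le: "\<And>X. X \<in> sets borel \<Longrightarrow> emeasure A X \<le> ennreal B * emeasure L X"
  obtains h where "h \<in> borel_measurable borel" "\<And>t. 0 \<le> h t" "\<And>t. h t \<le> max 0 B" "A = density L (\<lambda>t. ennreal (h t))"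
proof -
  interpret L: finite_measure L by fact
  have "absolutely_continuous L A"
    unfolding absolutely_continuous_def
  proof
    fix X assume "X \<in> null_sets L"
    then show "X \<in> null_sets A" using le[of X] sets by (auto simp: null_sets_def)
  qed
  then obtain g where g: "g \<in> borel_measurable L" and dg: "density L g = A"
    using L.Radon_Nikodym[of A] sets by auto
  have [measurable]: "g \<in> borel_measurable borel" using g by (simp cong: measurable_cong_sets)
  let ?X = "{t. ennreal B \<le> g t}"
  have X [measurable]: "?X \<in> sets borel" by measurable
  have "(\<integral>\<^sup>+t. (g t - ennreal B) * indicator ?X t \<partial>L) = (\<integral>\<^sup>+t. g t * indicator ?X t - ennreal B * indicator ?X t \<partial>L)"
    by (intro nn_integral_cong) (auto simp: indicator_def)
  also have "\<dots> = (\<integral>\<^sup>+t. g t * indicator ?X t \<partial>L) - (\<integral>\<^sup>+t. ennreal B * indicator ?X t \<partial>L)"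
  proof (rule nn_integral_diff)
    have "(\<integral>\<^sup>+t. ennreal B * indicator ?X t \<partial>L) = ennreal B * emeasure L ?X"
      using X sets by (intro nn_integral_cmult_indicator) simp
    then show "(\<integral>\<^sup>+t. ennreal B * indicator ?X t \<partial>L) \<noteq> \<infinity>" by (simp add: ennreal_mult_eq_top_iff L.emeasure_finite)
  qed (auto simp: indicator_def)
  also have "(\<integral>\<^sup>+t. g t * indicator ?X t \<partial>L) = emeasure A ?X"
    unfolding dg[symmetric] using X sets by (intro emeasure_density[symmetric]) (auto simp: g)
  also have "(\<integral>\<^sup>+t. ennreal B * indicator ?X t \<partial>L) = ennreal B * emeasure L ?X"
    using X sets by (intro nn_integral_cmult_indicator) simp
  also have "emeasure A ?X - ennreal B * emeasure L ?X = 0"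
  proof -
    have "ennreal B * emeasure L ?X < \<top>" by (auto simp: ennreal_mult_less_top L.emeasure_finite less_top[symmetric] ennreal_mult_eq_top_iff)
    then show ?thesis using le[OF X] by (simp add: diff_eq_0_iff_ennreal le_less_trans[OF le[OF X]])
  qed
  finally have "AE t in L. (g t - ennreal B) * indicator ?X t = 0"
    by (subst (asm) nn_integral_0_iff_AE) auto
  then have ae: "AE t in L. g t = ennreal (enn2real (min (g t) (ennreal (max 0 B))))"
  proof eventually_elim
    case (elim t)
    have "g t \<le> ennreal B"
    proof (cases "ennreal B \<le> g t")
      case True
      then have "g t - ennreal B = 0" using elim by simp
      then show ?thesis using diff_eq_0_iff_ennreal by auto
    qed simp
    then have "g t \<le> ennreal (max 0 B)" by (rule order_trans) (simp add: ennreal_leI)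
    then show ?case by (simp add: min_absorb1 le_less_trans)
  qed
  show thesis
  proof
    show "(\<lambda>t. enn2real (min (g t) (ennreal (max 0 B)))) \<in> borel_measurable borel" by measurable
    show "enn2real (min (g t) (ennreal (max 0 B))) \<le> max 0 B" for t
    proof -
      have "enn2real (min (g t) (ennreal (max 0 B))) \<le> enn2real (ennreal (max 0 B))"
        by (rule enn2real_mono) (auto simp: min.cobounded2)
      then show ?thesis by (simp only: enn2real_ennreal[OF max.cobounded1])
    qed
    show "A = density L (\<lambda>t. ennreal (enn2real (min (g t) (ennreal (max 0 B)))))"
      unfolding dg[symmetric] using ae by (intro density_cong) (auto cong: measurable_cong_sets)
  qed simp
qed

lemma axial_density:
  fixes A :: "(real ^ 'n) measure"
  assumes n: "CARD('n) \<ge> 3" and fin: "finite_measure A" and sets [measurable_cong, simp]: "sets A = sets borel"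
    and sphere: "AE x in A. norm x = 1" and inv: "axial_invariant k A"
    and le: "\<And>X. X \<in> sets borel \<Longrightarrow> emeasure A X \<le> ennreal B * emeasure sphere_area X"
  obtains h where "h \<in> borel_measurable borel" "\<And>t. 0 \<le> h t" "\<And>t. h t \<le> max 0 B"
    "A = density sphere_area (\<lambda>x. ennreal (h (x $ k)))"
proof -
  let ?\<sigma> = "sphere_area :: (real ^ 'n) measure" and ?T = "\<lambda>x :: real ^ 'n. x $ k"
  interpret \<sigma>: finite_measure ?\<sigma> by (rule finite_measure_sphere_area)
  interpret A: finite_measure A by fact
  have "\<exists>h. h \<in> borel_measurable borel \<and> (\<forall>t. 0 \<le> h t) \<and> (\<forall>t. h t \<le> max 0 B) \<and>
      distr A borel ?T = density (distr ?\<sigma> borel ?T) (\<lambda>t. ennreal (h t))"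
  proof (rule bounded_Radon_Nikodym[of "distr ?\<sigma> borel ?T" "distr A borel ?T" B])
    show "finite_measure (distr ?\<sigma> borel ?T)" by (rule \<sigma>.finite_measure_distr) simp
    fix X :: "real set" assume [measurable]: "X \<in> sets borel"
    have "?T -` X \<in> sets borel" using measurable_sets[of ?T borel borel X] by simp
    then show "emeasure (distr A borel ?T) X \<le> ennreal B * emeasure (distr ?\<sigma> borel ?T) X"
      using le[of "?T -` X"] sets_eq_imp_space_eq[OF sets] by (simp add: emeasure_distr)
  qed auto
  then obtain h where h [measurable]: "h \<in> borel_measurable borel" and h0: "\<And>t. 0 \<le> h t" and hB: "\<And>t. h t \<le> max 0 B"
    and dh: "distr A borel ?T = density (distr ?\<sigma> borel ?T) (\<lambda>t. ennreal (h t))"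
    by blast
  let ?D = "density ?\<sigma> (\<lambda>x. ennreal (h (x $ k)))"
  have "A = ?D"
  \<comment> \<open>\<open>?D\<close> is invariant because its density is a function of the height,
    which the reflections keep, and its image under the height has density \<open>h\<close>, like
    that of \<open>A\<close>.\<close>
  proof (rule axial_invariant_eqI[OF n fin _ _ _ sphere _ inv])
    have "emeasure ?D UNIV = (\<integral>\<^sup>+x. ennreal (h (x $ k)) \<partial>?\<sigma>)" by (subst emeasure_density) simp_all
    also have "\<dots> \<le> (\<integral>\<^sup>+x. ennreal (max 0 B) \<partial>?\<sigma>)" by (intro nn_integral_mono ennreal_leI hB)
    also have "\<dots> < \<infinity>" by (auto simp: ennreal_mult_less_top less_top[symmetric] ennreal_mult_eq_top_iff \<sigma>.emeasure_finite)
    finally show "finite_measure ?D" by (intro finite_measureI) simp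
    show "AE x in ?D. norm x = 1" using AE_sphere_area by (subst AE_density) (auto elim: eventually_mono)
    show "axial_invariant k ?D"
      unfolding axial_invariant_def
    proof (intro allI impI measure_eqI)
      fix w :: "real ^ 'n" and X assume w: "w $ k = 0" and "X \<in> sets (distr ?D borel (reflection w))"
      then have X [measurable]: "X \<in> sets borel" by simp
      have [measurable]: "reflection w -` X \<in> sets borel" using measurable_sets[OF borel_measurable_reflection X] by simp
      have "emeasure (distr ?D borel (reflection w)) X = (\<integral>\<^sup>+x. ennreal (h (x $ k)) * indicator (reflection w -` X) x \<partial>?\<sigma>)"
        by (simp add: emeasure_distr emeasure_density)
      also have "\<dots> = (\<integral>\<^sup>+x. ennreal (h (reflection w x $ k)) * indicator X (reflection w x) \<partial>?\<sigma>)"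
        by (simp add: reflection_component w indicator_def)
      also have "\<dots> = (\<integral>\<^sup>+x. ennreal (h (x $ k)) * indicator X x \<partial>distr ?\<sigma> borel (reflection w))"
        by (rule nn_integral_distr[symmetric]) simp_all
      also have "\<dots> = emeasure ?D X"
        by (simp add: distr_sphere_area_orthogonal orthogonal_transformation_reflection emeasure_density)
      finally show "emeasure (distr ?D borel (reflection w)) X = emeasure ?D X" .
    qed simp
    show "distr A borel ?T = distr ?D borel ?T"
    proof (rule measure_eqI)
      fix X assume "X \<in> sets (distr A borel ?T)"
      then have X [measurable]: "X \<in> sets borel" by simp
      have [measurable]: "?T -` X \<in> sets borel" using measurable_sets[of ?T borel borel X] by simp
      have "emeasure (distr A borel ?T) X = (\<integral>\<^sup>+t. ennreal (h t) * indicator X t \<partial>distr ?\<sigma> borel ?T)"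
        unfolding dh by (rule emeasure_density) simp_all
      also have "\<dots> = (\<integral>\<^sup>+x. ennreal (h (x $ k)) * indicator X (x $ k) \<partial>?\<sigma>)"
        by (rule nn_integral_distr) simp_all
      also have "\<dots> = (\<integral>\<^sup>+x. ennreal (h (x $ k)) * indicator (?T -` X) x \<partial>?\<sigma>)" by (simp add: indicator_def)
      also have "\<dots> = emeasure (distr ?D borel ?T) X" by (simp add: emeasure_distr emeasure_density)
      finally show "emeasure (distr A borel ?T) X = emeasure (distr ?D borel ?T) X" .
    qed simp
  qed simp_all
  then show thesis using that h h0 hB by blast
qed

section \<open>The extremal measure\<close>

context sphere_equilibrium
begin

text \<open>The inequality holds at \<open>M\<close>-almost every point, hence at points arbitrarily
  close to \<open>x0\<close>. The limit uses lower semicontinuity of the potential, by Fatou's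
  lemma, and of the field, through constants \<open>c\<close> below \<open>q x0\<close>.\<close>

lemma potential_plus_field_le_level:
  assumes supp: "\<And>U. open U \<Longrightarrow> x0 \<in> U \<Longrightarrow> emeasure M U > 0"
    and lsc: "\<And>a. a < q x0 \<Longrightarrow> \<exists>W. open W \<and> x0 \<in> W \<and> (\<forall>x\<in>W. norm x = 1 \<longrightarrow> a < q x)"
  shows "potential M x0 + q x0 \<le> level"
proof -
  \<comment> \<open>The value \<open>c = 0\<close> covers \<open>q x0 = 0\<close> and shows that
    \<open>potential M x0\<close> is finite, so that it can be subtracted.\<close>
  have *: "potential M x0 + c \<le> level" if c: "c = 0 \<or> c < q x0" for c
  proof -
    obtain W where W: "open W" "x0 \<in> W" "\<And>x. x \<in> W \<Longrightarrow> norm x = 1 \<Longrightarrow> c \<le> q x"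
    proof (cases "c = 0")
      case True
      then show ?thesis using that[of UNIV] by simp
    next
      case False
      then obtain W where "open W \<and> x0 \<in> W \<and> (\<forall>x\<in>W. norm x = 1 \<longrightarrow> c < q x)" using lsc c by blast
      then show ?thesis using that[of W] by (simp add: less_imp_le)
    qed
    have "\<exists>x. x \<in> ball x0 (inverse (real (Suc m))) \<and> potential M x + c \<le> level" for m
    proof (rule ccontr)
      assume "\<nexists>x. x \<in> ball x0 (inverse (real (Suc m))) \<and> potential M x + c \<le> level"
      then have no: "\<not> potential M x + c \<le> level" if "x \<in> ball x0 (inverse (real (Suc m)))" for x using that by blast
      let ?V = "W \<inter> ball x0 (inverse (real (Suc m)))"
      have "AE x in M. x \<notin> ?V"
        using sphere_M AE_M_le_level
      proof eventually_elim
        case (elim x)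
        show ?case
        proof
          assume "x \<in> ?V"
          then have "potential M x + c \<le> potential M x + q x" using elim W(3) by (intro add_left_mono) auto
          then show False using elim(2) no[of x] \<open>x \<in> ?V\<close> order_trans by blast
        qed
      qed
      then have "?V \<in> null_sets M" using W(1) by (subst AE_iff_null_sets) auto
      then have "emeasure M ?V = 0" by (rule null_setsD1)
      moreover have "emeasure M ?V > 0" using W by (intro supp) auto
      ultimately show False by simp
    qed
    then obtain x where x: "\<And>m. x m \<in> ball x0 (inverse (real (Suc m)))" "\<And>m. potential M (x m) + c \<le> level"
      by metis
    have "x \<longlonglongrightarrow> x0"
    proof (rule metric_tendsto_imp_tendsto[OF LIMSEQ_inverse_real_of_nat])
      show "\<forall>\<^sub>F m in sequentially. dist (x m) x0 \<le> dist (inverse (real (Suc m))) 0"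
        using x(1) by (intro always_eventually allI) (auto simp: dist_commute less_imp_le)
    qed
    have add: "(\<integral>\<^sup>+y. newton_kernel w y + c \<partial>M) = potential M w + c" for w
      unfolding potential_def by (subst nn_integral_add) (use emeasure_space_1 in simp_all)
    have "potential M x0 + c = (\<integral>\<^sup>+y. newton_kernel x0 y + c \<partial>M)" by (simp only: add)
    also have "\<dots> = (\<integral>\<^sup>+y. liminf (\<lambda>m. newton_kernel (x m) y + c) \<partial>M)"
    proof (rule nn_integral_cong)
      fix y
      have "(\<lambda>m. newton_kernel (x m) y + c) \<longlonglongrightarrow> newton_kernel x0 y + c"
        by (intro tendsto_add newton_kernel_tendsto \<open>x \<longlonglongrightarrow> x0\<close> tendsto_const)
      then show "newton_kernel x0 y + c = liminf (\<lambda>m. newton_kernel (x m) y + c)"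
        by (simp add: lim_imp_Liminf)
    qed
    also have "\<dots> \<le> liminf (\<lambda>m. \<integral>\<^sup>+y. newton_kernel (x m) y + c \<partial>M)"
      by (rule nn_integral_liminf) measurable
    also have "\<dots> \<le> liminf (\<lambda>m. level)" by (intro Liminf_mono always_eventually allI) (simp only: add x)
    also have "\<dots> = level" by (simp add: Liminf_const)
    finally show ?thesis .
  qed
  have U: "potential M x0 \<le> level" using *[of 0] by simp
  show ?thesis
  proof (cases "q x0 = 0")
    case False
    have "q x0 \<le> level - potential M x0"
    proof (rule dense_le)
      fix c assume "c < q x0"
      then show "c \<le> level - potential M x0"
        using *[of c] U level_finite(3)
        by (subst ennreal_le_minus_iff) (auto simp: add.commute top_unique)
    qed
    then show ?thesis
      using U level_finite(3) by (metis add_left_mono ennreal_diff_add_assoc add_diff_inverse_ennreal)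
  qed (use U in simp)
qed

end

section \<open>Passing between measures on the sphere and Borel measures on the whole space\<close>

lemma sphere_prob_measurable:
  assumes "sphere_prob \<nu>"
  shows "(\<lambda>x. x) \<in> \<nu> \<rightarrow>\<^sub>M borel" "space \<nu> = usphere"
proof -
  have s: "sets \<nu> = sets (restrict_space borel usphere)" using assms by (simp add: sphere_prob_def)
  show "space \<nu> = usphere" using sets_eq_imp_space_eq[OF s] by (simp add: space_restrict_space)
  have "(\<lambda>x. x) \<in> restrict_space borel usphere \<rightarrow>\<^sub>M borel" by (rule measurable_restrict_space1) simp
  then show "(\<lambda>x. x) \<in> \<nu> \<rightarrow>\<^sub>M borel" by (simp cong: measurable_cong_sets add: s)
qed

lemma weighted_energy_distr:
  fixes \<nu> :: "'a::euclidean_space measure"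
  assumes \<nu>: "sphere_prob \<nu>" and [measurable]: "q \<in> borel_measurable borel" and q: "\<And>x. x \<in> usphere \<Longrightarrow> q x = Q x"
  shows "weighted_energy Q \<nu> = energy (distr \<nu> borel (\<lambda>x. x)) (distr \<nu> borel (\<lambda>x. x)) + 2 * (\<integral>\<^sup>+x. q x \<partial>distr \<nu> borel (\<lambda>x. x))"
proof -
  note m = sphere_prob_measurable(1)[OF \<nu>]
  let ?N = "distr \<nu> borel (\<lambda>x. x)"
  have "prob_space \<nu>" using \<nu> by (simp add: sphere_prob_def)
  then have fin: "finite_measure ?N" by (intro prob_space.finite_measure prob_space.prob_space_distr m)
  have [measurable]: "potential ?N \<in> borel_measurable borel" by (rule measurable_potential[OF fin]) simp
  have pot: "potential ?N x = (\<integral>\<^sup>+y. newton_kernel x y \<partial>\<nu>)" for x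
    unfolding potential_def by (rule nn_integral_distr[OF m]) measurable
  have "energy ?N ?N = (\<integral>\<^sup>+x. potential ?N x \<partial>\<nu>)"
    unfolding energy_def by (rule nn_integral_distr[OF m]) measurable
  then have "energy ?N ?N = newton_energy \<nu>"
    by (simp only: pot newton_energy_def newton_kernel_def)
  moreover have "(\<integral>\<^sup>+x. q x \<partial>?N) = (\<integral>\<^sup>+x. Q x \<partial>\<nu>)"
  proof -
    have "(\<integral>\<^sup>+x. q x \<partial>?N) = (\<integral>\<^sup>+x. q x \<partial>\<nu>)" by (rule nn_integral_distr[OF m]) measurable
    also have "\<dots> = (\<integral>\<^sup>+x. Q x \<partial>\<nu>)"
      by (intro nn_integral_cong) (simp add: q sphere_prob_measurable(2)[OF \<nu>])
    finally show ?thesis .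
  qed
  ultimately show ?thesis by (simp add: weighted_energy_def)
qed

lemma sphere_prob_restrict_space:
  fixes N :: "'a::euclidean_space measure"
  assumes N: "prob_space N" "sets N = sets borel" "AE x in N. norm x = 1"
  shows "sphere_prob (restrict_space N usphere)" "distr (restrict_space N usphere) borel (\<lambda>x. x) = N"
proof -
  interpret prob_space N by fact
  have S: "usphere \<in> sets N" using N by simp
  have ae: "AE x in N. x \<in> usphere" using N(3) by simp
  have "emeasure N usphere = 1" using S ae by (simp add: emeasure_eq_1_AE)
  then have "prob_space (restrict_space N usphere)" using S by (intro prob_space_restrict_space) auto
  moreover have "sets (restrict_space N usphere) = sets (restrict_space borel usphere)"
    by (rule sets_restrict_space_cong[OF N(2)])
  ultimately show sp: "sphere_prob (restrict_space N usphere)" by (simp add: sphere_prob_def)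
  show "distr (restrict_space N usphere) borel (\<lambda>x. x) = N"
  proof (rule measure_eqI)
    fix A assume "A \<in> sets (distr (restrict_space N usphere) borel (\<lambda>x. x))"
    then have A: "A \<in> sets borel" by simp
    have "emeasure (distr (restrict_space N usphere) borel (\<lambda>x. x)) A = emeasure (restrict_space N usphere) (A \<inter> usphere)"
      using A sphere_prob_measurable[OF sp] by (simp add: emeasure_distr)
    also have "\<dots> = emeasure N (A \<inter> usphere)" using S by (intro emeasure_restrict_space) auto
    also have "\<dots> = emeasure N A"
      using A N(2) ae by (intro emeasure_eq_AE) auto
    finally show "emeasure (distr (restrict_space N usphere) borel (\<lambda>x. x)) A = emeasure N A" .
  qed (simp add: N)
qed

text \<open>The complement of the support in the sphere is covered by open sets of measure 0, and
  countably many of them suffice by Lindelof's theorem.\<close>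

lemma AE_measure_support:
  fixes \<mu> :: "'a::euclidean_space measure"
  assumes \<mu>: "sphere_prob \<mu>"
  shows "AE x in distr \<mu> borel (\<lambda>x. x). x \<in> measure_support \<mu>"
proof -
  note m = sphere_prob_measurable[OF \<mu>]
  let ?M = "distr \<mu> borel (\<lambda>x. x)"
  let ?F = "{U. open U \<and> emeasure \<mu> (U \<inter> usphere) = 0}"
  have e: "emeasure ?M U = emeasure \<mu> (U \<inter> usphere)" if "U \<in> sets borel" for U
    using that m by (simp add: emeasure_distr)
  obtain F' where F': "F' \<subseteq> ?F" "countable F'" "\<Union>F' = \<Union>?F"
    using Lindelof[of ?F] by auto
  have "(\<Union>U\<in>F'. U) \<in> null_sets ?M"
  proof (rule null_sets_UN')
    fix U assume "U \<in> F'"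
    then show "U \<in> null_sets ?M" using F'(1) e[of U] by (auto simp: null_sets_def)
  qed fact
  moreover have "- usphere \<in> null_sets ?M"
    using e[of "- usphere"] by (auto simp: null_sets_def)
  ultimately have "(\<Union>U\<in>F'. U) \<union> - usphere \<in> null_sets ?M" by (rule null_sets.Un)
  moreover have "- measure_support \<mu> \<subseteq> (\<Union>U\<in>F'. U) \<union> - usphere"
  proof
    fix x assume x: "x \<in> - measure_support \<mu>"
    show "x \<in> (\<Union>U\<in>F'. U) \<union> - usphere"
    proof (cases "x \<in> usphere")
      case True
      then obtain U where "open U" "x \<in> U" "\<not> emeasure \<mu> (U \<inter> usphere) > 0"
        using x unfolding measure_support_def m(2) by auto
      then have "x \<in> \<Union>?F" by auto
      then show ?thesis using F'(3) by auto
    qed simp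
  qed
  ultimately show ?thesis by (auto simp: eventually_ae_filter)
qed

text \<open>Minimality is carried over between the two kinds of measures. Finiteness of the energy
  comes from a competitor: normalised surface measure on a set of positive area where the field is
  bounded.\<close>

lemma extremal_measure_sphere_equilibrium:
  fixes Q :: "real ^ 'n \<Rightarrow> ennreal"
  assumes n: "CARD('n) \<ge> 3" and Q: "external_field Q" and \<mu>: "extremal_measure Q \<mu>"
    and q [measurable]: "q \<in> borel_measurable borel" "\<And>x. x \<in> usphere \<Longrightarrow> q x = Q x"
  shows "sphere_equilibrium (distr \<mu> borel (\<lambda>x. x)) q"
proof -
  let ?M = "distr \<mu> borel (\<lambda>x. x)" and ?\<sigma> = "sphere_area :: (real ^ 'n) measure"
  have sp: "sphere_prob \<mu>" using \<mu> by (simp add: extremal_measure_def)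
  note m = sphere_prob_measurable[OF sp]
  interpret \<sigma>: finite_measure ?\<sigma> by (rule finite_measure_sphere_area)
  have minimal: "energy ?M ?M + 2 * (\<integral>\<^sup>+x. q x \<partial>?M) \<le> energy N N + 2 * (\<integral>\<^sup>+x. q x \<partial>N)"
    if N: "prob_space N" "sets N = sets borel" "AE x in N. norm x = 1" for N
  proof -
    have "energy ?M ?M + 2 * (\<integral>\<^sup>+x. q x \<partial>?M) = weighted_energy Q \<mu>"
      by (rule weighted_energy_distr[OF sp q, symmetric])
    also have "\<dots> = min_energy Q" using \<mu> by (simp add: extremal_measure_def)
    also have "\<dots> \<le> weighted_energy Q (restrict_space N usphere)"
      unfolding min_energy_def by (rule INF_lower) (simp add: sphere_prob_restrict_space(1)[OF N])
    also have "\<dots> = energy N N + 2 * (\<integral>\<^sup>+x. q x \<partial>N)"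
      using weighted_energy_distr[OF sphere_prob_restrict_space(1)[OF N] q] by (simp only: sphere_prob_restrict_space(2)[OF N])
    finally show ?thesis .
  qed
  \<comment> \<open>The set where \<open>Q\<close> is finite is the countable union of the sets
    where it is at most \<open>l\<close>, so one of these has positive area.\<close>
  have "\<exists>l::nat. emeasure ?\<sigma> {x \<in> usphere. q x \<le> of_nat l} \<noteq> 0"
  proof (rule ccontr)
    assume *: "\<nexists>l::nat. emeasure ?\<sigma> {x \<in> usphere. q x \<le> of_nat l} \<noteq> 0"
    have [measurable]: "{x \<in> usphere. q x \<le> of_nat l} \<in> sets borel" for l
    proof -
      have "{x \<in> usphere. q x \<le> of_nat l} = {x. norm x = 1 \<and> q x \<le> of_nat l}" by auto
      then show ?thesis by simp
    qed
    have "(\<Union>l. {x \<in> usphere. q x \<le> of_nat l}) \<in> null_sets ?\<sigma>"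
      using * by (intro null_sets_UN) (auto simp: null_sets_def)
    moreover have "(\<Union>l. {x \<in> usphere. q x \<le> of_nat l}) = {x \<in> usphere. Q x < \<infinity>}"
    proof
      show "(\<Union>l. {x \<in> usphere. q x \<le> of_nat l}) \<subseteq> {x \<in> usphere. Q x < \<infinity>}"
        using q(2) by (auto intro: le_less_trans simp: ennreal_of_nat_eq_real_of_nat)
      show "{x \<in> usphere. Q x < \<infinity>} \<subseteq> (\<Union>l. {x \<in> usphere. q x \<le> of_nat l})"
      proof
        fix x assume x: "x \<in> {x \<in> usphere. Q x < \<infinity>}"
        then obtain r where r: "Q x = ennreal r" "r \<ge> 0" by (cases "Q x") auto
        obtain l :: nat where "r \<le> l" using real_arch_simple by blast
        then have "Q x \<le> of_nat l" unfolding r ennreal_of_nat_eq_real_of_nat by (rule ennreal_leI)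
        then show "x \<in> (\<Union>l. {x \<in> usphere. q x \<le> of_nat l})" using x q(2) by auto
      qed
    qed
    ultimately have null: "{x \<in> usphere. Q x < \<infinity>} \<in> null_sets ?\<sigma>" by simp
    then have "emeasure ?\<sigma> {x \<in> usphere. Q x < \<infinity>} = 0" "{x \<in> usphere. Q x < \<infinity>} \<in> sets borel"
      by (auto simp: null_sets_def)
    moreover have "{x \<in> usphere. Q x < \<infinity>} \<inter> usphere = {x \<in> usphere. Q x < \<infinity>}" by auto
    ultimately have "emeasure surface_measure {x \<in> usphere. Q x < \<infinity>} = 0"
      by (simp only: emeasure_sphere_area_eq)
    then show False using Q by (simp add: external_field_def)
  qed
  then obtain l :: nat where l: "emeasure ?\<sigma> {x \<in> usphere. q x \<le> of_nat l} \<noteq> 0" by blast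
  define A where "A = {x :: real ^ 'n. norm x = 1 \<and> q x \<le> of_nat l}"
  have A [measurable]: "A \<in> sets borel" unfolding A_def by measurable
  have "{x \<in> usphere. q x \<le> of_nat l} = A" by (auto simp: A_def)
  then have pos: "emeasure ?\<sigma> A \<noteq> 0" using l by simp
  let ?N = "uniform_measure ?\<sigma> A"
  have finite: "energy ?M ?M + 2 * (\<integral>\<^sup>+x. q x \<partial>?M) < \<infinity>"
  proof -
    have "energy ?M ?M + 2 * (\<integral>\<^sup>+x. q x \<partial>?M) \<le> energy ?N ?N + 2 * (\<integral>\<^sup>+x. q x \<partial>?N)"
    proof (rule minimal)
      show "prob_space ?N" using pos by (intro prob_space_uniform_measure) (auto simp: \<sigma>.emeasure_finite)
      show "AE x in ?N. norm x = 1" by (intro AE_uniform_measureI) (auto simp: A_def)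
    qed simp
    also have "\<dots> < \<infinity>"
    proof -
      have "energy ?N ?N \<le> energy ?\<sigma> ?\<sigma> / emeasure ?\<sigma> A / emeasure ?\<sigma> A"
        by (rule energy_uniform_measure_le) (use pos A \<sigma>.finite_measure_axioms in auto)
      also have "\<dots> < \<infinity>"
        using energy_sphere_area[OF n] pos by (auto simp: less_top[symmetric] ennreal_divide_eq_top_iff)
      finally have "energy ?N ?N < \<infinity>" .
      moreover have "(\<integral>\<^sup>+x. q x \<partial>?N) < \<infinity>"
      proof -
        have "(\<integral>\<^sup>+x. q x \<partial>?N) = (\<integral>\<^sup>+x. q x * indicator A x \<partial>?\<sigma>) / emeasure ?\<sigma> A"
          by (rule nn_integral_uniform_measure) auto
        also have "\<dots> \<le> (\<integral>\<^sup>+x. of_nat l * indicator A x \<partial>?\<sigma>) / emeasure ?\<sigma> A"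
          by (intro divide_right_mono_ennreal nn_integral_mono) (auto simp: A_def indicator_def)
        also have "\<dots> = of_nat l"
          using pos by (subst nn_integral_cmult_indicator) (auto simp: ennreal_mult_divide_eq \<sigma>.emeasure_finite)
        also have "\<dots> < \<infinity>" by (simp add: ennreal_of_nat_eq_real_of_nat)
        finally show ?thesis .
      qed
      ultimately show ?thesis by (simp add: ennreal_mult_less_top)
    qed
    finally show ?thesis .
  qed
  show ?thesis
  proof (rule sphere_equilibrium.intro)
    show "prob_space ?M" using sp m(1) by (intro prob_space.prob_space_distr) (simp_all add: sphere_prob_def)
    show "AE x in ?M. norm x = 1"
      by (subst AE_distr_iff[OF m(1)]) (auto simp: m(2) intro!: AE_I2)
  qed (use n q finite minimal in auto)
qed

theorem theorem1p2:
  fixes k :: "'n::finite"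
    and Q :: "real ^ 'n \<Rightarrow> ennreal"
    and \<mu> :: "(real ^ 'n) measure"
    and \<alpha> :: real
    and N :: "(real ^ 'n) set"
  assumes "CARD('n) \<ge> 3"
    and "external_field Q"
    and "rotationally_invariant k Q"
    and "extremal_measure Q \<mu>"
    and "0 < \<alpha>" and "\<alpha> \<le> pi"
    and "measure_support \<mu> = south_cap k \<alpha>"
    and "openin (top_of_set usphere) N" and "south_cap k \<alpha> \<subseteq> N"
    and "\<forall>x\<in>N. Q x < \<infinity>"
    and "C2_on_submanifold N (\<lambda>x. enn2real (Q x))"
  shows "absolutely_continuous surface_measure \<mu> \<and>
    (\<exists>f :: real \<Rightarrow> real.
       ess_bounded (restrict_space lborel {\<alpha>..pi}) f \<and>
       (\<forall>t\<in>{\<alpha>..pi}. 0 \<le> f t) \<and>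
       \<mu> = density surface_measure
             (\<lambda>x. ennreal (f (polar_angle k x)) * indicator (south_cap k \<alpha>) x))"
proof -
  let ?M = "distr \<mu> borel (\<lambda>x. x)" and ?cap = "south_cap k \<alpha>"
  \<comment> \<open>Extension by 0 keeps every superlevel set inside the sphere, as
    \<open>a \<ge> 0\<close> in \<open>ennreal\<close>; these sets are relatively open, so
    \<open>q\<close> is Borel.\<close>
  define q where "q x = (if x \<in> usphere then Q x else 0)" for x
  have sp: "sphere_prob \<mu>" using assms(4) by (simp add: extremal_measure_def)
  note m = sphere_prob_measurable[OF sp]
  have q_gt: "\<exists>W. open W \<and> {x. a < q x} = usphere \<inter> W" for a
  proof -
    have "openin (top_of_set usphere) {x \<in> usphere. a < Q x}" using assms(2) by (simp add: external_field_def)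
    moreover have "{x. a < q x} = {x \<in> usphere. a < Q x}" by (auto simp: q_def)
    ultimately show ?thesis unfolding openin_open by simp
  qed
  have q: "q \<in> borel_measurable borel"
  proof (rule borel_measurableI_greater)
    fix a
    obtain W where "open W" "{x. a < q x} = usphere \<inter> W" using q_gt by blast
    then show "{x \<in> space borel. a < q x} \<in> sets borel" by simp
  qed
  have qQ: "x \<in> usphere \<Longrightarrow> q x = Q x" for x by (simp add: q_def)
  interpret E: sphere_equilibrium ?M q
    by (rule extremal_measure_sphere_equilibrium[OF assms(1,2,4) q qQ])
  have cap: "?cap = {x. norm x = 1 \<and> x $ k \<le> cos \<alpha>}"
  proof -
    have "\<alpha> \<le> arccos (x $ k) \<and> arccos (x $ k) \<le> pi \<longleftrightarrow> x $ k \<le> cos \<alpha>" if "norm x = 1" for x :: "real ^ 'n"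
    proof -
      have b: "-1 \<le> x $ k" "x $ k \<le> 1" using component_le_norm_cart[of x k] that by auto
      have "\<alpha> \<le> arccos (x $ k) \<longleftrightarrow> cos (arccos (x $ k)) \<le> cos \<alpha>"
        using b assms(5,6) arccos_lbound arccos_ubound by (intro cos_mono_le_eq[symmetric]) auto
      then show ?thesis using b arccos_ubound by simp
    qed
    then show ?thesis by (auto simp: south_cap_def polar_angle_def)
  qed
  have "closed ?cap"
  proof -
    have "?cap = usphere \<inter> {x. x $ k \<le> cos \<alpha>}" by (auto simp: cap)
    then show ?thesis by (auto intro!: closed_Int closed_Collect_le continuous_intros)
  qed
  then have "compact ?cap" by (intro compact_eq_bounded_closed[THEN iffD2] conjI) (auto simp: cap intro!: boundedI[of _ 1])
  have cap_measurable [measurable]: "?cap \<in> sets borel" using \<open>closed ?cap\<close> by simp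
  have ae_cap: "AE x in ?M. x \<in> ?cap" using AE_measure_support[OF sp] by (simp only: assms(7))
  have cap_le: "potential ?M x + q x \<le> E.level" if x: "x \<in> ?cap" for x
  proof (rule E.potential_plus_field_le_level)
    fix U :: "(real ^ 'n) set" assume U: "open U" "x \<in> U"
    have "x \<in> measure_support \<mu>" using x assms(7) by simp
    then have "emeasure \<mu> (U \<inter> space \<mu>) > 0" using U by (simp add: measure_support_def)
    then show "emeasure ?M U > 0" using U m by (simp add: emeasure_distr)
  next
    fix a assume "a < q x"
    moreover obtain W where W: "open W" "{x. a < q x} = usphere \<inter> W" using q_gt by blast
    ultimately show "\<exists>W. open W \<and> x \<in> W \<and> (\<forall>x\<in>W. norm x = 1 \<longrightarrow> a < q x)"
      by (intro exI[of _ W]) (auto simp: set_eq_iff)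
  qed
  obtain C \<delta> where C: "C \<ge> 0" "\<delta> > 0"
    and Cb: "\<And>x0 x. x0 \<in> ?cap \<Longrightarrow> norm x = 1 \<Longrightarrow> norm (x - x0) < \<delta> \<Longrightarrow>
      x \<in> N \<and> - reflection x0 x \<in> N \<and>
      enn2real (Q x) + enn2real (Q (- reflection x0 x)) \<le> 2 * enn2real (Q x0) + C * (norm (x - x0))\<^sup>2"
    using C2_reflection_bound[OF assms(8) \<open>compact ?cap\<close> assms(9,11)] by blast
  have N_sphere: "N \<subseteq> usphere" using assms(8) openin_imp_subset by blast
  have qN: "q x = ennreal (enn2real (Q x))" if "x \<in> N" for x
    using assms(10) that N_sphere by (auto simp: q_def)
  have second_difference: "q x + q (- reflection x0 x) \<le> 2 * q x0 + ennreal (C * (norm (x - x0))\<^sup>2)"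
    if x0: "x0 \<in> ?cap" and x: "norm x = 1" "norm (x - x0) < \<delta>" for x0 x
  proof -
    have N: "x \<in> N" "- reflection x0 x \<in> N" "x0 \<in> N" using Cb[OF x0 x] x0 assms(9) by auto
    have "q x + q (- reflection x0 x) = ennreal (enn2real (Q x) + enn2real (Q (- reflection x0 x)))"
      by (simp add: qN N)
    also have "\<dots> \<le> ennreal (2 * enn2real (Q x0) + C * (norm (x - x0))\<^sup>2)"
      using Cb[OF x0 x] by (intro ennreal_leI) simp
    also have "\<dots> = 2 * q x0 + ennreal (C * (norm (x - x0))\<^sup>2)"
      using C by (simp add: qN N ennreal_mult)
    finally show ?thesis .
  qed
  have cap_sphere: "norm x = 1" if "x \<in> ?cap" for x using that by (simp add: cap)
  have "\<exists>B\<ge>0. \<forall>A\<in>sets borel. emeasure ?M A \<le> ennreal B * emeasure sphere_area A"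
    by (rule E.le_sphere_area[OF C ae_cap cap_sphere cap_le second_difference]) blast+
  then obtain B where B: "B \<ge> 0" "\<And>A. A \<in> sets borel \<Longrightarrow> emeasure ?M A \<le> ennreal B * emeasure sphere_area A"
    by blast
  \<comment> \<open>A reflection is not a rotation, but mirror images have the same height, and some
    rotation about the axis joins them because the dimension is at least 3. Hence \<open>Q\<close>
    is invariant under the reflection.\<close>
  have "axial_invariant k ?M"
    unfolding axial_invariant_def
  proof (intro allI impI)
    fix w :: "real ^ 'n" assume w: "w $ k = 0"
    show "distr ?M borel (reflection w) = ?M"
    proof (rule E.distr_eq_of_invariant[OF orthogonal_transformation_reflection])
      fix x :: "real ^ 'n" assume "norm x = 1"
      then show "q (reflection w x) = q x"
        using rotationally_invariant_eq[OF assms(1,3), of "reflection w x" x]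
        by (simp add: q_def reflection_component[OF w])
    qed
  qed
  then obtain h where h [measurable]: "h \<in> borel_measurable borel" and h_bounds: "\<And>t. 0 \<le> h t" "\<And>t. h t \<le> max 0 B"
    and Mh: "?M = density sphere_area (\<lambda>x. ennreal (h (x $ k)))"
    using axial_density[OF assms(1) E.finite_measure_axioms E.sets_M E.sphere_M _ B(2)] by blast
  \<comment> \<open>The height is the cosine of the polar angle, so \<open>f\<close> will be
    \<open>h\<close> composed with \<open>cos\<close>. The cap carries all the mass, so its
    indicator may be inserted.\<close>
  have \<mu>_eq: "\<mu> = density surface_measure (\<lambda>x. ennreal (h (cos (polar_angle k x))) * indicator ?cap x)"
    (is "_ = ?D")
  proof (rule measure_eqI)
    have s: "sets \<mu> = sets (restrict_space borel usphere)" using sp by (simp add: sphere_prob_def)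
    then show "sets \<mu> = sets ?D" by simp
    fix A assume A: "A \<in> sets \<mu>"
    then have A_sphere: "A \<subseteq> usphere" and A_borel [measurable]: "A \<in> sets borel"
      using s by (auto simp: sets_restrict_space_iff)
    note id = measurable_id_surface_measure
    have cos: "cos (polar_angle k x) = x $ k" if "x \<in> usphere" for x
      using component_le_norm_cart[of x k] that by (simp add: polar_angle_def cos_arccos_abs)
    have "emeasure \<mu> A = emeasure ?M A"
      using A_sphere m by (simp add: emeasure_distr Int_absorb2)
    also have "\<dots> = emeasure ?M (A \<inter> ?cap)"
      using ae_cap by (intro emeasure_eq_AE) auto
    also have "\<dots> = (\<integral>\<^sup>+x. ennreal (h (x $ k)) * indicator (A \<inter> ?cap) x \<partial>sphere_area)"
      unfolding Mh by (rule emeasure_density) simp_all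
    also have "\<dots> = (\<integral>\<^sup>+x. ennreal (h (x $ k)) * indicator (A \<inter> ?cap) x \<partial>surface_measure)"
      unfolding sphere_area_def by (rule nn_integral_distr[OF id]) simp
    also have "\<dots> = (\<integral>\<^sup>+x. ennreal (h (cos (polar_angle k x))) * indicator ?cap x * indicator A x \<partial>surface_measure)"
    proof (rule nn_integral_cong)
      fix x :: "real ^ 'n" assume "x \<in> space surface_measure"
      then have "cos (polar_angle k x) = x $ k" by (intro cos) simp
      then show "ennreal (h (x $ k)) * indicator (A \<inter> ?cap) x = ennreal (h (cos (polar_angle k x))) * indicator ?cap x * indicator A x"
        by (simp add: indicator_def)
    qed
    also have "\<dots> = emeasure ?D A"
    proof (rule emeasure_density[symmetric])
      have "(\<lambda>x. ennreal (h (x $ k)) * indicator ?cap x) \<in> borel_measurable borel" by measurable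
      then have "(\<lambda>x. ennreal (h (x $ k)) * indicator ?cap x) \<in> borel_measurable surface_measure"
        by (rule measurable_compose[OF id])
      moreover have "(\<lambda>x. ennreal (h (cos (polar_angle k x))) * indicator ?cap x) \<in> borel_measurable surface_measure \<longleftrightarrow>
        (\<lambda>x. ennreal (h (x $ k)) * indicator ?cap x) \<in> borel_measurable surface_measure"
      proof (rule measurable_cong)
        fix x :: "real ^ 'n" assume "x \<in> space surface_measure"
        then have "cos (polar_angle k x) = x $ k" by (intro cos) simp
        then show "ennreal (h (cos (polar_angle k x))) * indicator ?cap x = ennreal (h (x $ k)) * indicator ?cap x"
          by simp
      qed
      ultimately show "(\<lambda>x. ennreal (h (cos (polar_angle k x))) * indicator ?cap x) \<in> borel_measurable surface_measure"
        by (rule iffD2[rotated])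
      show "A \<in> sets surface_measure" using A s by simp
    qed
    finally show "emeasure \<mu> A = emeasure ?D A" .
  qed
  have "absolutely_continuous surface_measure \<mu>"
    unfolding absolutely_continuous_def
  proof
    fix X :: "(real ^ 'n) set" assume "X \<in> null_sets surface_measure"
    then have X: "X \<in> sets (restrict_space borel usphere)" "emeasure surface_measure X = 0" by (auto simp: null_sets_def)
    then have X': "X \<subseteq> usphere" "X \<in> sets borel" by (auto simp: sets_restrict_space_iff)
    have "emeasure \<mu> X = emeasure ?M X"
      using X' m by (simp add: emeasure_distr Int_absorb2)
    also have "\<dots> \<le> ennreal B * emeasure sphere_area X" by (rule B(2)[OF X'(2)])
    also have "\<dots> = 0" using X X' by (simp add: emeasure_sphere_area_eq Int_absorb2)
    finally show "X \<in> null_sets \<mu>" using X(1) sp by (simp add: null_sets_def sphere_prob_def)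
  qed
  moreover have "ess_bounded (restrict_space lborel {\<alpha>..pi}) (\<lambda>t. h (cos t))"
    unfolding ess_bounded_def
  proof
    show "(\<lambda>t. h (cos t)) \<in> borel_measurable (restrict_space lborel {\<alpha>..pi})"
      by (rule measurable_restrict_space1) measurable
    show "\<exists>B. AE t in restrict_space lborel {\<alpha>..pi}. \<bar>h (cos t)\<bar> \<le> B"
      using h_bounds by (intro exI[of _ "max 0 B"] AE_I2) simp
  qed
  ultimately show ?thesis
    using \<mu>_eq h_bounds(1) by (intro conjI exI[of _ "\<lambda>t. h (cos t)"]) auto
qed

end
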